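(* Fix a NETSOR$^-$ program (as in the context) with all dimensions $n$, sampled as in the context, and with all nonlinearities controlled. Let $g^1,\dots,g^M$ be all its G-vars (including inputs). Then for every controlled $\psi:\mathbb{R}^M\to\mathbb{R}$, as $n\to\infty$, $\frac1n\sum_{\alpha=1}^n\psi(g^1_\alpha,\dots,g^M_\alpha)\xrightarrow{\text{a.s.}}\mathbb{E}_{Z\sim\mathcal N(\mu,\Sigma)}\psi(Z^{g^1},\dots,Z^{g^M})$, with $\mu,\Sigma$ as in the context.
   Context: A NETSOR$^-$ program is a finite straight-line program with G-vars, H-vars (vectors; G-vars are also H-vars) and A-vars (matrices), starting from input G-vars and A-vars, in which new variables are introduced only by: (MatMul) $A:\mathsf A(n_1,n_2)$, $x:\mathsf H(n_2)$ gives $Ax:\mathsf G(n_1)$; (Nonlin) $x^1,\dots,x^k:\mathsf G(n)$ and $\phi:\mathbb{R}^k\to\mathbb{R}$ give $\phi(x^1,\dots,x^k):\mathsf H(n)$ coordinatewise. Sampling: all dimensions $n$; each A-var $W$ has iid $\mathcal N(0,\sigma_W^2/n)$ entries, $\sigma_W^2>0$; $(x_\alpha)_{x\text{ input G-var}}$ iid over $\alpha\in[n]$ with law $\mathcal N(\mu^{in},\Sigma^{in})$ (covariance possibly singular); A-vars and input G-vars independent. Controlled: $|\phi(x)|\le e^{C\|x\|^{2-\epsilon}+c}$ for some $C,c,\epsilon>0$. $\mu(g)=\mu^{in}(g)$ if $g$ is input, else $0$. $\Sigma(g,g')=\Sigma^{in}(g,g')$ if both are inputs; $\sigma_W^2\mathbb{E}_{Z\sim\mathcal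 N(\mu,\Sigma)}\phi(Z)\bar\phi(Z)$ if $g=Wh,g'=Wh'$ via MatMul with the same A-var $W$, where $h=\phi(g^1,\dots,g^M)$, $h'=\bar\phi(g^1,\dots,g^M)$ are the defining expressions (coordinate projection if $h$ is a G-var); $0$ otherwise. *)

theory Defs
  imports "HOL-Probability.Probability"
begin

definition cov_matrix :: "'i set \<Rightarrow> ('i \<Rightarrow> 'i \<Rightarrow> real) \<Rightarrow> bool" where
  "cov_matrix I S \<longleftrightarrow> finite I \<and> (\<forall>i\<in>I. \<forall>j\<in>I. S i j = S j i) \<and>
     (\<forall>v. 0 \<le> (\<Sum>i\<in>I. \<Sum>j\<in>I. v i * S i j * v j))"

definition gaussian_vec :: "'i set \<Rightarrow> ('i \<Rightarrow> real) \<Rightarrow> ('i \<Rightarrow> 'i \<Rightarrow> real) \<Rightarrow> ('i \<Rightarrow> real) measure" where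
  "gaussian_vec I mu S =
     (let L = (SOME L. \<forall>i\<in>I. \<forall>j\<in>I. S i j = (\<Sum>k\<in>I. L i k * L j k))
      in distr (PiM I (\<lambda>_. density lborel std_normal_density)) (PiM I (\<lambda>_. borel))
               (\<lambda>z. \<lambda>i\<in>I. mu i + (\<Sum>k\<in>I. L i k * z k)))"

definition list_norm :: "real list \<Rightarrow> real" where
  "list_norm x = sqrt (\<Sum>t\<leftarrow>x. t\<^sup>2)"

definition controlled :: "nat \<Rightarrow> (real list \<Rightarrow> real) \<Rightarrow> bool" where
  "controlled k f \<longleftrightarrow> (\<exists>C c \<epsilon>. C > 0 \<and> c > 0 \<and> \<epsilon> > 0 \<and> \<epsilon> < 2 \<and>
      (\<forall>x. length x = k \<longrightarrow> \<bar>f x\<bar> \<le> exp (C * list_norm x powr (2 - \<epsilon>) + c)))"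

definition borel_fun :: "nat \<Rightarrow> (real list \<Rightarrow> real) \<Rightarrow> bool" where
  "borel_fun k f \<longleftrightarrow> (\<lambda>x. f (map x [0..<k])) \<in> borel_measurable (PiM {..<k} (\<lambda>_. borel))"

text \<open>Variables are numbered: 0..<m are the input G-vars; instruction i of the list
  defines variable m+i.  A-vars are numbered 0..<nA.
  MatMul a x : G-var  W_a x  (x any earlier variable, every variable being an H-var);
  Nonlin phi [g1,...,gk] : H-var phi(g1,...,gk) coordinatewise (gj earlier G-vars).\<close>
datatype instr = MatMul nat nat | Nonlin "real list \<Rightarrow> real" "nat list"

definition is_matmul :: "instr \<Rightarrow> bool" where
  "is_matmul p = (case p of MatMul _ _ \<Rightarrow> True | Nonlin _ _ \<Rightarrow> False)"

definition isG :: "instr list \<Rightarrow> nat \<Rightarrow> nat \<Rightarrow> bool" where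
  "isG ps m v \<longleftrightarrow> v < m \<or> (m \<le> v \<and> v < m + length ps \<and> is_matmul (ps ! (v - m)))"

definition wf_prog :: "nat \<Rightarrow> nat \<Rightarrow> instr list \<Rightarrow> bool" where
  "wf_prog m nA ps \<longleftrightarrow> (\<forall>i<length ps. case ps ! i of
      MatMul a x \<Rightarrow> a < nA \<and> x < m + i
    | Nonlin f args \<Rightarrow> (\<forall>u\<in>set args. u < m + i \<and> isG ps m u) \<and>
                       controlled (length args) f \<and> borel_fun (length args) f)"

definition gvars :: "instr list \<Rightarrow> nat \<Rightarrow> nat list" where
  "gvars ps m = filter (isG ps m) [0..<m + length ps]"

text \<open>Wo a i j: entry (i,j) of A-var a; vectors are functions on the coordinate set {..<n}.\<close>
fun step :: "nat \<Rightarrow> (nat \<Rightarrow> nat \<Rightarrow> nat \<Rightarrow> real) \<Rightarrow> (nat \<Rightarrow> real) list \<Rightarrow> instr \<Rightarrow> (nat \<Rightarrow> real)" where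
  "step n Wo vs (MatMul a x) = (\<lambda>\<alpha>. \<Sum>\<beta><n. Wo a \<alpha> \<beta> * (vs ! x) \<beta>)"
| "step n Wo vs (Nonlin f args) = (\<lambda>\<alpha>. f (map (\<lambda>u. (vs ! u) \<alpha>) args))"

primrec run :: "instr list \<Rightarrow> nat \<Rightarrow> (nat \<Rightarrow> nat \<Rightarrow> nat \<Rightarrow> real) \<Rightarrow> (nat \<Rightarrow> real) list \<Rightarrow> (nat \<Rightarrow> real) list" where
  "run [] n Wo vs = vs"
| "run (p # ps) n Wo vs = run ps n Wo (vs @ [step n Wo vs p])"

text \<open>Values of all variables (list indexed by variable number), given the A-vars Wo
  and the input G-vars Xo (Xo k alpha = coordinate alpha of input k).\<close>
definition prog_vals :: "instr list \<Rightarrow> nat \<Rightarrow> nat \<Rightarrow> (nat \<Rightarrow> nat \<Rightarrow> nat \<Rightarrow> real) \<Rightarrow> (nat \<Rightarrow> nat \<Rightarrow> real) \<Rightarrow> (nat \<Rightarrow> real) list" where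
  "prog_vals ps m n Wo Xo = run ps n Wo (map Xo [0..<m])"

definition sampled :: "'w measure \<Rightarrow> nat \<Rightarrow> nat \<Rightarrow> nat \<Rightarrow> (nat \<Rightarrow> real) \<Rightarrow> (nat \<Rightarrow> nat \<Rightarrow> real)
     \<Rightarrow> (nat \<Rightarrow> real) \<Rightarrow> (nat \<Rightarrow> 'w \<Rightarrow> nat \<Rightarrow> nat \<Rightarrow> real) \<Rightarrow> ('w \<Rightarrow> nat \<Rightarrow> nat \<Rightarrow> real) \<Rightarrow> bool" where
  "sampled M n m nA mu_in S_in sW2 W X \<longleftrightarrow>
     (\<forall>a<nA. \<forall>i<n. \<forall>j<n.
        (\<lambda>\<omega>. W a \<omega> i j) \<in> borel_measurable M \<and>
        distr M borel (\<lambda>\<omega>. W a \<omega> i j) = density lborel (normal_density 0 (sqrt (sW2 a / real n)))) \<and>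
     (\<forall>\<alpha><n.
        (\<lambda>\<omega>. \<lambda>k\<in>{..<m}. X \<omega> k \<alpha>) \<in> measurable M (PiM {..<m} (\<lambda>_. borel)) \<and>
        distr M (PiM {..<m} (\<lambda>_. borel)) (\<lambda>\<omega>. \<lambda>k\<in>{..<m}. X \<omega> k \<alpha>) = gaussian_vec {..<m} mu_in S_in) \<and>
     prob_space.indep_vars M
        (\<lambda>t. PiM {..<(case t of Inl _ \<Rightarrow> 1 | Inr _ \<Rightarrow> m)} (\<lambda>_. borel :: real measure))
        (\<lambda>t \<omega>. case t of Inl (a, i, j) \<Rightarrow> (\<lambda>_\<in>{..<1::nat}. W a \<omega> i j)
                       | Inr \<alpha> \<Rightarrow> (\<lambda>k\<in>{..<m}. X \<omega> k \<alpha>))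
        ({Inl (a, i, j) | a i j. a < nA \<and> i < n \<and> j < n} \<union> {Inr \<alpha> | \<alpha>. \<alpha> < n})"

definition mu_lim :: "nat \<Rightarrow> (nat \<Rightarrow> real) \<Rightarrow> nat \<Rightarrow> real" where
  "mu_lim m mu_in g = (if g < m then mu_in g else 0)"

definition hexpr :: "instr list \<Rightarrow> nat \<Rightarrow> nat \<Rightarrow> (nat \<Rightarrow> real) \<Rightarrow> real" where
  "hexpr ps m v z = (if v < m then z v else
     (case ps ! (v - m) of MatMul _ _ \<Rightarrow> z v | Nonlin f args \<Rightarrow> f (map z args)))"

definition Gbelow :: "instr list \<Rightarrow> nat \<Rightarrow> nat \<Rightarrow> nat set" where
  "Gbelow ps m k = {v. v < k \<and> isG ps m v}"

text \<open>Sig_k: the covariance Sigma restricted to variables < k, computed by the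
  (well-founded) recursion of the definition of Sigma.  The entry Sigma(g,g') with
  max(g,g') = k only involves G-vars < k, whose joint law is N(mu, Sig_k).\<close>
primrec Sig :: "instr list \<Rightarrow> nat \<Rightarrow> (nat \<Rightarrow> real) \<Rightarrow> (nat \<Rightarrow> nat \<Rightarrow> real) \<Rightarrow> (nat \<Rightarrow> real)
     \<Rightarrow> nat \<Rightarrow> nat \<Rightarrow> nat \<Rightarrow> real" where
  "Sig ps m mu_in S_in sW2 0 = (\<lambda>i j. 0)"
| "Sig ps m mu_in S_in sW2 (Suc k) = (\<lambda>i j.
     if i < k \<and> j < k then Sig ps m mu_in S_in sW2 k i j
     else if i \<le> k \<and> j \<le> k then
       (if i < m \<and> j < m then S_in i j
        else if m \<le> i \<and> m \<le> j then
          (case (ps ! (i - m), ps ! (j - m)) of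
             (MatMul a h, MatMul b h') \<Rightarrow>
               (if a = b then sW2 a * (\<integral>z. hexpr ps m h z * hexpr ps m h' z
                   \<partial>gaussian_vec (Gbelow ps m k) (mu_lim m mu_in) (Sig ps m mu_in S_in sW2 k))
                else 0)
           | _ \<Rightarrow> 0)
        else 0)
     else 0)"

definition Sigma_lim :: "instr list \<Rightarrow> nat \<Rightarrow> (nat \<Rightarrow> real) \<Rightarrow> (nat \<Rightarrow> nat \<Rightarrow> real) \<Rightarrow> (nat \<Rightarrow> real)
     \<Rightarrow> nat \<Rightarrow> nat \<Rightarrow> real" where
  "Sigma_lim ps m mu_in S_in sW2 = Sig ps m mu_in S_in sW2 (m + length ps)"

end

theory Submission
  imports Defs
begin

text \<open>
  The proof is an induction over the variables of the program, carrying two statements about the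
  coordinates of the G-vars computed so far: the law of large numbers for controlled functions, and rank
  stability (a property that holds almost surely under the limiting Gaussian law eventually holds for all
  coordinates at once).  The latter is what makes discontinuous test functions and singular limiting
  covariances harmless.

  For a new variable \<open>g = W h\<close>, write \<open>h = \<Sum> c\<^sub>i h\<^sub>i + r\<close> with \<open>r\<close> orthogonal to all vectors \<open>h\<^sub>i\<close> to which the
  same matrix \<open>W\<close> has been applied.  Then \<open>g = \<Sum> c\<^sub>i g\<^sub>i + W r\<close>, and given the past the vector \<open>W r\<close> has iid centred
  Gaussian coordinates of standard deviation proportional to the norm of \<open>r\<close>.  The coefficients and the norm are
  functions of the Gram matrix of the \<open>h\<^sub>i\<close>, so they converge by induction.  If the limiting residual is zero,
  rank stability makes \<open>g\<close> an exact linear combination of earlier variables.  Otherwise a fourth moment bound with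
  Borel-Cantelli replaces \<open>\<psi>(g)\<close> by its conditional mean, and since Gaussian smoothing is continuous in
  mean and variance, the conditional mean may be taken at the limiting coefficients, where induction applies.
\<close>

section \<open>Gram-Schmidt coefficients from a Gram matrix\<close>

text \<open>Two difficulties shape the proof. Test functions are merely measurable and the limiting
  covariance may be singular, so convergence of Gram matrices is too weak: Gram-Schmidt coefficients
  jump where the rank drops. A pivot that vanishes in the limit has to vanish exactly for all large
  \<open>n\<close>, and this concerns every coordinate, not averages; hence a second invariant about
  arbitrary almost sure properties. It survives a step because all nondegenerate normal laws on the
  line have the same null sets.

  The conditional law of a matrix given its earlier products is expressed by an identity of
  integrals: a functional that sees the matrix only through vectors orthogonal to those already
  multiplied keeps its mean when the matrix is redrawn. The identity comes from a change of
  variables that preserves the standard Gaussian measure.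

  The joint law of the programs of different sizes is arbitrary, so each \<open>n\<close> must
  supply its own summable bound; fourth moments give order 1/n^2. Given the past these moments are
  bounded only on average over the coordinates, and that bound comes from the induction hypothesis,
  applied to an envelope.\<close>

definition bil :: "'i set \<Rightarrow> ('i \<Rightarrow> 'i \<Rightarrow> real) \<Rightarrow> ('i \<Rightarrow> real) \<Rightarrow> ('i \<Rightarrow> real) \<Rightarrow> real" where
  "bil J Q u w = (\<Sum>i\<in>J. \<Sum>j\<in>J. u i * Q i j * w j)"

definition unit_at :: "'i \<Rightarrow> 'i \<Rightarrow> real" where
  "unit_at h = (\<lambda>i. if i = h then 1 else 0)"

text \<open>Coefficients of the Gram-Schmidt residual of vector \<open>h\<close> against the vectors in the list,
  computed from the Gram matrix alone; a vanishing pivot contributes nothing because \<open>x / 0 = 0\<close>.\<close>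
primrec resid :: "'i set \<Rightarrow> ('i \<Rightarrow> 'i \<Rightarrow> real) \<Rightarrow> 'i list \<Rightarrow> 'i \<Rightarrow> 'i \<Rightarrow> real" where
  "resid J Q [] h = unit_at h"
| "resid J Q (b # bs) h = (\<lambda>i. resid J Q bs h i
     - bil J Q (resid J Q bs h) (resid J Q bs b) / bil J Q (resid J Q bs b) (resid J Q bs b)
       * resid J Q bs b i)"

definition psd :: "'i set \<Rightarrow> ('i \<Rightarrow> 'i \<Rightarrow> real) \<Rightarrow> bool" where
  "psd J Q \<longleftrightarrow> finite J \<and> (\<forall>i\<in>J. \<forall>j\<in>J. Q i j = Q j i) \<and> (\<forall>u. 0 \<le> bil J Q u u)"

lemma psd_finite: "psd J Q \<Longrightarrow> finite J" by (simp add: psd_def)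

lemma psd_eq_cov_matrix: "psd J Q \<longleftrightarrow> cov_matrix J Q"
  by (simp add: psd_def cov_matrix_def bil_def)

lemma bil_add_left: "bil J Q (\<lambda>i. u i + v i) w = bil J Q u w + bil J Q v w"
  by (simp add: bil_def sum.distrib algebra_simps)

lemma bil_diff_left: "bil J Q (\<lambda>i. u i - v i) w = bil J Q u w - bil J Q v w"
  by (simp add: bil_def sum_subtractf algebra_simps)

lemma bil_scale_left: "bil J Q (\<lambda>i. x * u i) w = x * bil J Q u w"
  by (simp add: bil_def sum_distrib_left mult.assoc)

lemma bil_add_right: "bil J Q u (\<lambda>i. w i + v i) = bil J Q u w + bil J Q u v"
  by (simp add: bil_def sum.distrib algebra_simps)

lemma bil_scale_right: "bil J Q u (\<lambda>i. x * w i) = x * bil J Q u w"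
  by (simp add: bil_def sum_distrib_left algebra_simps)

lemma bil_sym: "psd J Q \<Longrightarrow> bil J Q u w = bil J Q w u"
  unfolding bil_def by (subst sum.swap) (auto intro!: sum.cong simp: psd_def)

lemma bil_unit_right: "finite J \<Longrightarrow> j \<in> J \<Longrightarrow> bil J Q u (unit_at j) = (\<Sum>i\<in>J. u i * Q i j)"
  unfolding bil_def unit_at_def by (auto intro!: sum.cong simp: if_distrib cong: if_cong)

lemma bil_expand_right:
  "finite J \<Longrightarrow> bil J Q u w = (\<Sum>j\<in>J. w j * bil J Q u (unit_at j))"
  by (subst (1) bil_def, subst sum.swap) (auto simp: bil_unit_right sum_distrib_left intro!: sum.cong)

text \<open>Along the line \<open>u + x * w\<close> the form is affine in \<open>x\<close>, because
  the quadratic term vanishes; staying nonnegative forces the slope \<open>2 * bil J Q u w\<close>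
  to be zero. The \<open>x\<close> of the proof would give the value \<open>- 1\<close>.\<close>

lemma psd_null_orthogonal:
  assumes Q: "psd J Q" and w: "bil J Q w w = 0"
  shows "bil J Q u w = 0"
proof (rule ccontr)
  assume n: "bil J Q u w \<noteq> 0"
  define x where "x = - (bil J Q u u + 1) / (2 * bil J Q u w)"
  have "0 \<le> bil J Q (\<lambda>i. u i + x * w i) (\<lambda>i. u i + x * w i)"
    using Q by (auto simp: psd_def)
  also have "\<dots> = bil J Q u u + 2 * x * bil J Q u w"
    using w by (simp add: bil_add_left bil_add_right bil_scale_left bil_scale_right bil_sym[OF Q, of w u])
  also have "\<dots> = - 1" using n by (simp add: x_def field_simps)
  finally show False by simp
qed

lemma resid_support: "i \<noteq> h \<Longrightarrow> i \<notin> set bs \<Longrightarrow> resid J Q bs h i = 0"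
proof (induction bs arbitrary: h)
  case Nil then show ?case by (simp add: unit_at_def)
next
  case (Cons b bs)
  then have "resid J Q bs h i = 0" "resid J Q bs b i = 0" by auto
  then show ?case by simp
qed

lemma resid_self: "h \<notin> set bs \<Longrightarrow> resid J Q bs h h = 1"
proof (induction bs arbitrary: h)
  case Nil then show ?case by (simp add: unit_at_def)
next
  case (Cons b bs)
  then have "resid J Q bs h h = 1" "resid J Q bs b h = 0" by (auto simp: resid_support)
  then show ?case by simp
qed

text \<open>Only the coordinate \<open>b\<close> of the residual survives the pairing, and its
  coefficient is 1. \<open>Q'\<close> is unrelated to \<open>Q\<close>: \<open>resid_tendsto\<close>
  pairs one vector with the residuals of two different Gram matrices.\<close>

lemma bil_resid_right:
  assumes "finite J" "set bs \<subseteq> J" "b \<in> J" "b \<notin> set bs" "\<forall>j\<in>set bs. bil J Q r (unit_at j) = 0"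
  shows "bil J Q r (resid J Q' bs b) = bil J Q r (unit_at b)"
proof -
  have "bil J Q r (resid J Q' bs b) = (\<Sum>j\<in>J. resid J Q' bs b j * bil J Q r (unit_at j))"
    by (rule bil_expand_right) fact
  also have "\<dots> = (\<Sum>j\<in>{b}. resid J Q' bs b j * bil J Q r (unit_at j))"
    using assms by (intro sum.mono_neutral_right) (auto simp: resid_support)
  finally show ?thesis using assms by (simp add: resid_self)
qed

text \<open>The quotient makes the new residual orthogonal to the residual \<open>w\<close> of
  \<open>b\<close>, the induction hypothesis to the older vectors, and
  \<open>bil_resid_right\<close> trades \<open>w\<close> for \<open>b\<close>. At a zero pivot
  nothing is subtracted, but then everything is orthogonal to \<open>w\<close> by
  \<open>psd_null_orthogonal\<close>, so linearly dependent lists are covered.\<close>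

lemma resid_orthogonal:
  assumes Q: "psd J Q" and "set bs \<subseteq> J" "distinct bs" "h \<in> J" "j \<in> set bs"
  shows "bil J Q (resid J Q bs h) (unit_at j) = 0"
  using assms(2-)
proof (induction bs arbitrary: h j)
  case (Cons b bs)
  note fin = psd_finite[OF Q]
  define u where "u = resid J Q bs h"
  define w where "w = resid J Q bs b"
  define r where "r = resid J Q (b # bs) h"
  have r: "r = (\<lambda>i. u i - bil J Q u w / bil J Q w w * w i)"
    by (simp add: r_def u_def w_def)
  have bl: "bil J Q r v = bil J Q u v - bil J Q u w / bil J Q w w * bil J Q w v" for v
    unfolding r bil_diff_left bil_scale_left ..
  have o: "bil J Q r (unit_at j) = 0" if "j \<in> set bs" for j
    using Cons.IH[of h j] Cons.IH[of b j] Cons.prems that by (simp add: bl u_def w_def)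
  have "bil J Q r (unit_at b) = bil J Q r w"
    unfolding w_def using Cons.prems fin o by (subst bil_resid_right) auto
  also have "\<dots> = 0"
    using psd_null_orthogonal[OF Q, of w u] by (cases "bil J Q w w = 0") (auto simp: bl)
  finally show ?case using o Cons.prems unfolding r_def by auto
qed simp

text \<open>If a pivot vanishes in the limit, the hypothesis forces it to vanish exactly for large \<open>n\<close>,
  so the discontinuous quotient in \<^const>\<open>resid\<close> is \<open>0\<close> on both sides.\<close>
lemma resid_tendsto:
  fixes Qn :: "nat \<Rightarrow> 'i \<Rightarrow> 'i \<Rightarrow> real"
  assumes Q: "psd J Q" and Qn: "\<And>n. psd J (Qn n)"
    and lim: "\<And>i j. i \<in> J \<Longrightarrow> j \<in> J \<Longrightarrow> (\<lambda>n. Qn n i j) \<longlonglongrightarrow> Q i j"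
    and null: "\<And>bs b. set bs \<subseteq> J \<Longrightarrow> b \<in> J \<Longrightarrow> bil J Q (resid J Q bs b) (resid J Q bs b) = 0 \<Longrightarrow>
       \<forall>\<^sub>F n in sequentially. bil J (Qn n) (resid J Q bs b) (resid J Q bs b) = 0"
    and "set bs \<subseteq> J" "distinct bs" "h \<in> J"
  shows "(\<lambda>n. resid J (Qn n) bs h i) \<longlonglongrightarrow> resid J Q bs h i"
  using assms(5-)
proof (induction bs arbitrary: h i)
  case (Cons b bs)
  note fin = psd_finite[OF Q]
  define u where "u = (\<lambda>n. resid J (Qn n) bs h)"
  define w where "w = (\<lambda>n. resid J (Qn n) bs b)"
  define u' where "u' = resid J Q bs h"
  define w' where "w' = resid J Q bs b"
  have u: "(\<lambda>n. u n i) \<longlonglongrightarrow> u' i" and w: "(\<lambda>n. w n i) \<longlonglongrightarrow> w' i" for i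
    using Cons.IH[of h i] Cons.IH[of b i] Cons.prems by (auto simp: u_def w_def u'_def w'_def)
  have uw: "(\<lambda>n. bil J (Qn n) (u n) (w n)) \<longlonglongrightarrow> bil J Q u' w'"
    and ww: "(\<lambda>n. bil J (Qn n) (w n) (w n)) \<longlonglongrightarrow> bil J Q w' w'"
    unfolding bil_def by (auto intro!: tendsto_intros u w lim)
  have "(\<lambda>n. bil J (Qn n) (u n) (w n) / bil J (Qn n) (w n) (w n)) \<longlonglongrightarrow> bil J Q u' w' / bil J Q w' w'"
  proof (cases "bil J Q w' w' = 0")
    case False then show ?thesis by (intro tendsto_divide uw ww)
  next
    case True
    have "\<forall>\<^sub>F n in sequentially. bil J (Qn n) w' w' = 0"
      using null[of bs b] True Cons.prems by (simp add: w'_def)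
    then have "\<forall>\<^sub>F n in sequentially. bil J (Qn n) (w n) (w n) = 0"
    proof eventually_elim
      case (elim n)
      have o: "\<forall>j\<in>set bs. bil J (Qn n) (w n) (unit_at j) = 0"
        using Cons.prems by (auto simp: w_def intro!: resid_orthogonal[OF Qn])
      \<comment> \<open>The residual \<open>w n\<close> and the limiting residual \<open>w'\<close>
        differ only in coordinates from \<open>bs\<close>, to which \<open>w n\<close> is
        orthogonal. Pairing \<open>w n\<close> with either therefore gives the same number, and with
        \<open>w'\<close> it is zero.\<close>
      have "bil J (Qn n) (w n) (w n) = bil J (Qn n) (w n) (unit_at b)"
        using o fin Cons.prems by (subst (2) w_def, intro bil_resid_right) auto
      also have "\<dots> = bil J (Qn n) (w n) w'"
        using o fin Cons.prems by (subst w'_def, intro bil_resid_right[symmetric]) auto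
      also have "\<dots> = 0" by (rule psd_null_orthogonal[OF Qn elim])
      finally show ?case .
    qed
    then have "\<forall>\<^sub>F n in sequentially. 0 = bil J (Qn n) (u n) (w n) / bil J (Qn n) (w n) (w n)"
      by eventually_elim simp
    then show ?thesis using True by (auto intro: Lim_transform_eventually[OF tendsto_const])
  qed
  then show ?case
    using u[of i] w[of i] unfolding u_def w_def u'_def w'_def resid.simps
    by (intro tendsto_diff tendsto_mult) auto
qed simp

lemma bil_gram:
  "bil J (\<lambda>i j. \<Sum>\<beta>\<in>B. c * (f i \<beta> * f j \<beta>)) u w
     = c * (\<Sum>\<beta>\<in>B. (\<Sum>i\<in>J. u i * f i \<beta>) * (\<Sum>i\<in>J. w i * f i \<beta>))" (is "?l = ?r")
proof -
  have "?l = (\<Sum>i\<in>J. \<Sum>j\<in>J. \<Sum>\<beta>\<in>B. c * (u i * f i \<beta> * (w j * f j \<beta>)))"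
    by (simp add: bil_def sum_distrib_left sum_distrib_right algebra_simps)
  also have "\<dots> = (\<Sum>i\<in>J. \<Sum>\<beta>\<in>B. \<Sum>j\<in>J. c * (u i * f i \<beta> * (w j * f j \<beta>)))"
    by (rule sum.cong[OF refl], rule sum.swap)
  also have "\<dots> = (\<Sum>\<beta>\<in>B. \<Sum>i\<in>J. \<Sum>j\<in>J. c * (u i * f i \<beta> * (w j * f j \<beta>)))"
    by (rule sum.swap)
  also have "\<dots> = (\<Sum>\<beta>\<in>B. c * ((\<Sum>i\<in>J. u i * f i \<beta>) * (\<Sum>i\<in>J. w i * f i \<beta>)))"
    by (intro sum.cong refl, subst sum_product) (simp only: sum_distrib_left)
  also have "\<dots> = ?r" by (rule sum_distrib_left[symmetric])
  finally show ?thesis .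
qed

lemma psd_gram: "finite J \<Longrightarrow> c \<ge> 0 \<Longrightarrow> psd J (\<lambda>i j. \<Sum>\<beta>\<in>B. c * (f i \<beta> * f j \<beta>))"
  unfolding psd_def by (auto simp: bil_gram mult.commute sum_nonneg)

text \<open>One step of a Cholesky factorisation. The new row is the combination \<open>c\<close> of
  the old rows plus \<open>s\<close> in the fresh column \<open>k\<close>, in which the old rows
  vanish. Factors are square over the index set because \<open>gaussian_vec\<close> draws one normal
  variable per coordinate.\<close>

lemma gauss_factor_extend:
  fixes S L L' :: "'i \<Rightarrow> 'i \<Rightarrow> real"
  assumes I: "finite I" "k \<notin> I"
    and L: "\<And>i j. i \<in> I \<Longrightarrow> j \<in> I \<Longrightarrow> S i j = (\<Sum>l\<in>I. L i l * L j l)"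
    and cross: "\<And>j. j \<in> I \<Longrightarrow> S k j = (\<Sum>i\<in>I. c i * S i j)"
    and sym: "\<And>j. j \<in> I \<Longrightarrow> S j k = S k j"
    and diag: "S k k = (\<Sum>i\<in>I. \<Sum>j\<in>I. c i * S i j * c j) + s\<^sup>2"
    and L': "L' = (\<lambda>i l. if i = k then (if l = k then s else (\<Sum>i\<in>I. c i * L i l)) else if l = k then 0 else L i l)"
  shows "\<forall>i\<in>insert k I. \<forall>j\<in>insert k I. S i j = (\<Sum>l\<in>insert k I. L' i l * L' j l)"
proof -
  have L'k: "L' k l = (\<Sum>i\<in>I. c i * L i l)" if "l \<in> I" for l using I that by (auto simp: L')
  have L'kk: "L' k k = s" by (simp add: L')
  have L'j: "L' i l = (if l = k then 0 else L i l)" if "i \<in> I" for i l using I that by (auto simp: L')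
  have nk: "l \<in> I \<Longrightarrow> l \<noteq> k" for l using I by auto
  have kj: "(\<Sum>l\<in>insert k I. L' k l * L' j l) = S k j" if "j \<in> I" for j
  proof -
    have "(\<Sum>l\<in>insert k I. L' k l * L' j l) = (\<Sum>l\<in>I. L' k l * L' j l)"
      using I that by (simp add: L'j)
    also have "\<dots> = (\<Sum>l\<in>I. (\<Sum>i\<in>I. c i * L i l) * L j l)"
      using that by (simp add: L'k L'j nk cong: sum.cong)
    also have "\<dots> = (\<Sum>i\<in>I. \<Sum>l\<in>I. c i * (L i l * L j l))"
      by (subst sum.swap) (simp add: sum_distrib_right mult.assoc)
    also have "\<dots> = S k j" using cross[OF that] L that by (simp add: sum_distrib_left)
    finally show ?thesis .
  qed
  have "(\<Sum>l\<in>insert k I. L' k l * L' k l) = s\<^sup>2 + (\<Sum>l\<in>I. (\<Sum>i\<in>I. c i * L i l) * (\<Sum>i\<in>I. c i * L i l))"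
    using I by (simp add: L'k L'kk power2_eq_square)
  also have "(\<Sum>l\<in>I. (\<Sum>i\<in>I. c i * L i l) * (\<Sum>i\<in>I. c i * L i l)) = bil I (\<lambda>i j. \<Sum>l\<in>I. 1 * (L i l * L j l)) c c"
    by (subst bil_gram) simp
  also have "\<dots> = (\<Sum>i\<in>I. \<Sum>j\<in>I. c i * S i j * c j)"
    using L by (auto simp: bil_def intro!: sum.cong)
  finally have kk: "(\<Sum>l\<in>insert k I. L' k l * L' k l) = S k k" using diag by simp
  have ij: "(\<Sum>l\<in>insert k I. L' i l * L' j l) = S i j" if "i \<in> I" "j \<in> I" for i j
    using I that L by (simp add: L'j nk cong: sum.cong)
  have jk: "(\<Sum>l\<in>insert k I. L' j l * L' k l) = S j k" if "j \<in> I" for j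
    unfolding sym[OF that] kj[OF that, symmetric] by (rule sum.cong) (simp_all only: mult.commute)
  show ?thesis
    using kj kk ij jk by (metis insert_iff)
qed

text \<open>The first claim is orthogonality of the residual, read as normal equations; the second
  is Pythagoras. The sign in \<open>c\<close> moves the projection to the other side.\<close>

lemma psd_row_decomposition:
  assumes Q: "psd J Q" and bs: "set bs \<subseteq> J" "distinct bs" "k \<in> J" "k \<notin> set bs"
    and c: "c = (\<lambda>i. - resid J Q bs k i)"
  shows "j \<in> set bs \<Longrightarrow> Q k j = (\<Sum>i\<in>set bs. c i * Q i j)"
    and "Q k k = (\<Sum>i\<in>set bs. \<Sum>j\<in>set bs. c i * Q i j * c j) + bil J Q (resid J Q bs k) (resid J Q bs k)"
proof -
  define r where "r = resid J Q bs k"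
  note fin = psd_finite[OF Q]
  have rexp: "(\<Sum>i\<in>J. r i * g i) = g k + (\<Sum>i\<in>set bs. r i * g i)" for g :: "'a \<Rightarrow> real"
  proof -
    have "(\<Sum>i\<in>J. r i * g i) = (\<Sum>i\<in>insert k (set bs). r i * g i)"
      using bs fin by (intro sum.mono_neutral_right) (auto simp: r_def resid_support)
    then show ?thesis using bs by (simp add: r_def resid_self)
  qed
  have cross: "Q k j = (\<Sum>i\<in>set bs. c i * Q i j)" if "j \<in> set bs" for j
  proof -
    have "0 = (\<Sum>i\<in>J. r i * Q i j)"
      using resid_orthogonal[OF Q bs(1-3) that] bs that fin by (simp add: bil_unit_right r_def subset_iff)
    then show ?thesis by (simp add: rexp c r_def[symmetric] sum_negf)
  qed
  then show "j \<in> set bs \<Longrightarrow> Q k j = (\<Sum>i\<in>set bs. c i * Q i j)" .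
  have "bil J Q r r = bil J Q r (unit_at k)"
    using bs fin resid_orthogonal[OF Q bs(1-3)]
    by (subst (2) r_def, intro bil_resid_right) (auto simp: r_def)
  also have "\<dots> = Q k k + (\<Sum>i\<in>set bs. r i * Q i k)"
    using bs fin by (simp add: bil_unit_right rexp)
  also have "(\<Sum>i\<in>set bs. r i * Q i k) = (\<Sum>i\<in>set bs. r i * Q k i)"
    using Q bs by (intro sum.cong) (auto simp: psd_def)
  also have "\<dots> = (\<Sum>i\<in>set bs. r i * (\<Sum>j\<in>set bs. c j * Q j i))"
    using cross by simp
  also have "\<dots> = - (\<Sum>i\<in>set bs. \<Sum>j\<in>set bs. c i * Q i j * c j)"
    by (subst sum.swap) (simp add: sum_distrib_left c r_def[symmetric] sum_negf algebra_simps)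
  finally show "Q k k = (\<Sum>i\<in>set bs. \<Sum>j\<in>set bs. c i * Q i j * c j) + bil J Q (resid J Q bs k) (resid J Q bs k)"
    by (simp add: r_def)
qed

text \<open>The existence statement under which the \<open>SOME\<close> in
  \<open>gaussian_vec\<close> returns a genuine factor.\<close>

definition factorable :: "'i set \<Rightarrow> ('i \<Rightarrow> 'i \<Rightarrow> real) \<Rightarrow> bool" where
  "factorable I S \<longleftrightarrow> (\<exists>L. \<forall>i\<in>I. \<forall>j\<in>I. S i j = (\<Sum>k\<in>I. L i k * L j k))"

text \<open>Cholesky factorisation by induction over the index set. The pivot is the squared norm of
  the Gram-Schmidt residual, which may be zero.\<close>

lemma factorable_if_psd:
  assumes Q: "psd J Q" and "I \<subseteq> J"
  shows "factorable I Q"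
proof -
  have "finite I" using assms finite_subset psd_finite by blast
  then show ?thesis using \<open>I \<subseteq> J\<close>
  proof induction
    case empty then show ?case by (simp add: factorable_def)
  next
    case (insert k I)
    obtain bs where bs: "set bs = I" "distinct bs" using finite_distinct_list[OF insert(1)] by blast
    obtain L where L: "\<forall>i\<in>I. \<forall>j\<in>I. Q i j = (\<Sum>k\<in>I. L i k * L j k)"
      using insert unfolding factorable_def by auto
    define t where "t = bil J Q (resid J Q bs k) (resid J Q bs k)"
    have t: "t = (sqrt t)\<^sup>2" using Q by (simp add: psd_def t_def)
    have k: "set bs \<subseteq> J" "k \<in> J" "k \<notin> set bs" using insert bs by auto
    note d = psd_row_decomposition[OF Q k(1) bs(2) k(2,3) refl]
    have sym: "Q j k = Q k j" if "j \<in> I" for j using Q insert that by (auto simp: psd_def)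
    show ?case unfolding factorable_def
      by (rule exI, rule gauss_factor_extend[where S=Q and L=L and s="sqrt t" and c="\<lambda>i. - resid J Q bs k i", OF insert(1,2) _ _ sym _ refl])
         (use L d[folded t_def, unfolded bs(1)] t in auto)
  qed
qed

section \<open>Exchanging an orthonormal family of projections for fresh Gaussians\<close>

abbreviation std_gauss :: "real measure" where
  "std_gauss \<equiv> density lborel std_normal_density"

interpretation std_gauss: prob_space std_gauss
  by (rule prob_space_normal_density) simp

interpretation std_gauss_prod: product_sigma_finite "\<lambda>_. std_gauss"
  by (simp add: product_sigma_finite_def std_gauss.sigma_finite_measure_axioms)

interpretation lborel_prod: product_sigma_finite "\<lambda>_. lborel :: real measure"
  by (simp add: product_sigma_finite_def sigma_finite_lborel)

lemma sets_PiM_std_gauss [measurable_cong, simp]: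
  "sets (PiM I (\<lambda>_. std_gauss)) = sets (PiM I (\<lambda>_. borel))"
  by (rule sets_PiM_cong) auto

lemma sets_PiM_lborel [measurable_cong, simp]:
  "sets (PiM I (\<lambda>_. lborel :: real measure)) = sets (PiM I (\<lambda>_. borel))"
  by (rule sets_PiM_cong) auto

lemma space_PiM_std_gauss [simp]: "space (PiM I (\<lambda>_. std_gauss)) = extensional I"
  by (auto simp: space_PiM PiE_def)

lemma space_PiM_lborel [simp]: "space (PiM I (\<lambda>_. lborel :: real measure)) = extensional I"
  by (auto simp: space_PiM PiE_def)

lemma space_PiM_borel [simp]: "space (PiM I (\<lambda>_. borel :: real measure)) = extensional I"
  by (auto simp: space_PiM PiE_def)

lemma prob_space_PiM_std_gauss: "prob_space (PiM I (\<lambda>_. std_gauss))"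
  by (rule prob_space_PiM) (rule std_gauss.prob_space_axioms)

section \<open>Lebesgue and Gaussian measure on finite products\<close>

lemma PiM_lborel_translate:
  fixes c :: "'i \<Rightarrow> real"
  assumes I: "finite I"
  shows "distr (PiM I (\<lambda>_. lborel)) (PiM I (\<lambda>_. lborel)) (\<lambda>t. \<lambda>i\<in>I. t i + c i) = PiM I (\<lambda>_. lborel)"
    (is "distr ?L ?L ?T = _")
proof (rule lborel_prod.PiM_eqI[OF I])
  fix A :: "'i \<Rightarrow> real set" assume A: "\<And>i. i \<in> I \<Longrightarrow> A i \<in> sets lborel"
  have T: "?T \<in> measurable ?L ?L" by measurable
  have "emeasure (distr ?L ?L ?T) (Pi\<^sub>E I A) = emeasure ?L (?T -` Pi\<^sub>E I A \<inter> space ?L)"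
    using A I by (intro emeasure_distr T) (auto intro!: sets_PiM_I_finite)
  also have "?T -` Pi\<^sub>E I A \<inter> space ?L = Pi\<^sub>E I (\<lambda>i. (\<lambda>x. c i + x) -` A i)"
    by (auto simp: PiE_def extensional_def Pi_def add.commute)
  also have "emeasure ?L \<dots> = (\<Prod>i\<in>I. emeasure lborel ((\<lambda>x. c i + x) -` A i))"
    using A I by (intro lborel_prod.emeasure_PiM) (auto intro!: borel_measurable_vimage measurable_sets_borel[of _ borel])
  also have "\<dots> = (\<Prod>i\<in>I. emeasure lborel (A i))"
  proof (rule prod.cong[OF refl])
    fix i assume "i \<in> I"
    have "emeasure lborel (A i) = emeasure (distr lborel borel (\<lambda>x. c i + x)) (A i)"
      using lborel_distr_plus[of "c i"] by simp
    also have "\<dots> = emeasure lborel ((\<lambda>x. c i + x) -` A i)"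
      using A[OF \<open>i \<in> I\<close>] by (subst emeasure_distr) auto
    finally show "emeasure lborel ((\<lambda>x. c i + x) -` A i) = emeasure lborel (A i)" ..
  qed
  finally show "emeasure (distr ?L ?L ?T) (Pi\<^sub>E I A) = (\<Prod>i\<in>I. emeasure lborel (A i))" .
qed simp

lemma nn_integral_PiM_lborel_translate:
  fixes c :: "'i \<Rightarrow> real"
  assumes "finite I" and [measurable]: "f \<in> borel_measurable (PiM I (\<lambda>_. borel))"
  shows "(\<integral>\<^sup>+t. f (\<lambda>i\<in>I. t i + c i) \<partial>PiM I (\<lambda>_. lborel)) = (\<integral>\<^sup>+t. f t \<partial>PiM I (\<lambda>_. lborel))"
proof -
  have "(\<integral>\<^sup>+t. f t \<partial>PiM I (\<lambda>_. lborel)) =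
      (\<integral>\<^sup>+t. f t \<partial>distr (PiM I (\<lambda>_. lborel)) (PiM I (\<lambda>_. lborel)) (\<lambda>t. \<lambda>i\<in>I. t i + c i))"
    by (simp only: PiM_lborel_translate[OF \<open>finite I\<close>])
  also have "\<dots> = (\<integral>\<^sup>+t. f (\<lambda>i\<in>I. t i + c i) \<partial>PiM I (\<lambda>_. lborel))"
    by (rule nn_integral_distr) measurable
  finally show ?thesis ..
qed

lemma prod_std_normal_density:
  "(\<Prod>i\<in>I. std_normal_density (z i)) = (1 / sqrt (2 * pi)) ^ card I * exp (- (\<Sum>i\<in>I. (z i)\<^sup>2) / 2)"
  by (cases "finite I")
     (simp_all add: std_normal_density_def prod_dividef exp_sum[symmetric] sum_negf sum_divide_distrib power_divide)

lemma PiM_std_gauss_eq_density: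
  assumes I: "finite I"
  shows "PiM I (\<lambda>_. std_gauss) =
    density (PiM I (\<lambda>_. lborel)) (\<lambda>z. ennreal (\<Prod>i\<in>I. std_normal_density (z i)))"
proof (rule std_gauss_prod.PiM_eqI[OF I, symmetric])
  fix A :: "'a \<Rightarrow> real set" assume A: "\<And>i. i \<in> I \<Longrightarrow> A i \<in> sets std_gauss"
  have "emeasure (density (PiM I (\<lambda>_. lborel)) (\<lambda>z. ennreal (\<Prod>i\<in>I. std_normal_density (z i)))) (Pi\<^sub>E I A)
    = (\<integral>\<^sup>+z. ennreal (\<Prod>i\<in>I. std_normal_density (z i)) * indicator (Pi\<^sub>E I A) z \<partial>PiM I (\<lambda>_. lborel))"
    using A I by (intro emeasure_density) (auto intro!: sets_PiM_I_finite)
  also have "\<dots> = (\<integral>\<^sup>+z. (\<Prod>i\<in>I. ennreal (std_normal_density (z i)) * indicator (A i) (z i)) \<partial>PiM I (\<lambda>_. lborel))"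
    using I by (intro nn_integral_cong)
      (auto simp: prod.distrib prod_ennreal indicator_def PiE_def Pi_def intro!: prod_zero)
  also have "\<dots> = (\<Prod>i\<in>I. \<integral>\<^sup>+x. ennreal (std_normal_density x) * indicator (A i) x \<partial>lborel)"
    using A by (intro lborel_prod.product_nn_integral_prod I) auto
  also have "\<dots> = (\<Prod>i\<in>I. emeasure std_gauss (A i))"
    using A by (intro prod.cong refl emeasure_density[symmetric]) auto
  finally show "emeasure (density (PiM I (\<lambda>_. lborel)) (\<lambda>z. ennreal (\<Prod>i\<in>I. std_normal_density (z i)))) (Pi\<^sub>E I A)
    = (\<Prod>i\<in>I. emeasure std_gauss (A i))" .
qed (simp add: cong: sets_PiM_cong)

lemma nn_integral_PiM_std_gauss:
  assumes "finite I" and [measurable]: "f \<in> borel_measurable (PiM I (\<lambda>_. borel))"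
  shows "(\<integral>\<^sup>+z. f z \<partial>PiM I (\<lambda>_. std_gauss)) =
    (\<integral>\<^sup>+z. ennreal (\<Prod>i\<in>I. std_normal_density (z i)) * f z \<partial>PiM I (\<lambda>_. lborel))"
  unfolding PiM_std_gauss_eq_density[OF \<open>finite I\<close>] by (rule nn_integral_density) measurable

text \<open>The map sending \<open>(z, t)\<close> to \<open>(z - E\<^sup>T (t + E z), E z)\<close> is a composition of
  three shears, so it preserves Lebesgue measure, and it is an isometry when \<open>E E\<^sup>T = 1\<close>;
  hence it preserves the Gaussian measure.  It exchanges \<open>E z\<close> with the fresh variable \<open>t\<close>.\<close>
lemma gaussian_swap:
  fixes e :: "'j \<Rightarrow> 'k \<Rightarrow> real" and f :: "('j \<Rightarrow> real) \<Rightarrow> ('k \<Rightarrow> real) \<Rightarrow> ennreal"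
  assumes K: "finite K" and J: "finite J"
    and orth: "\<And>i j. i \<in> J \<Longrightarrow> j \<in> J \<Longrightarrow> (\<Sum>k\<in>K. e i k * e j k) = (if i = j then 1 else 0)"
    and f[measurable]: "(\<lambda>x. f (fst x) (snd x)) \<in> borel_measurable (PiM J (\<lambda>_. borel) \<Otimes>\<^sub>M PiM K (\<lambda>_. borel))"
    and inv: "\<And>y z w. y \<in> extensional J \<Longrightarrow> z \<in> extensional K \<Longrightarrow>
       f y (\<lambda>k\<in>K. z k + (\<Sum>j\<in>J. w j * e j k)) = f y z"
  shows "(\<integral>\<^sup>+z. f (\<lambda>j\<in>J. \<Sum>k\<in>K. e j k * z k) z \<partial>PiM K (\<lambda>_. std_gauss)) =
    (\<integral>\<^sup>+t. \<integral>\<^sup>+z. f t z \<partial>PiM K (\<lambda>_. std_gauss) \<partial>PiM J (\<lambda>_. std_gauss))"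
proof -
  let ?LK = "PiM K (\<lambda>_. lborel :: real measure)" and ?LJ = "PiM J (\<lambda>_. lborel :: real measure)"
  interpret LK: sigma_finite_measure ?LK by (rule lborel_prod.sigma_finite) fact
  interpret LJ: sigma_finite_measure ?LJ by (rule lborel_prod.sigma_finite) fact
  interpret KJ: pair_sigma_finite ?LK ?LJ ..
  define rK where "rK = (\<lambda>z. ennreal (\<Prod>k\<in>K. std_normal_density (z k)))"
  define rJ where "rJ = (\<lambda>t. ennreal (\<Prod>j\<in>J. std_normal_density (t j)))"
  \<comment> \<open>\<open>E\<close> reads off the components along the rows of \<open>e\<close>,
    and \<open>Et\<close> is its adjoint; orthonormality says that \<open>E\<close> after
    \<open>Et\<close> is the identity.\<close>
  define E where "E = (\<lambda>z. \<lambda>j\<in>J. \<Sum>k\<in>K. e j k * z k)"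
  define Et where "Et = (\<lambda>t k. \<Sum>j\<in>J. t j * e j k)"
  define H where "H = (\<lambda>z t. rK z * (rJ t * f t z))"
  have rK[measurable]: "rK \<in> borel_measurable (PiM K (\<lambda>_. borel))" unfolding rK_def by measurable
  have rJ[measurable]: "rJ \<in> borel_measurable (PiM J (\<lambda>_. borel))" unfolding rJ_def by measurable
  have E[measurable]: "E \<in> measurable (PiM K (\<lambda>_. borel)) (PiM J (\<lambda>_. borel))"
    unfolding E_def by measurable
  have f2[measurable (raw)]: "(\<lambda>x. f (g x) (h x)) \<in> borel_measurable N"
    if "g \<in> measurable N (PiM J (\<lambda>_. borel))" "h \<in> measurable N (PiM K (\<lambda>_. borel))" for g h and N :: "'n measure"
    using measurable_compose[OF measurable_Pair[OF that] f] by simp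
  have H[measurable (raw)]: "(\<lambda>x. H (h x) (g x)) \<in> borel_measurable N"
    if [measurable]: "g \<in> measurable N (PiM J (\<lambda>_. borel))" "h \<in> measurable N (PiM K (\<lambda>_. borel))" for g h and N :: "'n measure"
    unfolding H_def by measurable
  have Etm[measurable (raw)]: "(\<lambda>x. Et (g x) k) \<in> borel_measurable N"
    if [measurable]: "g \<in> measurable N (PiM J (\<lambda>_. borel))" for g k and N :: "'n measure"
    unfolding Et_def by measurable
  have EEt: "(\<Sum>k\<in>K. e j k * Et t k) = t j" if "j \<in> J" for j t
  proof -
    have "(\<Sum>k\<in>K. e j k * Et t k) = (\<Sum>i\<in>J. t i * (\<Sum>k\<in>K. e j k * e i k))"
      unfolding Et_def sum_distrib_left by (subst sum.swap) (simp add: algebra_simps)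
    also have "\<dots> = (\<Sum>i\<in>J. if j = i then t i else 0)"
      using that orth by (intro sum.cong) auto
    also have "\<dots> = t j" using that J by simp
    finally show ?thesis .
  qed
  have adj: "(\<Sum>k\<in>K. Et t k * z k) = (\<Sum>j\<in>J. t j * E z j)" for t z
  proof -
    have "(\<Sum>k\<in>K. Et t k * z k) = (\<Sum>j\<in>J. \<Sum>k\<in>K. t j * e j k * z k)"
      unfolding Et_def sum_distrib_right by (rule sum.swap)
    also have "\<dots> = (\<Sum>j\<in>J. t j * E z j)"
      by (rule sum.cong) (auto simp: E_def sum_distrib_left mult.assoc)
    finally show ?thesis .
  qed
  have EtEt: "(\<Sum>k\<in>K. Et t k * Et t k) = (\<Sum>j\<in>J. t j * t j)" for t
    unfolding adj by (rule sum.cong) (auto simp: E_def EEt)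
  have iso: "(\<Sum>k\<in>K. (z k - Et u k)\<^sup>2) + (\<Sum>j\<in>J. (E z j)\<^sup>2) = (\<Sum>k\<in>K. (z k)\<^sup>2) + (\<Sum>j\<in>J. (t j)\<^sup>2)"
    if u: "\<And>j. j \<in> J \<Longrightarrow> u j = t j + E z j" for z t u
  proof -
    have "(\<Sum>k\<in>K. (z k - Et u k)\<^sup>2) = (\<Sum>k\<in>K. (z k)\<^sup>2) + (\<Sum>k\<in>K. Et u k * Et u k) - 2 * (\<Sum>k\<in>K. Et u k * z k)"
      by (simp add: power2_eq_square algebra_simps sum.distrib sum_subtractf sum_distrib_left)
    also have "\<dots> = (\<Sum>k\<in>K. (z k)\<^sup>2) + (\<Sum>j\<in>J. u j * u j - 2 * (u j * E z j))"
      unfolding EtEt unfolding adj by (simp add: sum_subtractf sum_distrib_left)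
    also have "(\<Sum>j\<in>J. u j * u j - 2 * (u j * E z j)) = (\<Sum>j\<in>J. (t j)\<^sup>2 - (E z j)\<^sup>2)"
      using u by (intro sum.cong) (auto simp: power2_eq_square algebra_simps)
    finally show ?thesis by (simp add: sum_subtractf)
  qed
  \<comment> \<open>The integrand after all three shears. By \<open>iso\<close> the product of the
    densities is unchanged, and the displacement of \<open>z\<close> lies in the span of the rows of
    \<open>e\<close>, to which \<open>f\<close> is insensitive by \<open>inv\<close>.\<close>
  have eq: "H (\<lambda>k\<in>K. z k + - Et (\<lambda>j\<in>J. t j + E z j) k) (E z) = rJ t * (rK z * f (E z) z)"
    if z: "z \<in> extensional K" for z t
  proof -
    let ?u = "\<lambda>j\<in>J. t j + E z j"
    have "(\<lambda>k\<in>K. z k + - Et ?u k) = (\<lambda>k\<in>K. z k + (\<Sum>j\<in>J. (- ?u j) * e j k))"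
      by (auto simp: Et_def sum_negf[symmetric] fun_eq_iff algebra_simps intro!: sum.cong)
    then have "f (E z) (\<lambda>k\<in>K. z k + - Et ?u k) = f (E z) z"
      using inv[of "E z" z "\<lambda>j. - ?u j"] z by (simp add: E_def)
    moreover have "rK (\<lambda>k\<in>K. z k + - Et ?u k) * rJ (E z) = rJ t * rK z"
    proof -
      have "(\<Prod>k\<in>K. std_normal_density ((\<lambda>k\<in>K. z k + - Et ?u k) k)) * (\<Prod>j\<in>J. std_normal_density (E z j))
         = (1 / sqrt (2 * pi)) ^ card K * (1 / sqrt (2 * pi)) ^ card J *
            exp (- ((\<Sum>k\<in>K. (z k - Et ?u k)\<^sup>2) + (\<Sum>j\<in>J. (E z j)\<^sup>2)) / 2)"
        unfolding prod_std_normal_density by (simp add: exp_add[symmetric] add_divide_distrib)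
      also have "(\<Sum>k\<in>K. (z k - Et ?u k)\<^sup>2) + (\<Sum>j\<in>J. (E z j)\<^sup>2) = (\<Sum>k\<in>K. (z k)\<^sup>2) + (\<Sum>j\<in>J. (t j)\<^sup>2)"
        by (rule iso) simp
      also have "(1 / sqrt (2 * pi)) ^ card K * (1 / sqrt (2 * pi)) ^ card J *
           exp (- ((\<Sum>k\<in>K. (z k)\<^sup>2) + (\<Sum>j\<in>J. (t j)\<^sup>2)) / 2) =
         (\<Prod>j\<in>J. std_normal_density (t j)) * (\<Prod>k\<in>K. std_normal_density (z k))"
        unfolding prod_std_normal_density by (simp add: exp_add[symmetric] add_divide_distrib)
      finally show ?thesis unfolding rK_def rJ_def
        by (simp only: ennreal_mult[OF prod_nonneg prod_nonneg, OF normal_density_nonneg normal_density_nonneg, symmetric])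
    qed
    ultimately show ?thesis unfolding H_def by (metis mult.assoc)
  qed
  have "(\<integral>\<^sup>+t. \<integral>\<^sup>+z. f t z \<partial>PiM K (\<lambda>_. std_gauss) \<partial>PiM J (\<lambda>_. std_gauss)) =
    (\<integral>\<^sup>+t. rJ t * (\<integral>\<^sup>+z. f t z \<partial>PiM K (\<lambda>_. std_gauss)) \<partial>?LJ)"
  proof (unfold rJ_def, rule nn_integral_PiM_std_gauss[OF J])
    interpret P: prob_space "PiM K (\<lambda>_. std_gauss)" by (rule prob_space_PiM_std_gauss)
    show "(\<lambda>t. \<integral>\<^sup>+z. f t z \<partial>PiM K (\<lambda>_. std_gauss)) \<in> borel_measurable (PiM J (\<lambda>_. borel))"
      by measurable
  qed
  also have "\<dots> = (\<integral>\<^sup>+t. \<integral>\<^sup>+z. H z t \<partial>?LK \<partial>?LJ)"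
  proof (rule nn_integral_cong)
    fix t assume t: "t \<in> space ?LJ"
    then have [measurable]: "t \<in> space (PiM J (\<lambda>_. borel))" by simp
    have "(\<integral>\<^sup>+z. f t z \<partial>PiM K (\<lambda>_. std_gauss)) = (\<integral>\<^sup>+z. rK z * f t z \<partial>?LK)"
      unfolding rK_def by (rule nn_integral_PiM_std_gauss[OF K]) measurable
    moreover have "(\<integral>\<^sup>+z. H z t \<partial>?LK) = (\<integral>\<^sup>+z. rJ t * (rK z * f t z) \<partial>?LK)"
      by (simp add: H_def ac_simps)
    moreover have "\<dots> = rJ t * (\<integral>\<^sup>+z. rK z * f t z \<partial>?LK)"
      by (rule nn_integral_cmult) measurable
    ultimately show "rJ t * (\<integral>\<^sup>+z. f t z \<partial>PiM K (\<lambda>_. std_gauss)) = (\<integral>\<^sup>+z. H z t \<partial>?LK)"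
      by simp
  qed
  also have "\<dots> = (\<integral>\<^sup>+z. \<integral>\<^sup>+t. H z t \<partial>?LJ \<partial>?LK)"
    by (rule KJ.Fubini') measurable
  \<comment> \<open>First shear. Each shear shifts the inner variable by a function of the outer
    one, which is why the order of integration alternates.\<close>
  also have "\<dots> = (\<integral>\<^sup>+z. \<integral>\<^sup>+t. H z (\<lambda>j\<in>J. t j + E z j) \<partial>?LJ \<partial>?LK)"
  proof (rule nn_integral_cong)
    fix z assume "z \<in> space ?LK"
    then have [measurable]: "z \<in> space (PiM K (\<lambda>_. borel))" by simp
    show "(\<integral>\<^sup>+t. H z t \<partial>?LJ) = (\<integral>\<^sup>+t. H z (\<lambda>j\<in>J. t j + E z j) \<partial>?LJ)"
      by (rule nn_integral_PiM_lborel_translate[OF J, symmetric]) measurable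
  qed
  also have "\<dots> = (\<integral>\<^sup>+t. \<integral>\<^sup>+z. H z (\<lambda>j\<in>J. t j + E z j) \<partial>?LK \<partial>?LJ)"
    by (rule KJ.Fubini'[symmetric]) measurable
  \<comment> \<open>Second shear: shifting \<open>z\<close> by \<open>- Et t\<close> lowers
    \<open>E z\<close> by \<open>t\<close>, so the slot \<open>t + E z\<close> becomes
    \<open>E z\<close>.\<close>
  also have "\<dots> = (\<integral>\<^sup>+t. \<integral>\<^sup>+z. H (\<lambda>k\<in>K. z k + - Et t k) (E z) \<partial>?LK \<partial>?LJ)"
  proof (rule nn_integral_cong)
    fix t assume "t \<in> space ?LJ"
    then have [measurable]: "t \<in> space (PiM J (\<lambda>_. borel))" and t: "t \<in> extensional J" by simp_all
    have "(\<integral>\<^sup>+z. H z (\<lambda>j\<in>J. t j + E z j) \<partial>?LK) =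
       (\<integral>\<^sup>+z. H (\<lambda>k\<in>K. z k + - Et t k) (\<lambda>j\<in>J. t j + E (\<lambda>k\<in>K. z k + - Et t k) j) \<partial>?LK)"
      by (rule nn_integral_PiM_lborel_translate[OF K, symmetric]) measurable
    also have "\<dots> = (\<integral>\<^sup>+z. H (\<lambda>k\<in>K. z k + - Et t k) (E z) \<partial>?LK)"
    proof (intro nn_integral_cong arg_cong2[where f=H] refl)
      fix z
      show "(\<lambda>j\<in>J. t j + E (\<lambda>k\<in>K. z k + - Et t k) j) = E z"
        by (auto simp: fun_eq_iff E_def right_diff_distrib sum_subtractf EEt)
    qed
    finally show "(\<integral>\<^sup>+z. H z (\<lambda>j\<in>J. t j + E z j) \<partial>?LK) = (\<integral>\<^sup>+z. H (\<lambda>k\<in>K. z k + - Et t k) (E z) \<partial>?LK)" .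
  qed
  also have "\<dots> = (\<integral>\<^sup>+z. \<integral>\<^sup>+t. H (\<lambda>k\<in>K. z k + - Et t k) (E z) \<partial>?LJ \<partial>?LK)"
    by (rule KJ.Fubini') measurable
  also have "\<dots> = (\<integral>\<^sup>+z. \<integral>\<^sup>+t. H (\<lambda>k\<in>K. z k + - Et (\<lambda>j\<in>J. t j + E z j) k) (E z) \<partial>?LJ \<partial>?LK)"
  proof (rule nn_integral_cong)
    fix z assume "z \<in> space ?LK"
    then have [measurable]: "z \<in> space (PiM K (\<lambda>_. borel))" by simp
    show "(\<integral>\<^sup>+t. H (\<lambda>k\<in>K. z k + - Et t k) (E z) \<partial>?LJ) =
      (\<integral>\<^sup>+t. H (\<lambda>k\<in>K. z k + - Et (\<lambda>j\<in>J. t j + E z j) k) (E z) \<partial>?LJ)"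
      by (rule nn_integral_PiM_lborel_translate[OF J, symmetric]) measurable
  qed
  also have "\<dots> = (\<integral>\<^sup>+z. \<integral>\<^sup>+t. rJ t * (rK z * f (E z) z) \<partial>?LJ \<partial>?LK)"
    by (intro nn_integral_cong eq) simp
  also have "\<dots> = (\<integral>\<^sup>+z. (\<integral>\<^sup>+t. rJ t \<partial>?LJ) * (rK z * f (E z) z) \<partial>?LK)"
    by (intro nn_integral_cong nn_integral_multc) measurable
  also have "(\<integral>\<^sup>+t. rJ t \<partial>?LJ) = 1"
  proof -
    interpret P: prob_space "PiM J (\<lambda>_. std_gauss)" by (rule prob_space_PiM_std_gauss)
    have "(\<integral>\<^sup>+t. rJ t * 1 \<partial>?LJ) = (\<integral>\<^sup>+t. 1 \<partial>PiM J (\<lambda>_. std_gauss))"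
      unfolding rJ_def by (rule nn_integral_PiM_std_gauss[OF J, symmetric]) simp
    then show ?thesis using P.emeasure_space_1 by simp
  qed
  also have "(\<integral>\<^sup>+z. 1 * (rK z * f (E z) z) \<partial>?LK) = (\<integral>\<^sup>+z. f (E z) z \<partial>PiM K (\<lambda>_. std_gauss))"
    unfolding rK_def mult_1 by (rule nn_integral_PiM_std_gauss[OF K, symmetric]) measurable
  finally show ?thesis unfolding E_def ..
qed

section \<open>Degenerate Gaussian vectors\<close>

text \<open>Split row \<open>i0\<close> into its projection on the old rows and an orthogonal rest
  \<open>r\<close>. Moving \<open>z\<close> along \<open>r\<close> does not change the old
  coordinates, so \<open>gaussian_swap\<close> in the single direction \<open>r / s\<close> replaces
  the product of \<open>r\<close> and \<open>z\<close> by \<open>s\<close> times a fresh normal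
  variable.\<close>

lemma linear_image_insert:
  fixes L :: "'i \<Rightarrow> 'k \<Rightarrow> real"
  assumes I: "finite I" "i0 \<notin> I" and K: "finite K"
    and orth: "\<And>j. j \<in> I \<Longrightarrow> (\<Sum>k\<in>K. (L i0 k - (\<Sum>i\<in>I. c i * L i k)) * L j k) = 0"
    and s: "s\<^sup>2 = (\<Sum>k\<in>K. (L i0 k - (\<Sum>i\<in>I. c i * L i k))\<^sup>2)"
  shows "distr (PiM K (\<lambda>_. std_gauss)) (PiM (insert i0 I) (\<lambda>_. borel))
      (\<lambda>z. \<lambda>i\<in>insert i0 I. \<Sum>k\<in>K. L i k * z k) =
    distr (distr (PiM K (\<lambda>_. std_gauss)) (PiM I (\<lambda>_. borel)) (\<lambda>z. \<lambda>i\<in>I. \<Sum>k\<in>K. L i k * z k)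
        \<Otimes>\<^sub>M std_gauss) (PiM (insert i0 I) (\<lambda>_. borel))
      (\<lambda>(x, t). x(i0 := (\<Sum>i\<in>I. c i * x i) + s * t))" (is "?l = ?r")
proof (rule measure_eqI)
  let ?G = "PiM K (\<lambda>_. std_gauss)" and ?B = "PiM (insert i0 I) (\<lambda>_. borel :: real measure)"
  let ?BI = "PiM I (\<lambda>_. borel :: real measure)"
  define r where "r = (\<lambda>k. L i0 k - (\<Sum>i\<in>I. c i * L i k))"
  define X where "X = (\<lambda>z. \<lambda>i\<in>I. \<Sum>k\<in>K. L i k * z k)"
  interpret G: prob_space ?G by (rule prob_space_PiM_std_gauss)
  have X[measurable]: "X \<in> measurable ?G ?BI" unfolding X_def by measurable
  have X'[measurable]: "X \<in> measurable (PiM K (\<lambda>_. borel)) ?BI" unfolding X_def by measurable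
  interpret D: prob_space "distr ?G ?BI X" by (rule G.prob_space_distr) measurable
  interpret P: pair_sigma_finite "distr ?G ?BI X" std_gauss ..
  have upd[measurable (raw)]: "(\<lambda>x. (f x)(i0 := g x)) \<in> measurable N ?B"
    if [measurable]: "f \<in> measurable N ?BI" "g \<in> measurable N borel" for f g and N :: "'n measure"
    by (rule measurable_fun_upd[where J=I]) (use that in auto)
  fix A assume "A \<in> sets ?l"
  then have A[measurable]: "A \<in> sets ?B" by simp
  define g where "g = (\<lambda>x t. indicator A (x(i0 := (\<Sum>i\<in>I. c i * x i) + s * t)) :: ennreal)"
  have g[measurable (raw)]: "(\<lambda>x. g (p x) (q x)) \<in> borel_measurable N"
    if [measurable]: "p \<in> measurable N ?BI" "q \<in> measurable N borel" for p q and N :: "'n measure"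
    unfolding g_def by measurable
  have row: "(\<Sum>k\<in>K. L i0 k * z k) = (\<Sum>i\<in>I. c i * X z i) + (\<Sum>k\<in>K. r k * z k)" for z
  proof -
    have "(\<Sum>i\<in>I. c i * X z i) = (\<Sum>k\<in>K. (\<Sum>i\<in>I. c i * L i k) * z k)"
      by (subst sum_distrib_right, subst sum.swap) (simp add: X_def sum_distrib_left mult.assoc)
    then show ?thesis by (simp add: r_def left_diff_distrib sum_subtractf)
  qed
  have upd_eq: "(\<lambda>i\<in>insert i0 I. \<Sum>k\<in>K. L i k * z k) = (X z)(i0 := (\<Sum>i\<in>I. c i * X z i) + (\<Sum>k\<in>K. r k * z k))" for z
    unfolding row[symmetric] by (auto simp: X_def)
  have "emeasure ?l A = (\<integral>\<^sup>+x. indicator A x \<partial>?l)" by simp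
  also have "\<dots> = (\<integral>\<^sup>+z. indicator A ((X z)(i0 := (\<Sum>i\<in>I. c i * X z i) + (\<Sum>k\<in>K. r k * z k))) \<partial>?G)"
    unfolding upd_eq[symmetric] by (rule nn_integral_distr) measurable
  also have "\<dots> = (\<integral>\<^sup>+t. \<integral>\<^sup>+z. g (X z) t \<partial>?G \<partial>std_gauss)"
  proof (cases "s = 0")
    case True
    have "(\<Sum>k\<in>K. (r k)\<^sup>2) = 0" using s True by (simp add: r_def)
    then have "\<forall>k\<in>K. r k = 0" using K by (simp add: sum_nonneg_eq_0_iff)
    then show ?thesis using True by (simp add: g_def std_gauss.emeasure_space_1[simplified])
  next
    case False
    \<comment> \<open>One direction is exchanged, so the family of projections is indexed by the
      one-point type.\<close>
    define f where "f = (\<lambda>y z. g (X z) (y ()) )"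
    have fm: "(\<lambda>x. f (fst x) (snd x)) \<in> borel_measurable (PiM {()} (\<lambda>_. borel) \<Otimes>\<^sub>M PiM K (\<lambda>_. borel))"
      unfolding f_def by measurable
    have "(\<integral>\<^sup>+z. f (\<lambda>j\<in>{()}. \<Sum>k\<in>K. r k / s * z k) z \<partial>?G) =
        (\<integral>\<^sup>+t. \<integral>\<^sup>+z. f t z \<partial>?G \<partial>PiM {()} (\<lambda>_. std_gauss))"
    proof (rule gaussian_swap[OF K _ _ fm])
      fix i j :: unit
      have "(\<Sum>k\<in>K. r k / s * (r k / s)) = (\<Sum>k\<in>K. (r k)\<^sup>2) / s\<^sup>2"
        by (simp add: power2_eq_square sum_divide_distrib)
      moreover have "s\<^sup>2 = (\<Sum>k\<in>K. (r k)\<^sup>2)" using s by (simp only: r_def)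
      ultimately have "(\<Sum>k\<in>K. r k / s * (r k / s)) = s\<^sup>2 / s\<^sup>2" by (simp only:)
      also have "\<dots> = 1" using False by simp
      finally show "(\<Sum>k\<in>K. r k / s * (r k / s)) = (if i = j then 1 else 0)" by simp
    next
      fix y :: "unit \<Rightarrow> real" and z w
      have "X (\<lambda>k\<in>K. z k + (\<Sum>j\<in>{()}. w j * (r k / s))) = X z"
      proof (rule ext)
        fix i
        show "X (\<lambda>k\<in>K. z k + (\<Sum>j\<in>{()}. w j * (r k / s))) i = X z i"
        proof (cases "i \<in> I")
          case True
          have "(\<Sum>k\<in>K. L i k * (w () * (r k / s))) = w () / s * (\<Sum>k\<in>K. r k * L i k)"
            by (simp add: sum_distrib_left algebra_simps)
          also have "\<dots> = 0" using orth[OF True] by (simp add: r_def)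
          finally show ?thesis using True by (simp add: X_def distrib_left sum.distrib)
        qed (simp add: X_def)
      qed
      then show "f y (\<lambda>k\<in>K. z k + (\<Sum>j\<in>{()}. w j * (r k / s))) = f y z" by (simp add: f_def)
    qed simp
    moreover have "f (\<lambda>j\<in>{()}. \<Sum>k\<in>K. r k / s * z k) z =
        indicator A ((X z)(i0 := (\<Sum>i\<in>I. c i * X z i) + (\<Sum>k\<in>K. r k * z k)))" for z
      using False by (simp add: f_def g_def sum_distrib_left)
    moreover have "(\<integral>\<^sup>+t. \<integral>\<^sup>+z. f t z \<partial>?G \<partial>PiM {()} (\<lambda>_. std_gauss)) = (\<integral>\<^sup>+t. \<integral>\<^sup>+z. g (X z) t \<partial>?G \<partial>std_gauss)"
      unfolding f_def by (rule std_gauss_prod.product_nn_integral_singleton) measurable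
    ultimately show ?thesis by simp
  qed
  also have "\<dots> = (\<integral>\<^sup>+t. \<integral>\<^sup>+x. g x t \<partial>distr ?G ?BI X \<partial>std_gauss)"
    by (intro nn_integral_cong nn_integral_distr[symmetric]) measurable
  also have "\<dots> = (\<integral>\<^sup>+p. g (fst p) (snd p) \<partial>(distr ?G ?BI X \<Otimes>\<^sub>M std_gauss))"
    by (subst P.nn_integral_snd[symmetric]) auto
  also have "\<dots> = (\<integral>\<^sup>+p. indicator A (case p of (x, t) \<Rightarrow> x(i0 := (\<Sum>i\<in>I. c i * x i) + s * t))
      \<partial>(distr ?G ?BI X \<Otimes>\<^sub>M std_gauss))"
    by (simp add: g_def case_prod_beta)
  also have "\<dots> = (\<integral>\<^sup>+x. indicator A x \<partial>?r)"
    unfolding X_def[symmetric] by (rule nn_integral_distr[symmetric]) measurable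
  also have "\<dots> = emeasure ?r A" by simp
  finally show "emeasure ?l A = emeasure ?r A" .
qed simp

text \<open>Coefficients and scale in \<open>linear_image_insert\<close> are functions of the Gram
  matrix of the rows, so both laws are built by the same recursion over the index set. The image may
  be singular, with no density to compare.\<close>

lemma linear_image_eqI:
  fixes L L' :: "'i \<Rightarrow> 'k \<Rightarrow> real"
  assumes K: "finite K" and I: "finite I"
    and gram: "\<And>i j. i \<in> I \<Longrightarrow> j \<in> I \<Longrightarrow> (\<Sum>k\<in>K. L i k * L j k) = (\<Sum>k\<in>K. L' i k * L' j k)"
  shows "distr (PiM K (\<lambda>_. std_gauss)) (PiM I (\<lambda>_. borel)) (\<lambda>z. \<lambda>i\<in>I. \<Sum>k\<in>K. L i k * z k) =
    distr (PiM K (\<lambda>_. std_gauss)) (PiM I (\<lambda>_. borel)) (\<lambda>z. \<lambda>i\<in>I. \<Sum>k\<in>K. L' i k * z k)"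
  using I gram
proof induction
  case empty
  then show ?case by (auto simp: restrict_def intro!: distr_cong)
next
  case (insert i0 I)
  obtain bs where bs: "set bs = I" "distinct bs" using finite_distinct_list[OF insert(1)] by blast
  let ?J = "insert i0 I"
  define Q where "Q = (\<lambda>i j. \<Sum>k\<in>K. 1 * (L i k * L j k))"
  have psd: "psd ?J Q" unfolding Q_def using insert(1) by (intro psd_gram) auto
  define u where "u = resid ?J Q bs i0"
  define s where "s = sqrt (bil ?J Q u u)"
  have s2: "s\<^sup>2 = bil ?J Q u u" using psd by (simp add: s_def psd_def)
  have bilM: "bil ?J Q v w = (\<Sum>k\<in>K. (\<Sum>i\<in>?J. v i * M i k) * (\<Sum>i\<in>?J. w i * M i k))"
    if M: "M = L \<or> M = L'" for M v w
  proof -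
    have "bil ?J Q v w = bil ?J (\<lambda>i j. \<Sum>k\<in>K. 1 * (M i k * M j k)) v w"
      unfolding bil_def Q_def using M insert.prems by (intro sum.cong refl) auto
    also have "\<dots> = (\<Sum>k\<in>K. (\<Sum>i\<in>?J. v i * M i k) * (\<Sum>i\<in>?J. w i * M i k))"
      by (subst bil_gram) simp
    finally show ?thesis .
  qed
  have u: "(\<Sum>i\<in>?J. u i * M i k) = M i0 k - (\<Sum>i\<in>I. - u i * M i k)" for M :: "'i \<Rightarrow> 'k \<Rightarrow> real" and k
    using insert bs by (simp add: u_def resid_self sum_negf)
  have unit: "(\<Sum>i\<in>?J. unit_at j i * M i k) = M j k" if "j \<in> ?J" for M :: "'i \<Rightarrow> 'k \<Rightarrow> real" and j k
  proof -
    have "(\<Sum>i\<in>?J. unit_at j i * M i k) = (\<Sum>i\<in>?J. if i = j then M i k else 0)"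
      by (rule sum.cong) (auto simp: unit_at_def)
    then show ?thesis using that insert(1) by simp
  qed
  have step: "distr (PiM K (\<lambda>_. std_gauss)) (PiM ?J (\<lambda>_. borel)) (\<lambda>z. \<lambda>i\<in>?J. \<Sum>k\<in>K. M i k * z k) =
    distr (distr (PiM K (\<lambda>_. std_gauss)) (PiM I (\<lambda>_. borel)) (\<lambda>z. \<lambda>i\<in>I. \<Sum>k\<in>K. M i k * z k)
        \<Otimes>\<^sub>M std_gauss) (PiM ?J (\<lambda>_. borel))
      (\<lambda>(x, t). x(i0 := (\<Sum>i\<in>I. - u i * x i) + s * t))" if M: "M = L \<or> M = L'" for M
  proof (rule linear_image_insert[OF insert(1,2) K])
    show "s\<^sup>2 = (\<Sum>k\<in>K. (M i0 k - (\<Sum>i\<in>I. - u i * M i k))\<^sup>2)"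
      unfolding s2 bilM[OF M] u by (simp add: power2_eq_square)
    fix j assume j: "j \<in> I"
    have "bil ?J Q u (unit_at j) = 0"
      unfolding u_def using j bs by (intro resid_orthogonal[OF psd]) auto
    then show "(\<Sum>k\<in>K. (M i0 k - (\<Sum>i\<in>I. - u i * M i k)) * M j k) = 0"
      using j unfolding bilM[OF M] u by (simp add: unit)
  qed
  have "distr (PiM K (\<lambda>_. std_gauss)) (PiM I (\<lambda>_. borel)) (\<lambda>z. \<lambda>i\<in>I. \<Sum>k\<in>K. L i k * z k) =
    distr (PiM K (\<lambda>_. std_gauss)) (PiM I (\<lambda>_. borel)) (\<lambda>z. \<lambda>i\<in>I. \<Sum>k\<in>K. L' i k * z k)"
    using insert.prems by (intro insert.IH) auto
  then show ?case unfolding step[of L, OF disjI1[OF refl]] step[of L', OF disjI2[OF refl]] by (simp only:)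
qed

text \<open>Any factor may stand in for the one picked by \<open>SOME\<close>, since
  \<open>linear_image_eqI\<close> sees only the products of rows. The mean is added by a further
  image.\<close>

lemma gaussian_vec_eq:
  assumes I: "finite I" and L: "\<And>i j. i \<in> I \<Longrightarrow> j \<in> I \<Longrightarrow> S i j = (\<Sum>k\<in>I. L i k * L j k)"
  shows "gaussian_vec I mu S = distr (PiM I (\<lambda>_. std_gauss)) (PiM I (\<lambda>_. borel))
    (\<lambda>z. \<lambda>i\<in>I. mu i + (\<Sum>k\<in>I. L i k * z k))"
proof -
  define M where "M = (SOME L. \<forall>i\<in>I. \<forall>j\<in>I. S i j = (\<Sum>k\<in>I. L i k * L j k))"
  have M: "\<forall>i\<in>I. \<forall>j\<in>I. S i j = (\<Sum>k\<in>I. M i k * M j k)"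
    unfolding M_def by (rule someI[where x=L]) (use L in auto)
  have t: "distr (PiM I (\<lambda>_. std_gauss)) (PiM I (\<lambda>_. borel)) (\<lambda>z. \<lambda>i\<in>I. mu i + (\<Sum>k\<in>I. N i k * z k)) =
    distr (distr (PiM I (\<lambda>_. std_gauss)) (PiM I (\<lambda>_. borel)) (\<lambda>z. \<lambda>i\<in>I. \<Sum>k\<in>I. N i k * z k))
      (PiM I (\<lambda>_. borel)) (\<lambda>x. \<lambda>i\<in>I. mu i + x i)" for N
    by (subst distr_distr) (auto simp: comp_def cong: restrict_cong)
  show ?thesis
    unfolding gaussian_vec_def M_def[symmetric] Let_def t
    by (subst linear_image_eqI[OF I I, of M L]) (use M L in auto)
qed

lemma sets_gaussian_vec [simp, measurable_cong]: "sets (gaussian_vec I mu S) = sets (PiM I (\<lambda>_. borel))"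
  by (simp add: gaussian_vec_def Let_def)

lemma space_gaussian_vec [simp]: "space (gaussian_vec I mu S) = extensional I"
  by (simp add: gaussian_vec_def Let_def)

text \<open>Whatever \<open>SOME\<close> returns is some matrix, so \<open>gaussian_vec\<close> is
  an affine image of standard normals for every \<open>S\<close>; total mass and integrability
  follow without looking at \<open>S\<close>.\<close>

lemma gaussian_vec_ex:
  obtains L where "gaussian_vec I mu S = distr (PiM I (\<lambda>_. std_gauss)) (PiM I (\<lambda>_. borel))
    (\<lambda>z. \<lambda>i\<in>I. mu i + (\<Sum>k\<in>I. L i k * z k))"
  unfolding gaussian_vec_def Let_def by auto

lemma prob_space_gaussian_vec: "prob_space (gaussian_vec I mu S)"
proof -
  interpret G: prob_space "PiM I (\<lambda>_. std_gauss)" by (rule prob_space_PiM_std_gauss)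
  obtain L where L: "gaussian_vec I mu S = distr (PiM I (\<lambda>_. std_gauss)) (PiM I (\<lambda>_. borel))
    (\<lambda>z. \<lambda>i\<in>I. mu i + (\<Sum>k\<in>I. L i k * z k))" by (rule gaussian_vec_ex)
  show ?thesis unfolding L by (rule G.prob_space_distr) measurable
qed

lemma gaussian_vec_cong:
  assumes "\<And>i. i \<in> I \<Longrightarrow> mu i = mu' i" "\<And>i j. i \<in> I \<Longrightarrow> j \<in> I \<Longrightarrow> S i j = S' i j"
  shows "gaussian_vec I mu S = gaussian_vec I mu' S'"
proof -
  have "(\<lambda>L. \<forall>i\<in>I. \<forall>j\<in>I. S i j = (\<Sum>k\<in>I. L i k * L j k)) =
        (\<lambda>L. \<forall>i\<in>I. \<forall>j\<in>I. S' i j = (\<Sum>k\<in>I. L i k * L j k))"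
    using assms by auto
  then show ?thesis unfolding gaussian_vec_def Let_def using assms
    by (auto intro!: distr_cong cong: restrict_cong)
qed

text \<open>The counterpart of a program step in the limit: regression on the old coordinates plus
  independent noise of standard deviation \<open>s\<close>, possibly zero. For the extended Cholesky
  factor the noise is exactly the normal variable of column \<open>k\<close>.\<close>

lemma gaussian_vec_insert:
  assumes I: "finite I" "k \<notin> I" and S: "factorable I S"
    and cross: "\<And>j. j \<in> I \<Longrightarrow> S k j = (\<Sum>i\<in>I. c i * S i j)"
    and sym: "\<And>j. j \<in> I \<Longrightarrow> S j k = S k j"
    and diag: "S k k = (\<Sum>i\<in>I. \<Sum>j\<in>I. c i * S i j * c j) + s\<^sup>2"
    and mu: "mu k = (\<Sum>i\<in>I. c i * mu i)"
  shows "gaussian_vec (insert k I) mu S = distr (gaussian_vec I mu S \<Otimes>\<^sub>M std_gauss)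
     (PiM (insert k I) (\<lambda>_. borel)) (\<lambda>(z, t). z(k := (\<Sum>i\<in>I. c i * z i) + s * t))" (is "?l = ?r")
    and "factorable (insert k I) S"
proof -
  obtain L where L: "\<And>i j. i \<in> I \<Longrightarrow> j \<in> I \<Longrightarrow> S i j = (\<Sum>k\<in>I. L i k * L j k)"
    using S unfolding factorable_def by auto
  define L' where "L' = (\<lambda>i l. if i = k then (if l = k then s else (\<Sum>i\<in>I. c i * L i l)) else if l = k then 0 else L i l)"
  note L' = gauss_factor_extend[OF I L cross sym diag L'_def]
  then show "factorable (insert k I) S" unfolding factorable_def by blast
  let ?G = "PiM I (\<lambda>_. std_gauss)" and ?B = "PiM (insert k I) (\<lambda>_. borel :: real measure)"
  let ?BI = "PiM I (\<lambda>_. borel :: real measure)"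
  define Y where "Y = (\<lambda>z. \<lambda>i\<in>I. mu i + (\<Sum>k\<in>I. L i k * z k))"
  define Y' where "Y' = (\<lambda>z. \<lambda>i\<in>insert k I. mu i + (\<Sum>l\<in>insert k I. L' i l * z l))"
  have l: "?l = distr (PiM (insert k I) (\<lambda>_. std_gauss)) ?B Y'"
    unfolding Y'_def using I L' by (intro gaussian_vec_eq) auto
  have g: "gaussian_vec I mu S = distr ?G ?BI Y"
    unfolding Y_def using I L by (intro gaussian_vec_eq) auto
  have [measurable]: "Y \<in> measurable ?BI ?BI" "Y \<in> measurable ?G ?BI" "Y' \<in> measurable ?B ?B"
    "Y' \<in> measurable (PiM (insert k I) (\<lambda>_. std_gauss)) ?B"
    unfolding Y_def Y'_def by measurable
  interpret D: prob_space "gaussian_vec I mu S" by (rule prob_space_gaussian_vec)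
  interpret P: pair_sigma_finite "gaussian_vec I mu S" std_gauss ..
  have upd[measurable (raw)]: "(\<lambda>x. (f x)(k := g x)) \<in> measurable N ?B"
    if [measurable]: "f \<in> measurable N ?BI" "g \<in> measurable N borel" for f g and N :: "'n measure"
    by (rule measurable_fun_upd[where J=I]) (use that in auto)
  have Y': "Y' (x(k := t)) = (Y x)(k := (\<Sum>i\<in>I. c i * Y x i) + s * t)" if "x \<in> extensional I" for x t
  proof (rule ext)
    fix i
    have ne: "(\<Sum>l\<in>I. a l * (if l = k then t else x l)) = (\<Sum>l\<in>I. a l * x l)" for a
      using I by (intro sum.cong) auto
    have k: "(\<Sum>l\<in>I. L' k l * x l) = (\<Sum>i\<in>I. c i * (\<Sum>l\<in>I. L i l * x l))"
    proof -
      have "(\<Sum>l\<in>I. L' k l * x l) = (\<Sum>l\<in>I. (\<Sum>i\<in>I. c i * L i l) * x l)"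
        using I by (intro sum.cong) (auto simp: L'_def)
      also have "\<dots> = (\<Sum>i\<in>I. c i * (\<Sum>l\<in>I. L i l * x l))"
        by (subst sum_distrib_right, subst sum.swap) (simp add: sum_distrib_left mult.assoc)
      finally show ?thesis .
    qed
    have i: "(\<Sum>l\<in>I. L' i l * x l) = (\<Sum>l\<in>I. L i l * x l)" if "i \<in> I"
      using I that by (intro sum.cong) (auto simp: L'_def)
    consider "i = k" | "i \<noteq> k" "i \<in> I" | "i \<noteq> k" "i \<notin> I" by blast
    then show "Y' (x(k := t)) i = ((Y x)(k := (\<Sum>i\<in>I. c i * Y x i) + s * t)) i"
    proof cases
      case 1
      have "L' k k = s" by (simp add: L'_def)
      then show ?thesis using 1 I mu
        by (simp add: Y'_def Y_def ne k distrib_left sum.distrib)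
    next
      case 2
      then have "L' i k = 0" by (simp add: L'_def)
      then show ?thesis using 2 I by (simp add: Y'_def Y_def ne i)
    qed (simp add: Y'_def Y_def)
  qed
  show "?l = ?r"
  proof (rule measure_eqI)
    fix A assume "A \<in> sets ?l"
    then have A[measurable]: "A \<in> sets ?B" by simp
    define g where "g = (\<lambda>x t. indicator A (x(k := (\<Sum>i\<in>I. c i * x i) + s * t)) :: ennreal)"
    have [measurable (raw)]: "(\<lambda>x. g (p x) (q x)) \<in> borel_measurable N"
      if [measurable]: "p \<in> measurable N ?BI" "q \<in> measurable N borel" for p q and N :: "'n measure"
      unfolding g_def by measurable
    have "emeasure ?l A = (\<integral>\<^sup>+x. indicator A x \<partial>?l)" by simp
    also have "\<dots> = (\<integral>\<^sup>+z. indicator A (Y' z) \<partial>PiM (insert k I) (\<lambda>_. std_gauss))"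
      unfolding l by (rule nn_integral_distr) measurable
    also have "\<dots> = (\<integral>\<^sup>+x. \<integral>\<^sup>+t. indicator A (Y' (x(k := t))) \<partial>std_gauss \<partial>?G)"
      by (rule std_gauss_prod.product_nn_integral_insert[OF I]) measurable
    also have "\<dots> = (\<integral>\<^sup>+x. \<integral>\<^sup>+t. g (Y x) t \<partial>std_gauss \<partial>?G)"
      by (intro nn_integral_cong) (simp add: Y' g_def)
    also have "\<dots> = (\<integral>\<^sup>+y. \<integral>\<^sup>+t. g y t \<partial>std_gauss \<partial>gaussian_vec I mu S)"
      unfolding \<open>gaussian_vec I mu S = distr ?G ?BI Y\<close> by (rule nn_integral_distr[symmetric]) measurable
    also have "\<dots> = (\<integral>\<^sup>+p. g (fst p) (snd p) \<partial>(gaussian_vec I mu S \<Otimes>\<^sub>M std_gauss))"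
      by (subst std_gauss.nn_integral_fst[symmetric]) auto
    also have "\<dots> = (\<integral>\<^sup>+p. indicator A (case p of (x, t) \<Rightarrow> x(k := (\<Sum>i\<in>I. c i * x i) + s * t))
        \<partial>(gaussian_vec I mu S \<Otimes>\<^sub>M std_gauss))"
      by (simp add: g_def case_prod_beta)
    also have "\<dots> = (\<integral>\<^sup>+x. indicator A x \<partial>?r)"
      by (rule nn_integral_distr[symmetric]) measurable
    also have "\<dots> = emeasure ?r A" by simp
    finally show "emeasure ?l A = emeasure ?r A" .
  qed simp
qed

section \<open>Controlled functions\<close>

text \<open>The summand 1 lets one factor \<open>K\<close> absorb additive constants in the exponent
  as well.\<close>

definition growth :: "real \<Rightarrow> 'i set \<Rightarrow> ('i \<Rightarrow> real) \<Rightarrow> real" where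
  "growth p I z = 1 + (\<Sum>i\<in>I. \<bar>z i\<bar> powr p)"

text \<open>The exponent \<open>p < 2\<close> is an argument because one exponent has to serve the whole program.
  The sum of powers is equivalent to a power of the norm but makes the bound a product over coordinates.\<close>
definition ctrl :: "real \<Rightarrow> 'i set \<Rightarrow> (('i \<Rightarrow> real) \<Rightarrow> real) \<Rightarrow> bool" where
  "ctrl p I f \<longleftrightarrow> (\<exists>K\<ge>0. \<forall>z\<in>extensional I. \<bar>f z\<bar> \<le> exp (K * growth p I z))"

lemma growth_ge_1: "1 \<le> growth p I z"
  by (simp add: growth_def sum_nonneg)

lemma growth_nonneg: "0 \<le> growth p I z"
  using growth_ge_1[of p I z] by linarith

lemma ctrlI: "K \<ge> 0 \<Longrightarrow> (\<And>z. z \<in> extensional I \<Longrightarrow> \<bar>f z\<bar> \<le> exp (K * growth p I z)) \<Longrightarrow> ctrl p I f"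
  unfolding ctrl_def by blast

lemma ctrlE:
  assumes "ctrl p I f"
  obtains K where "K \<ge> 0" "\<And>z. z \<in> extensional I \<Longrightarrow> \<bar>f z\<bar> \<le> exp (K * growth p I z)"
  using assms unfolding ctrl_def by blast

lemma ctrl_le: "ctrl p I g \<Longrightarrow> (\<And>z. z \<in> extensional I \<Longrightarrow> \<bar>f z\<bar> \<le> \<bar>g z\<bar>) \<Longrightarrow> ctrl p I f"
  unfolding ctrl_def by (meson order_trans)

lemma ctrl_exp_growth: "ctrl p I (\<lambda>z. exp (K * growth p I z))"
  by (rule ctrlI[of "\<bar>K\<bar>"]) (auto simp: growth_nonneg mult_right_mono)

lemma ctrl_mult:
  assumes "ctrl p I f" "ctrl p I g"
  shows "ctrl p I (\<lambda>z. f z * g z)"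
proof -
  obtain K L where K: "K \<ge> 0" "\<And>z. z \<in> extensional I \<Longrightarrow> \<bar>f z\<bar> \<le> exp (K * growth p I z)"
    and L: "L \<ge> 0" "\<And>z. z \<in> extensional I \<Longrightarrow> \<bar>g z\<bar> \<le> exp (L * growth p I z)"
    using assms by (metis ctrlE)
  show ?thesis
  proof (rule ctrlI[of "K + L"])
    fix z :: "'a \<Rightarrow> real" assume "z \<in> extensional I"
    then have "\<bar>f z\<bar> * \<bar>g z\<bar> \<le> exp (K * growth p I z) * exp (L * growth p I z)"
      using K L by (intro mult_mono) auto
    then show "\<bar>f z * g z\<bar> \<le> exp ((K + L) * growth p I z)"
      by (simp add: abs_mult exp_add[symmetric] distrib_right)
  qed (use K L in simp)
qed

lemma ctrl_const: "ctrl p I (\<lambda>_. c)"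
proof (rule ctrlI[of "\<bar>c\<bar>"])
  fix z :: "'a \<Rightarrow> real"
  have "\<bar>c\<bar> \<le> exp \<bar>c\<bar>" using exp_ge_add_one_self[of "\<bar>c\<bar>"] by linarith
  also have "\<dots> \<le> exp (\<bar>c\<bar> * growth p I z)"
    using mult_left_mono[OF growth_ge_1[of p I z] abs_ge_zero[of c]] by simp
  finally show "\<bar>c\<bar> \<le> exp (\<bar>c\<bar> * growth p I z)" .
qed simp

lemma ctrl_add:
  assumes "ctrl p I f" "ctrl p I g"
  shows "ctrl p I (\<lambda>z. f z + g z)"
proof -
  obtain K L where K: "K \<ge> 0" "\<And>z. z \<in> extensional I \<Longrightarrow> \<bar>f z\<bar> \<le> exp (K * growth p I z)"
    and L: "L \<ge> 0" "\<And>z. z \<in> extensional I \<Longrightarrow> \<bar>g z\<bar> \<le> exp (L * growth p I z)"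
    using assms by (metis ctrlE)
  show ?thesis
  proof (rule ctrlI[of "K + L + 1"])
    fix z :: "'a \<Rightarrow> real" assume z: "z \<in> extensional I"
    let ?g = "growth p I z"
    have "\<bar>f z + g z\<bar> \<le> exp (K * ?g) + exp (L * ?g)"
      using K(2)[OF z] L(2)[OF z] by linarith
    also have "\<dots> \<le> 2 * exp ((K + L) * ?g)"
      using K L growth_nonneg[of p I z]
      by (intro order_trans[OF add_mono[of "exp (K * ?g)" "exp ((K + L) * ?g)" "exp (L * ?g)" "exp ((K + L) * ?g)"]])
         (auto intro!: mult_right_mono)
    also have "\<dots> \<le> exp ?g * exp ((K + L) * ?g)"
      using order_trans[OF _ exp_ge_add_one_self[of ?g], of 2] growth_ge_1[of p I z]
      by (intro mult_right_mono) auto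
    finally show "\<bar>f z + g z\<bar> \<le> exp ((K + L + 1) * ?g)"
      by (simp add: exp_add[symmetric] distrib_right add.commute)
  qed (use K L in simp)
qed

lemma ctrl_abs: "ctrl p I f \<Longrightarrow> ctrl p I (\<lambda>z. \<bar>f z\<bar>)"
  by (rule ctrl_le[of p I f]) auto

lemma ctrl_power: "ctrl p I f \<Longrightarrow> ctrl p I (\<lambda>z. f z ^ n)"
  by (induction n) (auto simp: ctrl_const intro: ctrl_mult)

lemma ctrl_sum: "(\<And>i. i \<in> A \<Longrightarrow> ctrl p I (f i)) \<Longrightarrow> ctrl p I (\<lambda>z. \<Sum>i\<in>A. f i z)"
  by (induction A rule: infinite_finite_induct) (auto simp: ctrl_const intro: ctrl_add)

lemma abs_le_powr: "p \<ge> 1 \<Longrightarrow> \<bar>x\<bar> \<le> 1 + \<bar>x\<bar> powr p" for x :: real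
proof (cases "\<bar>x\<bar> \<le> 1")
  case False
  assume "p \<ge> 1"
  then have "\<bar>x\<bar> powr 1 \<le> \<bar>x\<bar> powr p" using False by (intro powr_mono) auto
  then show ?thesis using False by simp
qed (simp add: add_increasing2)

lemma ctrl_coord:
  assumes "p \<ge> 1" "finite I" "i \<in> I"
  shows "ctrl p I (\<lambda>z. z i)"
proof (rule ctrlI[of 1])
  fix z :: "'a \<Rightarrow> real"
  have "\<bar>z i\<bar> \<le> 1 + \<bar>z i\<bar> powr p" by (rule abs_le_powr) fact
  also have "\<dots> \<le> growth p I z"
    unfolding growth_def using assms by (intro add_left_mono member_le_sum) auto
  also have "\<dots> \<le> exp (growth p I z)" using exp_ge_add_one_self[of "growth p I z"] by linarith
  finally show "\<bar>z i\<bar> \<le> exp (1 * growth p I z)" by simp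
qed simp

text \<open>Comparing the sum with its largest term works for every \<open>p > 0\<close>, at the
  price of a constant that is not sharp.\<close>

lemma powr_sum_le:
  fixes a :: "'i \<Rightarrow> real"
  assumes A: "finite A" and a: "\<And>i. i \<in> A \<Longrightarrow> 0 \<le> a i" and p: "p > 0"
  shows "(\<Sum>i\<in>A. a i) powr p \<le> real (card A) powr p * (\<Sum>i\<in>A. a i powr p)"
proof (cases "A = {}")
  case False
  define m where "m = Max (a ` A)"
  have le: "a i \<le> m" if "i \<in> A" for i using that A by (auto simp: m_def)
  have "m \<in> a ` A" unfolding m_def using A False by (intro Max_in) auto
  then obtain i where i: "i \<in> A" "m = a i" by blast
  have "(\<Sum>i\<in>A. a i) \<le> real (card A) * m"
    using sum_bounded_above[of A a m] le by simp
  then have "(\<Sum>i\<in>A. a i) powr p \<le> (real (card A) * m) powr p"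
    using p a by (intro powr_mono2) (auto intro!: sum_nonneg)
  also have "\<dots> = real (card A) powr p * m powr p"
    using i a by (simp add: powr_mult)
  also have "m powr p \<le> (\<Sum>i\<in>A. a i powr p)"
    unfolding i(2) using i A by (intro member_le_sum) auto
  finally show ?thesis by (simp add: mult_left_mono)
qed simp

lemma affine_powr_le:
  assumes I: "finite I" and p: "p > 0" and B: "B \<ge> 0"
  obtains D where "D \<ge> 0"
    "\<And>b l z. \<bar>b\<bar> \<le> B \<Longrightarrow> (\<And>k. k \<in> I \<Longrightarrow> \<bar>l k\<bar> \<le> B) \<Longrightarrow>
      \<bar>b + (\<Sum>k\<in>I. l k * z k)\<bar> powr p \<le> D * growth p I z"
proof
  \<comment> \<open>\<open>None\<close> stands for the constant term, treated as one more coordinate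
    with value 1; its power is the summand 1 of \<open>growth\<close>.\<close>
  let ?J = "insert None (Some ` I)"
  let ?D = "B powr p * real (card ?J) powr p"
  show "?D \<ge> 0" by simp
  fix b and l z :: "'a \<Rightarrow> real" assume b: "\<bar>b\<bar> \<le> B" and l: "\<And>k. k \<in> I \<Longrightarrow> \<bar>l k\<bar> \<le> B"
  let ?a = "\<lambda>j. case j of None \<Rightarrow> 1 | Some k \<Rightarrow> \<bar>z k\<bar>"
  have J: "(\<Sum>j\<in>?J. case j of None \<Rightarrow> u | Some k \<Rightarrow> v k) = u + (\<Sum>k\<in>I. v k)" for u and v :: "'a \<Rightarrow> real"
    using I by (subst sum.insert) (auto simp: sum.reindex)
  have "\<bar>b + (\<Sum>k\<in>I. l k * z k)\<bar> \<le> \<bar>b\<bar> + (\<Sum>k\<in>I. \<bar>l k\<bar> * \<bar>z k\<bar>)"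
    by (rule order_trans[OF abs_triangle_ineq add_left_mono[OF order_trans[OF sum_abs]]]) (simp add: abs_mult)
  also have "\<dots> \<le> B * 1 + (\<Sum>k\<in>I. B * \<bar>z k\<bar>)"
    using b l by (intro add_mono sum_mono mult_right_mono) auto
  also have "\<dots> = B * (\<Sum>j\<in>?J. ?a j)"
    unfolding J by (simp add: sum_distrib_left distrib_left)
  finally have "\<bar>b + (\<Sum>k\<in>I. l k * z k)\<bar> powr p \<le> (B * (\<Sum>j\<in>?J. ?a j)) powr p"
    using p by (intro powr_mono2) auto
  also have "\<dots> = B powr p * (\<Sum>j\<in>?J. ?a j) powr p"
    using B by (intro powr_mult)
  also have "\<dots> \<le> B powr p * (real (card ?J) powr p * (\<Sum>j\<in>?J. ?a j powr p))"
    using I p by (intro mult_left_mono powr_sum_le) (auto split: option.split)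
  also have "(\<Sum>j\<in>?J. ?a j powr p) = (\<Sum>j\<in>?J. case j of None \<Rightarrow> 1 | Some k \<Rightarrow> \<bar>z k\<bar> powr p)"
    by (intro sum.cong) (auto split: option.split)
  also have "\<dots> = growth p I z"
    unfolding J growth_def ..
  finally show "\<bar>b + (\<Sum>k\<in>I. l k * z k)\<bar> powr p \<le> ?D * growth p I z" by (simp add: mult.assoc)
qed

text \<open>The place where growth below the square matters. The factor 1/4 is half of the Gaussian
  exponent: what remains is \<open>exp (- t^2 / 4)\<close>, up to a constant the density of variance
  2 that serves as integrable bound below.\<close>

lemma abs_powr_le_square:
  fixes K p :: real
  assumes "K \<ge> 0" "0 < p" "p < 2"
  obtains C where "\<And>t. K * \<bar>t\<bar> powr p \<le> t\<^sup>2 / 4 + C"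
proof
  fix t :: real
  \<comment> \<open>Beyond this threshold \<open>\<bar>t\<bar> powr (2 - p)\<close> exceeds
    \<open>4 * K\<close> and the square wins; below it the left side is at most its value at the
    threshold.\<close>
  let ?T = "(4 * K) powr (1 / (2 - p))"
  show "K * \<bar>t\<bar> powr p \<le> t\<^sup>2 / 4 + K * ?T powr p"
  proof (cases "\<bar>t\<bar> \<le> ?T")
    case True
    then have "K * \<bar>t\<bar> powr p \<le> K * ?T powr p"
      using assms by (intro mult_left_mono powr_mono2) auto
    then show ?thesis by (simp add: add_increasing)
  next
    case False
    have t0: "\<bar>t\<bar> > 0" using False powr_ge_zero[of "4 * K" "1 / (2 - p)"] by linarith
    have "?T powr (2 - p) \<le> \<bar>t\<bar> powr (2 - p)"
      using False assms by (intro powr_mono2) auto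
    then have "4 * K \<le> \<bar>t\<bar> powr (2 - p)"
      using assms by (simp add: powr_powr)
    then have "4 * K * \<bar>t\<bar> powr p \<le> \<bar>t\<bar> powr (2 - p) * \<bar>t\<bar> powr p"
      by (intro mult_right_mono) auto
    also have "\<dots> = t\<^sup>2" using t0 by (simp add: powr_add[symmetric] powr_numeral)
    finally have "K * \<bar>t\<bar> powr p \<le> t\<^sup>2 / 4" by simp
    moreover have "0 \<le> K * ?T powr p" using assms by simp
    ultimately show ?thesis by linarith
  qed
qed

lemma integrable_std_gauss_exp_powr:
  assumes p: "0 < p" "p < 2"
  shows "integrable std_gauss (\<lambda>t. exp (K * \<bar>t\<bar> powr p))"
proof -
  obtain C where C: "\<And>t. \<bar>K\<bar> * \<bar>t\<bar> powr p \<le> t\<^sup>2 / 4 + C"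
    using abs_powr_le_square[of "\<bar>K\<bar>" p] p by auto
  have "integrable lborel (\<lambda>t. std_normal_density t *\<^sub>R exp (K * \<bar>t\<bar> powr p))"
  proof (rule Bochner_Integration.integrable_bound)
    show "integrable lborel (\<lambda>t. sqrt 2 * exp C * normal_density 0 (sqrt 2) t)" by auto
    show "AE t in lborel. norm (std_normal_density t *\<^sub>R exp (K * \<bar>t\<bar> powr p))
      \<le> norm (sqrt 2 * exp C * normal_density 0 (sqrt 2) t)"
    proof (rule AE_I2)
      fix t :: real
      have "K * \<bar>t\<bar> powr p \<le> \<bar>K\<bar> * \<bar>t\<bar> powr p" by (intro mult_right_mono) auto
      then have "- t\<^sup>2 / 2 + K * \<bar>t\<bar> powr p \<le> C + - t\<^sup>2 / 4" using C[of t] by simp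
      then have "exp (- t\<^sup>2 / 2) * exp (K * \<bar>t\<bar> powr p) \<le> exp C * exp (- t\<^sup>2 / 4)"
        by (simp only: exp_add[symmetric] exp_le_cancel_iff)
      then have "1 / sqrt (2 * pi) * (exp (- t\<^sup>2 / 2) * exp (K * \<bar>t\<bar> powr p)) \<le> 1 / sqrt (2 * pi) * (exp C * exp (- t\<^sup>2 / 4))"
        by (rule mult_left_mono) simp
      moreover have "sqrt 2 * normal_density 0 (sqrt 2) t = 1 / sqrt (2 * pi) * exp (- t\<^sup>2 / 4)"
        by (simp add: normal_density_def real_sqrt_mult field_simps)
      ultimately show "norm (std_normal_density t *\<^sub>R exp (K * \<bar>t\<bar> powr p))
        \<le> norm (sqrt 2 * exp C * normal_density 0 (sqrt 2) t)"
        by (simp add: std_normal_density_def mult.assoc mult.left_commute)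
    qed
  qed measurable
  then show ?thesis by (subst integrable_density) auto
qed

lemma integrable_gaussian_vec:
  assumes I: "finite I" and p: "0 < p" "p < 2" and f: "ctrl p I f"
    and [measurable]: "f \<in> borel_measurable (PiM I (\<lambda>_. borel))"
  shows "integrable (gaussian_vec I mu S) f"
proof -
  obtain L where L: "gaussian_vec I mu S = distr (PiM I (\<lambda>_. std_gauss)) (PiM I (\<lambda>_. borel))
    (\<lambda>z. \<lambda>i\<in>I. mu i + (\<Sum>k\<in>I. L i k * z k))" by (rule gaussian_vec_ex)
  define Y where "Y = (\<lambda>z. \<lambda>i\<in>I. mu i + (\<Sum>k\<in>I. L i k * z k))"
  define B where "B = (\<Sum>i\<in>I. \<bar>mu i\<bar> + (\<Sum>k\<in>I. \<bar>L i k\<bar>))"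
  have B0: "B \<ge> 0" unfolding B_def by (intro sum_nonneg add_nonneg_nonneg) auto
  have row: "\<bar>mu i\<bar> + (\<Sum>k\<in>I. \<bar>L i k\<bar>) \<le> B" if "i \<in> I" for i
    unfolding B_def using I that by (intro member_le_sum) (auto intro!: add_nonneg_nonneg sum_nonneg)
  have muB: "\<bar>mu i\<bar> \<le> B" if "i \<in> I" for i
    by (rule order_trans[OF _ row[OF that]]) (simp add: sum_nonneg)
  have LB: "\<bar>L i k\<bar> \<le> B" if "i \<in> I" "k \<in> I" for i k
    using row[OF that(1)] member_le_sum[of k I "\<lambda>k. \<bar>L i k\<bar>"] I that by auto
  obtain D where D: "D \<ge> 0" "\<And>b l z. \<bar>b\<bar> \<le> B \<Longrightarrow> (\<And>k. k \<in> I \<Longrightarrow> \<bar>l k\<bar> \<le> B) \<Longrightarrow>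
      \<bar>b + (\<Sum>k\<in>I. l k * z k)\<bar> powr p \<le> D * growth p I z"
    using affine_powr_le[OF I p(1) B0] by metis
  obtain K where K: "K \<ge> 0" "\<And>z. z \<in> extensional I \<Longrightarrow> \<bar>f z\<bar> \<le> exp (K * growth p I z)"
    using f by (metis ctrlE)
  \<comment> \<open>Each of the \<open>card I\<close> coordinates of the affine image costs a factor
    \<open>D\<close>, and the constant summand of \<open>growth\<close> costs 1.\<close>
  define K' where "K' = K * (1 + real (card I) * D)"
  have K': "K * growth p I (Y z) \<le> K' * growth p I z" for z
  proof -
    have "growth p I (Y z) \<le> growth p I z + (\<Sum>i\<in>I. D * growth p I z)"
      unfolding growth_def[of p I "Y z"]
      by (intro add_mono sum_mono growth_ge_1) (auto simp: Y_def intro!: D muB LB)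
    from mult_left_mono[OF this K(1)] show ?thesis by (simp add: K'_def algebra_simps)
  qed
  have "integrable (PiM I (\<lambda>_. std_gauss)) (\<lambda>z. f (Y z))"
  proof (rule Bochner_Integration.integrable_bound)
    show "integrable (PiM I (\<lambda>_. std_gauss)) (\<lambda>z. exp K' * (\<Prod>i\<in>I. exp (K' * \<bar>z i\<bar> powr p)))"
      by (intro integrable_mult_right std_gauss_prod.product_integrable_prod I integrable_std_gauss_exp_powr p)
    show "(\<lambda>z. f (Y z)) \<in> borel_measurable (PiM I (\<lambda>_. std_gauss))" unfolding Y_def by measurable
    show "AE z in PiM I (\<lambda>_. std_gauss). norm (f (Y z)) \<le> norm (exp K' * (\<Prod>i\<in>I. exp (K' * \<bar>z i\<bar> powr p)))"
    proof (rule AE_I2)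
      fix z
      have "norm (f (Y z)) \<le> exp (K * growth p I (Y z))" using K(2)[of "Y z"] by (simp add: Y_def)
      also have "\<dots> \<le> exp (K' * growth p I z)" using K' by simp
      also have "\<dots> = exp K' * (\<Prod>i\<in>I. exp (K' * \<bar>z i\<bar> powr p))"
        using I by (simp add: growth_def distrib_left exp_add sum_distrib_left exp_sum)
      finally show "norm (f (Y z)) \<le> norm (exp K' * (\<Prod>i\<in>I. exp (K' * \<bar>z i\<bar> powr p)))"
        by (simp add: prod_nonneg)
    qed
  qed
  then show ?thesis unfolding L Y_def by (subst integrable_distr_eq) (auto simp: Y_def)
qed

text \<open>The coefficients of a program step are random, so the bound has to be uniform over all
  coefficients below \<open>B\<close>. It factors: the part in \<open>z\<close> is again controlled
  and can be averaged by induction, the part in \<open>t\<close> is Gaussian integrable.\<close>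

lemma ctrl_update_bound:
  assumes I: "finite I" "k \<notin> I" and p: "0 < p" "p < 2" and B: "B \<ge> 0" and f: "ctrl p (insert k I) f"
  shows "\<exists>K\<ge>0. \<forall>z c s t. z \<in> extensional I \<longrightarrow> (\<forall>i\<in>I. \<bar>c i\<bar> \<le> B) \<longrightarrow> \<bar>s\<bar> \<le> B \<longrightarrow>
       \<bar>f (z(k := (\<Sum>i\<in>I. c i * z i) + s * t))\<bar> \<le> exp (K * growth p I z) * exp (K * \<bar>t\<bar> powr p)"
proof -
  obtain D where D: "D \<ge> 0" "\<And>b l z. \<bar>b\<bar> \<le> B \<Longrightarrow> (\<And>j. j \<in> insert k I \<Longrightarrow> \<bar>l j\<bar> \<le> B) \<Longrightarrow>
      \<bar>b + (\<Sum>j\<in>insert k I. l j * z j)\<bar> powr p \<le> D * growth p (insert k I) z"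
    using affine_powr_le[of "insert k I" p B] I p(1) B by (metis finite.insertI)
  obtain K where K: "K \<ge> 0" "\<And>z. z \<in> extensional (insert k I) \<Longrightarrow> \<bar>f z\<bar> \<le> exp (K * growth p (insert k I) z)"
    using f by (metis ctrlE)
  have gi: "growth p (insert k I) (z(k := y)) = \<bar>y\<bar> powr p + growth p I z" for z y
    using I by (simp add: growth_def fun_upd_def cong: sum.cong)
       (auto intro!: sum.cong)
  show ?thesis
  proof (rule exI[of _ "K * (1 + D)"], intro conjI allI impI)
    fix z c :: "'a \<Rightarrow> real" and s t :: real
    assume z: "z \<in> extensional I" and c: "\<forall>i\<in>I. \<bar>c i\<bar> \<le> B" and s: "\<bar>s\<bar> \<le> B"
    let ?y = "(\<Sum>i\<in>I. c i * z i) + s * t"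
    \<comment> \<open>The noise \<open>t\<close> is read as coordinate \<open>k\<close> with
      coefficient \<open>s\<close>, so that the affine bound covers it.\<close>
    have "\<bar>?y\<bar> powr p = \<bar>0 + (\<Sum>j\<in>insert k I. (c(k := s)) j * (z(k := t)) j)\<bar> powr p"
      using I by (simp add: add.commute) (auto intro!: arg_cong[where f="\<lambda>x. \<bar>_ + x\<bar> powr p"] sum.cong)
    also have "\<dots> \<le> D * growth p (insert k I) (z(k := t))"
      using B c s by (intro D) auto
    finally have y: "\<bar>?y\<bar> powr p \<le> D * (\<bar>t\<bar> powr p + growth p I z)" by (simp only: gi)
    have "\<bar>f (z(k := ?y))\<bar> \<le> exp (K * growth p (insert k I) (z(k := ?y)))"
      using z by (intro K) (auto simp: extensional_def)
    also have "\<dots> \<le> exp (K * (1 + D) * growth p I z + K * (1 + D) * \<bar>t\<bar> powr p)"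
    proof -
      have "\<bar>?y\<bar> powr p + growth p I z \<le> (1 + D) * growth p I z + (1 + D) * \<bar>t\<bar> powr p"
        using y by (simp add: algebra_simps add_increasing)
      from mult_left_mono[OF this K(1)] show ?thesis by (simp add: gi algebra_simps)
    qed
    finally show "\<bar>f (z(k := ?y))\<bar> \<le> exp (K * (1 + D) * growth p I z) * exp (K * (1 + D) * \<bar>t\<bar> powr p)"
      by (simp add: exp_add)
  qed (use K D in simp)
qed

section \<open>Fourth moments and almost sure convergence\<close>

context prob_space
begin

lemma integrable_power_le:
  fixes X :: "'a \<Rightarrow> real"
  assumes "integrable M (\<lambda>w. X w ^ 4)" and [measurable]: "X \<in> borel_measurable M" and "k \<le> 4"
  shows "integrable M (\<lambda>w. X w ^ k)"
proof (rule Bochner_Integration.integrable_bound)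
  show "integrable M (\<lambda>w. 1 + X w ^ 4)" using assms by (intro Bochner_Integration.integrable_add) auto
  show "AE w in M. norm (X w ^ k) \<le> norm (1 + X w ^ 4)"
  proof (rule AE_I2)
    fix w
    have "\<bar>X w\<bar> ^ k \<le> 1 + \<bar>X w\<bar> ^ 4"
    proof (cases "\<bar>X w\<bar> \<le> 1")
      case True then show ?thesis by (intro order_trans[OF power_le_one]) auto
    next
      case False then show ?thesis using power_increasing[OF \<open>k \<le> 4\<close>, of "\<bar>X w\<bar>"] by linarith
    qed
    then show "norm (X w ^ k) \<le> norm (1 + X w ^ 4)" by (simp add: power_abs)
  qed
qed measurable

lemma square_expectation_le:
  fixes X :: "'a \<Rightarrow> real"
  assumes "integrable M (\<lambda>w. (X w)\<^sup>2)" and "integrable M X"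
  shows "(expectation X)\<^sup>2 \<le> expectation (\<lambda>w. (X w)\<^sup>2)"
  using variance_eq[OF assms(2,1)] variance_positive[of X] by simp

text \<open>When an independent centred \<open>Y\<close> is added to \<open>S\<close>, the odd terms
  of \<open>(Y + S)^4\<close> carry a factor \<open>E Y\<close> or \<open>E S\<close> and drop out.
  With \<open>q\<close> the root of \<open>E Y^4\<close>, which bounds \<open>E Y^2\<close>, what
  remains is at most \<open>q^2 + 6 q T + 3 T^2\<close>, hence at most \<open>3 (q + T)^2\<close>.
  The second moment is carried along to bound the middle term.\<close>

lemma fourth_moment_sum:
  fixes X :: "'i \<Rightarrow> 'a \<Rightarrow> real"
  assumes "finite A" "indep_vars (\<lambda>_. borel) X A"
    and "\<And>i. i \<in> A \<Longrightarrow> integrable M (\<lambda>w. X i w ^ 4)" and "\<And>i. i \<in> A \<Longrightarrow> expectation (X i) = 0"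
  shows "integrable M (\<lambda>w. (\<Sum>i\<in>A. X i w) ^ 4) \<and> expectation (\<lambda>w. \<Sum>i\<in>A. X i w) = 0 \<and>
    expectation (\<lambda>w. (\<Sum>i\<in>A. X i w)\<^sup>2) \<le> (\<Sum>i\<in>A. sqrt (expectation (\<lambda>w. X i w ^ 4))) \<and>
    expectation (\<lambda>w. (\<Sum>i\<in>A. X i w) ^ 4) \<le> 3 * (\<Sum>i\<in>A. sqrt (expectation (\<lambda>w. X i w ^ 4)))\<^sup>2"
  using assms
proof (induction A)
  case (insert i A)
  define S where "S = (\<lambda>w. \<Sum>i\<in>A. X i w)"
  define Y where "Y = X i"
  define T where "T = (\<Sum>i\<in>A. sqrt (expectation (\<lambda>w. X i w ^ 4)))"
  define q where "q = sqrt (expectation (\<lambda>w. Y w ^ 4))"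
  have iA: "indep_vars (\<lambda>_. borel) X A" using insert.prems(1) by (rule indep_vars_subset) auto
  have IH: "integrable M (\<lambda>w. S w ^ 4)" "expectation S = 0" "expectation (\<lambda>w. (S w)\<^sup>2) \<le> T"
    "expectation (\<lambda>w. S w ^ 4) \<le> 3 * T\<^sup>2"
    using insert.IH[OF iA] insert.prems unfolding S_def T_def by auto
  have YS: "indep_var borel Y borel S"
    unfolding Y_def S_def using insert by (intro indep_vars_sum) auto
  have [measurable]: "Y \<in> borel_measurable M" "S \<in> borel_measurable M"
    using indep_var_rv1[OF YS] indep_var_rv2[OF YS] by auto
  have Y4: "integrable M (\<lambda>w. Y w ^ 4)" and Y0: "expectation Y = 0" using insert.prems by (auto simp: Y_def)
  have iY: "k \<le> 4 \<Longrightarrow> integrable M (\<lambda>w. Y w ^ k)" and iS: "k \<le> 4 \<Longrightarrow> integrable M (\<lambda>w. S w ^ k)" for k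
    using integrable_power_le[OF Y4, of k] integrable_power_le[OF IH(1), of k] by auto
  have ind: "indep_var borel (\<lambda>w. Y w ^ j) borel (\<lambda>w. S w ^ k)" for j k
    using indep_var_compose[OF YS, of "\<lambda>x. x ^ j" borel "\<lambda>x. x ^ k" borel] by (simp add: comp_def)
  have ijk: "integrable M (\<lambda>w. Y w ^ j * S w ^ k)" if "j \<le> 4" "k \<le> 4" for j k
    using indep_var_integrable[OF ind iY iS] that by auto
  have ejk: "expectation (\<lambda>w. Y w ^ j * S w ^ k) = expectation (\<lambda>w. Y w ^ j) * expectation (\<lambda>w. S w ^ k)"
    if "j \<le> 4" "k \<le> 4" for j k
    using indep_var_lebesgue_integral[OF ind iY iS] that by auto
  have EY2: "expectation (\<lambda>w. (Y w)\<^sup>2) \<le> q"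
  proof -
    have "(expectation (\<lambda>w. (Y w)\<^sup>2))\<^sup>2 \<le> expectation (\<lambda>w. ((Y w)\<^sup>2)\<^sup>2)"
      using iY[of 2] Y4 by (intro square_expectation_le) auto
    then show ?thesis unfolding q_def by (intro real_le_rsqrt) simp
  qed
  have q: "0 \<le> q" "q\<^sup>2 = expectation (\<lambda>w. Y w ^ 4)" unfolding q_def by auto
  have T: "0 \<le> T" unfolding T_def by (intro sum_nonneg) auto
  have ES2: "0 \<le> expectation (\<lambda>w. (S w)\<^sup>2)" by simp
  have p4: "(Y w + S w) ^ 4 = Y w ^ 4 * S w ^ 0 + 4 * (Y w ^ 3 * S w ^ 1) + 6 * (Y w ^ 2 * S w ^ 2)
      + 4 * (Y w ^ 1 * S w ^ 3) + Y w ^ 0 * S w ^ 4" for w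
    by (simp add: power4_eq_xxxx power3_eq_cube power2_eq_square algebra_simps)
  have p2: "(Y w + S w)\<^sup>2 = Y w ^ 2 * S w ^ 0 + 2 * (Y w ^ 1 * S w ^ 1) + Y w ^ 0 * S w ^ 2" for w
    by (simp add: power2_eq_square algebra_simps)
  have sum: "(\<Sum>i\<in>insert i A. X i w) = Y w + S w" for w using insert by (simp add: Y_def S_def)
  have sumq: "(\<Sum>i\<in>insert i A. sqrt (expectation (\<lambda>w. X i w ^ 4))) = q + T"
    using insert by (simp add: q_def T_def Y_def)
  have "integrable M (\<lambda>w. (Y w + S w) ^ 4)"
    unfolding p4 by (intro Bochner_Integration.integrable_add integrable_mult_right ijk) auto
  moreover have "expectation (\<lambda>w. Y w + S w) = 0"
    using iY[of 1] iS[of 1] Y0 IH(2) by simp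
  moreover have "expectation (\<lambda>w. (Y w + S w)\<^sup>2) \<le> q + T"
  proof -
    have "expectation (\<lambda>w. (Y w + S w)\<^sup>2) = expectation (\<lambda>w. (Y w)\<^sup>2) + expectation (\<lambda>w. (S w)\<^sup>2)"
      unfolding p2 using ijk[of 2 0] ijk[of 1 1] ijk[of 0 2] ejk[of 1 1] Y0
      by (simp add: Bochner_Integration.integral_add)
    then show ?thesis using EY2 IH(3) by linarith
  qed
  moreover have "expectation (\<lambda>w. (Y w + S w) ^ 4) \<le> 3 * (q + T)\<^sup>2"
  proof -
    have "expectation (\<lambda>w. (Y w + S w) ^ 4) =
        q\<^sup>2 + 6 * (expectation (\<lambda>w. (Y w)\<^sup>2) * expectation (\<lambda>w. (S w)\<^sup>2)) + expectation (\<lambda>w. S w ^ 4)"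
      unfolding p4 q using ijk[of 4 0] ijk[of 3 1] ijk[of 2 2] ijk[of 1 3] ijk[of 0 4]
        ejk[of 3 1] ejk[of 2 2] ejk[of 1 3] Y0 IH(2)
      by (simp add: Bochner_Integration.integral_add)
    also have "\<dots> \<le> q\<^sup>2 + 6 * (q * T) + 3 * T\<^sup>2"
      using EY2 IH ES2 q T by (intro add_mono mult_left_mono mult_mono) auto
    also have "\<dots> \<le> 3 * (q + T)\<^sup>2"
      using q T by (simp add: power2_eq_square algebra_simps)
    finally show ?thesis .
  qed
  ultimately show ?case unfolding sum sumq by simp
qed simp

text \<open>\<open>C\<close> bounds the average of the fourth moments, not each of them, since that
  is all the law of large numbers provides for the conditional moments. Markov for the fourth power
  gives the order 1/n^2. The constant is 3 * 16: 3 from \<open>fourth_moment_sum\<close>, 16 from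
  centring by \<open>(a + b)^4 <= 8 a^4 + 8 b^4\<close> and Jensen.\<close>

lemma fourth_moment_tail:
  fixes X :: "'i \<Rightarrow> 'a \<Rightarrow> real"
  assumes A: "finite A" and ind: "indep_vars (\<lambda>_. borel) X A"
    and int: "\<And>i. i \<in> A \<Longrightarrow> integrable M (\<lambda>w. X i w ^ 4)"
    and C: "(\<Sum>i\<in>A. expectation (\<lambda>w. X i w ^ 4)) \<le> real (card A) * C"
    and e: "e > 0" "A \<noteq> {}"
  shows "prob {w \<in> space M. e * real (card A) \<le> \<bar>\<Sum>i\<in>A. X i w - expectation (X i)\<bar>} \<le> 48 * C / (e ^ 4 * (real (card A))\<^sup>2)"
proof -
  define n where "n = real (card A)"
  have n: "n > 0" using e A by (auto simp: n_def card_gt_0_iff)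
  define Y where "Y = (\<lambda>i w. X i w - expectation (X i))"
  have Xm: "X i \<in> borel_measurable M" if "i \<in> A" for i
    using ind that unfolding indep_vars_def by auto
  have iX: "integrable M (\<lambda>w. X i w ^ k)" if "i \<in> A" "k \<le> 4" for i k
    using integrable_power_le[OF int Xm] that by auto
  have Yp: "Y i w ^ 4 \<le> 8 * X i w ^ 4 + 8 * expectation (X i) ^ 4" for i w
  proof -
    have sq: "(a + b)\<^sup>2 \<le> 2 * a\<^sup>2 + 2 * b\<^sup>2" for a b :: real
      using sum_squares_bound[of a b] by (simp add: power2_sum)
    have "(Y i w)\<^sup>2 \<le> 2 * (X i w)\<^sup>2 + 2 * (expectation (X i))\<^sup>2"
      using sq[of "X i w" "- expectation (X i)"] by (simp add: Y_def)
    then have "((Y i w)\<^sup>2)\<^sup>2 \<le> (2 * (X i w)\<^sup>2 + 2 * (expectation (X i))\<^sup>2)\<^sup>2"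
      by (intro power_mono) auto
    also have "\<dots> \<le> 2 * (2 * (X i w)\<^sup>2)\<^sup>2 + 2 * (2 * (expectation (X i))\<^sup>2)\<^sup>2" by (rule sq)
    finally show ?thesis by (simp add: power_mult_distrib)
  qed
  have iY: "integrable M (\<lambda>w. Y i w ^ 4)" if "i \<in> A" for i
  proof (rule Bochner_Integration.integrable_bound)
    show "integrable M (\<lambda>w. 8 * X i w ^ 4 + 8 * expectation (X i) ^ 4)"
      using int[OF that] by (intro Bochner_Integration.integrable_add) auto
    show "AE w in M. norm (Y i w ^ 4) \<le> norm (8 * X i w ^ 4 + 8 * expectation (X i) ^ 4)"
      using Yp by (intro AE_I2) (simp add: order_trans[OF _ abs_ge_self])
  qed (use Xm[OF that] in \<open>simp add: Y_def\<close>)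
  have EY: "expectation (\<lambda>w. Y i w ^ 4) \<le> 16 * expectation (\<lambda>w. X i w ^ 4)" if "i \<in> A" for i
  proof -
    have "(expectation (X i))\<^sup>2 \<le> expectation (\<lambda>w. (X i w)\<^sup>2)"
      using iX[OF that, of 2] iX[OF that, of 1] by (intro square_expectation_le) auto
    then have "((expectation (X i))\<^sup>2)\<^sup>2 \<le> (expectation (\<lambda>w. (X i w)\<^sup>2))\<^sup>2" by (intro power_mono) auto
    also have "\<dots> \<le> expectation (\<lambda>w. ((X i w)\<^sup>2)\<^sup>2)"
      using iX[OF that, of 2] iX[OF that, of 4] by (intro square_expectation_le) auto
    finally have E: "expectation (X i) ^ 4 \<le> expectation (\<lambda>w. X i w ^ 4)" by simp
    have "expectation (\<lambda>w. Y i w ^ 4) \<le> expectation (\<lambda>w. 8 * X i w ^ 4 + 8 * expectation (X i) ^ 4)"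
      using iY[OF that] int[OF that] Yp by (intro integral_mono) auto
    also have "\<dots> = 8 * expectation (\<lambda>w. X i w ^ 4) + 8 * expectation (X i) ^ 4"
      using int[OF that] by (simp add: prob_space)
    finally show ?thesis using E by simp
  qed
  have indY: "indep_vars (\<lambda>_. borel) Y A"
    unfolding Y_def by (rule indep_vars_compose2[OF ind]) simp
  define S where "S = (\<lambda>w. \<Sum>i\<in>A. Y i w)"
  have S: "integrable M (\<lambda>w. S w ^ 4)"
    "expectation (\<lambda>w. S w ^ 4) \<le> 3 * (\<Sum>i\<in>A. sqrt (expectation (\<lambda>w. Y i w ^ 4)))\<^sup>2"
    using fourth_moment_sum[OF A indY iY] iX[of _ 1] unfolding S_def by (auto simp: Y_def prob_space)
  have "(\<Sum>i\<in>A. sqrt (expectation (\<lambda>w. Y i w ^ 4)))\<^sup>2 \<le> n * (\<Sum>i\<in>A. (sqrt (expectation (\<lambda>w. Y i w ^ 4)))\<^sup>2)"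
    unfolding n_def using A sum_squared_le_sum_of_squares[of "\<lambda>i. sqrt (expectation (\<lambda>w. Y i w ^ 4))" A] by (simp add: mult.commute)
  also have "\<dots> = n * (\<Sum>i\<in>A. expectation (\<lambda>w. Y i w ^ 4))"
    by (intro arg_cong2[where f="(*)"] sum.cong) auto
  also have "\<dots> \<le> n * (\<Sum>i\<in>A. 16 * expectation (\<lambda>w. X i w ^ 4))"
    using n EY by (intro mult_left_mono sum_mono) auto
  also have "\<dots> \<le> n * (16 * (n * C))"
    using C n by (intro mult_left_mono) (auto simp: sum_distrib_left[symmetric] n_def)
  finally have S4: "expectation (\<lambda>w. S w ^ 4) \<le> 48 * n\<^sup>2 * C"
    using S(2) by (simp add: power2_eq_square)
  have "prob {w \<in> space M. (e * n) ^ 4 \<le> S w ^ 4} \<le> expectation (\<lambda>w. S w ^ 4) / (e * n) ^ 4"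
    using n e by (intro integral_Markov_inequality_measure[OF S(1), where A="{}"]) auto
  also have "\<dots> \<le> 48 * n\<^sup>2 * C / (e * n) ^ 4"
    using S4 by (intro divide_right_mono) auto
  also have "\<dots> = 48 * C / (e ^ 4 * n\<^sup>2)"
    using n e by (simp add: power_mult_distrib field_simps power4_eq_xxxx power2_eq_square)
  also have "{w \<in> space M. (e * n) ^ 4 \<le> S w ^ 4} = {w \<in> space M. e * n \<le> \<bar>S w\<bar>}"
  proof -
    have "(e * n) ^ 4 \<le> S w ^ 4 \<longleftrightarrow> e * n \<le> \<bar>S w\<bar>" for w
      using power_mono_iff[of "e * n" "\<bar>S w\<bar>" 4] n e by (simp add: power_even_abs)
    then show ?thesis by simp
  qed
  finally show ?thesis by (simp add: S_def Y_def n_def)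
qed

text \<open>Borel-Cantelli for a tail of order 1/n^2. The set at \<open>n = 0\<close> is replaced by
  the empty set, as the hypotheses start at 1.\<close>

lemma AE_eventually_notin:
  assumes A: "\<And>n. n \<ge> 1 \<Longrightarrow> A n \<in> events" and C: "\<And>n. n \<ge> 1 \<Longrightarrow> prob (A n) \<le> C / (real n)\<^sup>2"
  shows "AE w in M. \<forall>\<^sub>F n in sequentially. w \<notin> A n"
proof -
  define B where "B = (\<lambda>n. if n \<ge> 1 then A n else {})"
  have "AE w in M. \<forall>\<^sub>F n in sequentially. w \<in> space M - B n"
  proof (rule borel_cantelli_AE1)
    show "B n \<in> events" for n using A by (simp add: B_def)
    show "summable (\<lambda>n. prob (B n))"
    proof (rule summable_comparison_test)
      have "summable (\<lambda>n. 1 / (real n)\<^sup>2)" using inverse_power_summable[of 2, where 'a=real] by (simp add: inverse_eq_divide)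
      then show "summable (\<lambda>n. C * (1 / (real n)\<^sup>2))" by (rule summable_mult)
      show "\<exists>N. \<forall>n\<ge>N. norm (prob (B n)) \<le> C * (1 / (real n)\<^sup>2)"
        using C by (intro exI[of _ 1]) (auto simp: B_def)
    qed
  qed (simp add: emeasure_eq_measure)
  then show ?thesis
  proof (eventually_elim)
    case (elim w)
    then show ?case using eventually_ge_at_top[of 1] by eventually_elim (auto simp: B_def)
  qed
qed

text \<open>The functions vary with the coordinate because, given the past, every coordinate is an
  affine image of its own noise with its own shift.\<close>

lemma PiM_coordinates_tail:
  fixes f :: "nat \<Rightarrow> 'a \<Rightarrow> real"
  assumes f: "\<And>i. i < n \<Longrightarrow> f i \<in> borel_measurable M"
    and int: "\<And>i. i < n \<Longrightarrow> integrable M (\<lambda>w. f i w ^ 4)"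
    and C: "(\<Sum>i<n. expectation (\<lambda>w. f i w ^ 4)) \<le> real n * C" and e: "e > 0" and n: "n \<ge> 1"
  shows "measure (PiM {..<n} (\<lambda>_. M)) {w \<in> space (PiM {..<n} (\<lambda>_. M)).
      e * real n \<le> \<bar>\<Sum>i<n. f i (w i) - expectation (f i)\<bar>} \<le> 48 * C / (e ^ 4 * (real n)\<^sup>2)"
proof -
  let ?P = "PiM {..<n} (\<lambda>_. M)"
  interpret P: prob_space ?P by (intro prob_space_PiM prob_space_axioms)
  have comp: "distr ?P M (\<lambda>w. w i) = M" if "i < n" for i
    using that by (intro distr_PiM_component[where I="{..<n}" and M="\<lambda>_. M"] prob_space_axioms) auto
  have "P.indep_vars (\<lambda>_. M) (\<lambda>i w. w i) {..<n}"
  proof (subst P.indep_vars_iff_distr_eq_PiM')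
    have "0 \<in> {..<n}" using n by simp
    then show "{..<n} \<noteq> {}" by blast
    have "distr ?P ?P (\<lambda>x. \<lambda>i\<in>{..<n}. x i) = distr ?P ?P (\<lambda>x. x)"
      by (rule distr_cong) (auto simp: space_PiM)
    also have "\<dots> = ?P" by (rule distr_id)
    also have "\<dots> = PiM {..<n} (\<lambda>i. distr ?P M (\<lambda>x. x i))"
      by (rule PiM_cong) (auto simp: comp)
    finally show "distr ?P ?P (\<lambda>x. \<lambda>i\<in>{..<n}. x i) = PiM {..<n} (\<lambda>i. distr ?P M (\<lambda>x. x i))" .
  qed measurable
  then have ind: "P.indep_vars (\<lambda>_. borel) (\<lambda>i w. f i (w i)) {..<n}"
    by (rule P.indep_vars_compose2) (use f in auto)
  have E: "P.expectation (\<lambda>w. g (w i)) = expectation g" if "i < n" "g \<in> borel_measurable M" for i and g :: "'a \<Rightarrow> real"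
    using integral_distr[of "\<lambda>w. w i" ?P M g] that by (simp add: comp)
  have "P.prob {w \<in> space ?P. e * real (card {..<n}) \<le> \<bar>\<Sum>i<n. f i (w i) - P.expectation (\<lambda>w. f i (w i))\<bar>}
      \<le> 48 * C / (e ^ 4 * (real (card {..<n}))\<^sup>2)"
  proof (rule P.fourth_moment_tail[OF _ ind])
    fix i assume i: "i \<in> {..<n}"
    then have "integrable (distr ?P M (\<lambda>w. w i)) (\<lambda>w. f i w ^ 4)" using int by (simp add: comp)
    then show "integrable ?P (\<lambda>w. f i (w i) ^ 4)" using i f by (subst (asm) integrable_distr_eq) auto
  next
    have "(\<Sum>i<n. P.expectation (\<lambda>w. f i (w i) ^ 4)) = (\<Sum>i<n. expectation (\<lambda>w. f i w ^ 4))"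
    proof (rule sum.cong[OF refl])
      fix i assume "i \<in> {..<n}"
      then show "P.expectation (\<lambda>w. f i (w i) ^ 4) = expectation (\<lambda>w. f i w ^ 4)"
        using f E[of i "\<lambda>x. f i x ^ 4"] by simp
    qed
    then show "(\<Sum>i<n. P.expectation (\<lambda>w. f i (w i) ^ 4)) \<le> real (card {..<n}) * C" using C by simp
  qed (use e n in \<open>auto simp: lessThan_empty_iff\<close>)
  moreover have "(\<Sum>i<n. f i (w i) - P.expectation (\<lambda>w. f i (w i))) = (\<Sum>i<n. f i (w i) - expectation (f i))" for w
    using f by (intro sum.cong refl) (simp add: E)
  ultimately show ?thesis by simp
qed

end

section \<open>Perturbation of one-dimensional Gaussians\<close>

lemma distr_std_gauss_affine:
  assumes b: "b > 0"
  shows "distr std_gauss borel (\<lambda>t. a + b * t) = density lborel (normal_density a b)"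
proof -
  have "distributed std_gauss lborel (\<lambda>x. x) std_normal_density"
    unfolding distributed_def by (auto simp: distr_id2)
  from std_gauss.normal_density_affine[OF this, of b a] b
  have "distributed std_gauss lborel (\<lambda>t. a + b * t) (normal_density a b)" by simp
  then have "distr std_gauss lborel (\<lambda>t. a + b * t) = density lborel (normal_density a b)"
    by (rule distributed_distr_eq_density)
  moreover have "distr std_gauss lborel (\<lambda>t. a + b * t) = distr std_gauss borel (\<lambda>t. a + b * t)"
    by (rule distr_cong) auto
  ultimately show ?thesis by simp
qed

lemma integral_std_gauss_affine:
  fixes f :: "real \<Rightarrow> real"
  assumes b: "b > 0" and [measurable]: "f \<in> borel_measurable borel"
  shows "integrable std_gauss (\<lambda>t. f (a + b * t)) \<longleftrightarrow> integrable lborel (\<lambda>u. normal_density a b u * f u)"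
    and "(\<integral>t. f (a + b * t) \<partial>std_gauss) = (\<integral>u. normal_density a b u * f u \<partial>lborel)"
proof -
  have "integrable std_gauss (\<lambda>t. f (a + b * t)) \<longleftrightarrow> integrable (distr std_gauss borel (\<lambda>t. a + b * t)) f"
    by (rule integrable_distr_eq[symmetric]) auto
  then show "integrable std_gauss (\<lambda>t. f (a + b * t)) \<longleftrightarrow> integrable lborel (\<lambda>u. normal_density a b u * f u)"
    unfolding distr_std_gauss_affine[OF b] by (subst (asm) integrable_density) auto
  have "(\<integral>t. f (a + b * t) \<partial>std_gauss) = (\<integral>u. f u \<partial>distr std_gauss borel (\<lambda>t. a + b * t))"
    by (rule integral_distr[symmetric]) auto
  then show "(\<integral>t. f (a + b * t) \<partial>std_gauss) = (\<integral>u. normal_density a b u * f u \<partial>lborel)"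
    unfolding distr_std_gauss_affine[OF b] by (subst (asm) integral_density) auto
qed

text \<open>Completing the square: the geometric mean of two normal densities is a normal density
  times a constant. The constant is the Hellinger affinity of the two laws, which
  \<open>gaussian_perturbation\<close> obtains from it by integration.\<close>

lemma sqrt_normal_density_mult:
  fixes a b u :: real
  assumes b: "b > 0"
  shows "sqrt (std_normal_density u) * sqrt (normal_density a b u) =
    sqrt (2 * b / (1 + b\<^sup>2)) * exp (- a\<^sup>2 / (4 * (1 + b\<^sup>2))) *
    normal_density (a / (1 + b\<^sup>2)) (sqrt (2 * b\<^sup>2 / (1 + b\<^sup>2))) u"
proof -
  let ?d = "1 + b\<^sup>2"
  have d: "?d > 0" by (simp add: add_pos_nonneg)
  have sq: "(sqrt (2 * b\<^sup>2 / ?d))\<^sup>2 = 2 * b\<^sup>2 / ?d"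
    using b d by simp
  have ex: "- u\<^sup>2 / 2 + - (u - a)\<^sup>2 / (2 * b\<^sup>2) =
    2 * (- a\<^sup>2 / (4 * ?d) + - (u - a / ?d)\<^sup>2 / (2 * (2 * b\<^sup>2 / ?d)))"
  proof -
    \<comment> \<open>With \<open>w\<close> the centre of the product and \<open>a = ?d * w\<close>,
      the identity of the exponents becomes polynomial.\<close>
    define w where "w = a / ?d"
    have a: "a = ?d * w" using d by (simp add: w_def)
    have "b\<^sup>2 * u\<^sup>2 + (u - a)\<^sup>2 = b\<^sup>2 * (?d * w\<^sup>2) + ?d * (u - w)\<^sup>2"
      unfolding a by (simp add: power2_eq_square algebra_simps)
    moreover have "- u\<^sup>2 / 2 + - (u - a)\<^sup>2 / (2 * b\<^sup>2) = - (b\<^sup>2 * u\<^sup>2 + (u - a)\<^sup>2) / (2 * b\<^sup>2)"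
      using b by (simp add: add_divide_distrib diff_divide_distrib)
    moreover have "a\<^sup>2 / (4 * ?d) = ?d * w\<^sup>2 / 4"
    proof -
      have "(e * w)\<^sup>2 / (4 * e) = e * w\<^sup>2 / 4" if "e > 0" for e
        using that by (simp add: power2_eq_square field_simps)
      from this[OF d] show ?thesis unfolding a .
    qed
    moreover have "2 * (- (?d * w\<^sup>2 / 4) + - (u - w)\<^sup>2 / (2 * (2 * b\<^sup>2 / ?d))) =
        - (b\<^sup>2 * (?d * w\<^sup>2) + ?d * (u - w)\<^sup>2) / (2 * b\<^sup>2)"
      using b d by (simp add: add_divide_distrib diff_divide_distrib)
    ultimately show ?thesis unfolding w_def[symmetric] by (metis minus_divide_left)
  qed
  have co: "1 / sqrt (2 * pi) * (1 / sqrt (2 * pi * b\<^sup>2)) =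
     (sqrt (2 * b / ?d) * (1 / sqrt (2 * pi * (2 * b\<^sup>2 / ?d))))\<^sup>2"
  proof -
    have "sqrt (2 * pi) * sqrt (2 * pi * b\<^sup>2) = sqrt ((2 * pi * b)\<^sup>2)"
      unfolding real_sqrt_mult[symmetric] by (simp add: power2_eq_square algebra_simps)
    then have l: "sqrt (2 * pi) * sqrt (2 * pi * b\<^sup>2) = 2 * pi * b" using b by simp
    have "(sqrt A * (1 / sqrt B))\<^sup>2 = A / B" if "A \<ge> 0" "B \<ge> 0" for A B
      using that by (simp add: power_mult_distrib power_divide)
    moreover have "2 * b\<^sup>2 / ?d \<ge> 0" "2 * b / ?d \<ge> 0" using b d by auto
    ultimately have "(sqrt (2 * b / ?d) * (1 / sqrt (2 * pi * (2 * b\<^sup>2 / ?d))))\<^sup>2 =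
        2 * b / ?d / (2 * pi * (2 * b\<^sup>2 / ?d))"
      by simp
    also have "\<dots> = 1 / (2 * pi * b)"
    proof -
      have "2 * b / e / (2 * pi * (2 * b\<^sup>2 / e)) = 1 / (2 * pi * b)" if "e > 0" for e
        using b that by (simp add: power2_eq_square)
      from this[OF d] show ?thesis .
    qed
    finally show ?thesis using l by (simp only: times_divide_times_eq mult_1)
  qed
  have "std_normal_density u * normal_density a b u =
    (1 / sqrt (2 * pi) * (1 / sqrt (2 * pi * b\<^sup>2))) * exp (- u\<^sup>2 / 2 + - (u - a)\<^sup>2 / (2 * b\<^sup>2))"
    by (simp add: normal_density_def mult_exp_exp)
  also have "\<dots> = (sqrt (2 * b / ?d) * (1 / sqrt (2 * pi * (2 * b\<^sup>2 / ?d))) *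
      exp (- a\<^sup>2 / (4 * ?d) + - (u - a / ?d)\<^sup>2 / (2 * (2 * b\<^sup>2 / ?d))))\<^sup>2"
    unfolding co ex by (subst exp_double) (rule power_mult_distrib[symmetric])
  finally have "sqrt (std_normal_density u * normal_density a b u) = sqrt (2 * b / ?d) * (1 / sqrt (2 * pi * (2 * b\<^sup>2 / ?d))) *
      exp (- a\<^sup>2 / (4 * ?d) + - (u - a / ?d)\<^sup>2 / (2 * (2 * b\<^sup>2 / ?d)))"
  proof (rule real_sqrt_unique[OF sym], intro mult_nonneg_nonneg)
    show "0 \<le> sqrt (2 * b / ?d)" using b d by simp
    show "0 \<le> 1 / sqrt (2 * pi * (2 * b\<^sup>2 / ?d))" using d by simp
  qed simp
  then have "sqrt (std_normal_density u) * sqrt (normal_density a b u) = sqrt (2 * b / ?d) * (1 / sqrt (2 * pi * (2 * b\<^sup>2 / ?d))) *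
      exp (- a\<^sup>2 / (4 * ?d) + - (u - a / ?d)\<^sup>2 / (2 * (2 * b\<^sup>2 / ?d)))"
    by (simp only: real_sqrt_mult[of "std_normal_density u" "normal_density a b u"])
  then show ?thesis
    unfolding normal_density_def[of "a / ?d"] sq exp_add by (simp only: mult_ac)
qed

text \<open>Hellinger distance: \<open>f (N - N') = (f (\<surd>N + \<surd>N')) (\<surd>N - \<surd>N')\<close> with AM-GM at scale \<open>\<kappa>\<close>.
  Unlike a bound through the likelihood ratio it stays polynomial in \<open>a\<close>.\<close>
lemma gaussian_perturbation:
  fixes f :: "real \<Rightarrow> real"
  assumes b: "b > 0" and k: "\<kappa> > 0" and [measurable]: "f \<in> borel_measurable borel"
    and i1: "integrable std_gauss f" "integrable std_gauss (\<lambda>t. (f t)\<^sup>2)"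
    and i2: "integrable std_gauss (\<lambda>t. f (a + b * t))" "integrable std_gauss (\<lambda>t. (f (a + b * t))\<^sup>2)"
  shows "\<bar>(\<integral>t. f (a + b * t) \<partial>std_gauss) - (\<integral>t. f t \<partial>std_gauss)\<bar> \<le>
    (2 * (1 - sqrt (2 * b / (1 + b\<^sup>2))) + a\<^sup>2) / (2 * \<kappa>) +
    \<kappa> * ((\<integral>t. (f t)\<^sup>2 \<partial>std_gauss) + (\<integral>t. (f (a + b * t))\<^sup>2 \<partial>std_gauss))"
proof -
  let ?N = "std_normal_density" and ?N' = "normal_density a b"
  let ?q = "sqrt (2 * b / (1 + b\<^sup>2))" and ?E = "exp (- a\<^sup>2 / (4 * (1 + b\<^sup>2)))"
  have d: "1 + b\<^sup>2 \<ge> 1" by simp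
  have std: "(\<integral>t. g t \<partial>std_gauss) = (\<integral>u. ?N u * g u \<partial>lborel)"
    "integrable std_gauss g \<longleftrightarrow> integrable lborel (\<lambda>u. ?N u * g u)" if "g \<in> borel_measurable borel" for g :: "real \<Rightarrow> real"
    using integral_std_gauss_affine[of 1 g 0] that by auto
  note aff = integral_std_gauss_affine[OF b, of _ a]
  have iN: "integrable lborel (\<lambda>u. ?N u * f u)" "integrable lborel (\<lambda>u. ?N u * (f u)\<^sup>2)"
    "integrable lborel (\<lambda>u. ?N' u * f u)" "integrable lborel (\<lambda>u. ?N' u * (f u)\<^sup>2)"
    using i1 i2 std(2)[of f] std(2)[of "\<lambda>u. (f u)\<^sup>2"] aff(1)[of f] aff(1)[of "\<lambda>u. (f u)\<^sup>2"] by auto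
  define h where "h = (\<lambda>u. sqrt (?N u) * sqrt (?N' u))"
  have s0: "sqrt (2 * b\<^sup>2 / (1 + b\<^sup>2)) > 0"
    using b d unfolding real_sqrt_gt_0_iff by (intro divide_pos_pos) (auto intro: add_pos_nonneg)
  have hi: "integrable lborel h" and hE: "(\<integral>u. h u \<partial>lborel) = ?q * ?E"
    unfolding h_def sqrt_normal_density_mult[OF b] using s0 by auto
  \<comment> \<open>\<open>D\<close> is the square of the difference of the root densities; its
    integral is the squared Hellinger distance, two minus twice the affinity.\<close>
  define D where "D = (\<lambda>u. ?N u + ?N' u - 2 * h u)"
  define V where "V = (\<lambda>u. ?N u * (f u)\<^sup>2 + ?N' u * (f u)\<^sup>2)"
  have Di: "integrable lborel D" unfolding D_def using b hi by auto
  have DE: "(\<integral>u. D u \<partial>lborel) = 2 - 2 * (?q * ?E)" unfolding D_def using b hi hE by simp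
  have Vi: "integrable lborel V" unfolding V_def using iN by auto
  have VE: "(\<integral>u. V u \<partial>lborel) = (\<integral>t. (f t)\<^sup>2 \<partial>std_gauss) + (\<integral>t. (f (a + b * t))\<^sup>2 \<partial>std_gauss)"
    unfolding V_def using iN std(1)[of "\<lambda>u. (f u)\<^sup>2"] aff(2)[of "\<lambda>u. (f u)\<^sup>2"] by simp
  have pw: "\<bar>?N' u * f u - ?N u * f u\<bar> \<le> D u / (2 * \<kappa>) + \<kappa> * V u" for u
  proof -
    define x where "x = sqrt (?N u)"
    define y where "y = sqrt (?N' u)"
    have xy: "x \<ge> 0" "y \<ge> 0" by (simp_all add: x_def y_def)
    have N: "?N u = x\<^sup>2" "?N' u = y\<^sup>2" by (simp_all add: x_def y_def)
    have Dxy: "D u = (y - x)\<^sup>2" unfolding D_def h_def x_def[symmetric] y_def[symmetric] N using xy by (simp add: power2_diff)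
    have am: "\<bar>A * B\<bar> \<le> A\<^sup>2 / (2 * \<kappa>) + \<kappa> / 2 * B\<^sup>2" for A B :: real
    proof -
      have "0 \<le> (\<bar>A\<bar> - \<kappa> * \<bar>B\<bar>)\<^sup>2 / (2 * \<kappa>)" using k by simp
      also have "\<dots> = A\<^sup>2 / (2 * \<kappa>) + \<kappa> / 2 * B\<^sup>2 - \<bar>A * B\<bar>"
        using k by (simp add: power2_diff field_simps power2_eq_square abs_mult)
      finally show ?thesis by simp
    qed
    have "\<bar>?N' u * f u - ?N u * f u\<bar> = \<bar>(y - x) * ((y + x) * f u)\<bar>"
      unfolding N by (simp add: power2_eq_square algebra_simps)
    also have "\<dots> \<le> (y - x)\<^sup>2 / (2 * \<kappa>) + \<kappa> / 2 * ((y + x) * f u)\<^sup>2" by (rule am)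
    also have "\<dots> \<le> D u / (2 * \<kappa>) + \<kappa> * V u"
    proof -
      have "(y + x)\<^sup>2 \<le> 2 * (x\<^sup>2 + y\<^sup>2)"
        using sum_squares_bound[of y x] by (simp add: power2_sum)
      then have "((y + x) * f u)\<^sup>2 \<le> (2 * (x\<^sup>2 + y\<^sup>2)) * (f u)\<^sup>2"
        unfolding power_mult_distrib by (rule mult_right_mono) simp
      then have "\<kappa> / 2 * ((y + x) * f u)\<^sup>2 \<le> \<kappa> / 2 * ((2 * (x\<^sup>2 + y\<^sup>2)) * (f u)\<^sup>2)"
        using k by (intro mult_left_mono) auto
      also have "\<dots> = \<kappa> * V u" unfolding V_def N by (simp add: algebra_simps)
      finally show ?thesis unfolding Dxy by simp
    qed
    finally show ?thesis .
  qed
  have "\<bar>(\<integral>t. f (a + b * t) \<partial>std_gauss) - (\<integral>t. f t \<partial>std_gauss)\<bar> = \<bar>\<integral>u. ?N' u * f u - ?N u * f u \<partial>lborel\<bar>"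
    using iN std(1)[of f] aff(2)[of f] by simp
  also have "\<dots> \<le> (\<integral>u. \<bar>?N' u * f u - ?N u * f u\<bar> \<partial>lborel)" by (rule integral_abs_bound)
  also have "\<dots> \<le> (\<integral>u. D u / (2 * \<kappa>) + \<kappa> * V u \<partial>lborel)"
    using iN Di Vi pw by (intro integral_mono) auto
  also have "\<dots> = (2 - 2 * (?q * ?E)) / (2 * \<kappa>) + \<kappa> * ((\<integral>t. (f t)\<^sup>2 \<partial>std_gauss) + (\<integral>t. (f (a + b * t))\<^sup>2 \<partial>std_gauss))"
    using Di Vi by (simp add: DE VE)
  \<comment> \<open>Separates the two defects: \<open>?q\<close> measures the change of variance,
    and the inequality \<open>1 - x \<le> exp (- x)\<close> together with \<open>?q \<le> 1\<close>
    bounds the effect of the mean by the square of \<open>a\<close>.\<close>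
  also have "(2 - 2 * (?q * ?E)) / (2 * \<kappa>) \<le> (2 * (1 - ?q) + a\<^sup>2) / (2 * \<kappa>)"
  proof (rule divide_right_mono)
    have "2 * b \<le> 1 + b\<^sup>2" using sum_squares_bound[of 1 b] by simp
    then have q: "0 \<le> ?q" "?q \<le> 1" using b d by (auto simp: divide_simps)
    have "1 - a\<^sup>2 / (4 * (1 + b\<^sup>2)) \<le> ?E" using exp_ge_add_one_self[of "- a\<^sup>2 / (4 * (1 + b\<^sup>2))"] by simp
    moreover have "a\<^sup>2 / (4 * (1 + b\<^sup>2)) \<le> a\<^sup>2 / 2"
      using d by (intro frac_le) auto
    ultimately have "1 - a\<^sup>2 / 2 \<le> ?E" by linarith
    then have "?q * (1 - a\<^sup>2 / 2) \<le> ?q * ?E" using q by (intro mult_left_mono)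
    moreover have "?q * (a\<^sup>2 / 2) \<le> 1 * (a\<^sup>2 / 2)" using q by (intro mult_right_mono) auto
    ultimately show "2 - 2 * (?q * ?E) \<le> 2 * (1 - ?q) + a\<^sup>2" by (simp add: algebra_simps)
  qed (use k in simp)
  finally show ?thesis by simp
qed

text \<open>Every nondegenerate normal law on the line has the null sets of Lebesgue measure,
  whatever its mean and variance. Rank stability rests on this.\<close>

lemma std_gauss_null_affine:
  assumes s: "s > 0" "s' > 0" and [measurable]: "A \<in> sets borel"
    and null: "emeasure std_gauss {t. m + s * t \<in> A} = 0"
  shows "emeasure std_gauss {t. m' + s' * t \<in> A} = 0"
proof -
  have e: "emeasure std_gauss {t. m + s * t \<in> A} = 0 \<longleftrightarrow> emeasure lborel A = 0" if "s > 0" for m s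
  proof -
    have "emeasure std_gauss {t. m + s * t \<in> A} = emeasure (distr std_gauss borel (\<lambda>t. m + s * t)) A"
      by (subst emeasure_distr) (auto simp: vimage_def)
    also have "\<dots> = (\<integral>\<^sup>+u. ennreal (normal_density m s u) * indicator A u \<partial>lborel)"
      unfolding distr_std_gauss_affine[OF that] by (rule emeasure_density) auto
    also have "\<dots> = 0 \<longleftrightarrow> (AE u in lborel. ennreal (normal_density m s u) * indicator A u = 0)"
      by (rule nn_integral_0_iff_AE) auto
    also have "\<dots> \<longleftrightarrow> (AE u in lborel. u \<notin> A)"
    proof (rule AE_cong)
      fix u
      have "ennreal (normal_density m s u) \<noteq> 0"
        using normal_density_pos[OF that, of m u] by (simp add: ennreal_eq_0_iff not_le)
      then show "ennreal (normal_density m s u) * indicator A u = 0 \<longleftrightarrow> u \<notin> A"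
        by (simp add: indicator_def)
    qed
    also have "\<dots> \<longleftrightarrow> emeasure lborel A = 0"
      using AE_iff_measurable[of A lborel "\<lambda>u. u \<notin> A"] by auto
    finally show ?thesis .
  qed
  show ?thesis using null e[OF s(1)] e[OF s(2)] by simp
qed

section \<open>Programs and their random inputs\<close>

lemma (in prob_space) indep_vars_reindex:
  assumes g: "inj_on g T" "g ` T \<subseteq> I" and ind: "indep_vars M' X I"
  shows "indep_vars (\<lambda>t. M' (g t)) (\<lambda>t. X (g t)) T"
proof -
  let ?F = "\<lambda>i. {X i -` A \<inter> space M |A. A \<in> sets (M' i)}"
  have rv: "random_variable (M' i) (X i)" if "i \<in> I" for i
    using ind that by (simp add: indep_vars_def2)
  have sets: "indep_sets ?F I" using ind by (simp add: indep_vars_def2)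
  have "indep_sets (\<lambda>t. ?F (g t)) T"
  proof (rule indep_setsI)
    fix t assume "t \<in> T"
    then show "?F (g t) \<subseteq> events" using sets g by (auto simp: indep_sets_def)
  next
    fix A J assume J: "J \<noteq> {}" "J \<subseteq> T" "finite J" "\<forall>j\<in>J. A j \<in> ?F (g j)"
    have inj: "inj_on g J" using g(1) J(2) inj_on_subset by blast
    let ?A = "\<lambda>i. A (inv_into J g i)"
    have inv: "?A (g j) = A j" if "j \<in> J" for j using inj that by simp
    have "prob (\<Inter>i\<in>g ` J. ?A i) = (\<Prod>i\<in>g ` J. prob (?A i))"
    proof (rule indep_setsD[OF sets])
      show "g ` J \<subseteq> I" using J g by blast
      show "\<forall>i\<in>g ` J. ?A i \<in> ?F i"
      proof
        fix i assume "i \<in> g ` J"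
        then obtain j where "j \<in> J" "i = g j" by blast
        then show "?A i \<in> ?F i" using J(4) inv[of j] by simp
      qed
    qed (use J in auto)
    then show "prob (\<Inter> (A ` J)) = (\<Prod>j\<in>J. prob (A j))"
      using inj inv by (simp add: prod.reindex cong: INF_cong_simp prod.cong)
  qed
  then show ?thesis using rv g by (auto simp: indep_vars_def2)
qed

section \<open>Evaluation of straight-line programs\<close>

definition refs :: "instr \<Rightarrow> nat set" where
  "refs p = (case p of MatMul a x \<Rightarrow> {x} | Nonlin f args \<Rightarrow> set args)"

lemma length_run [simp]: "length (run ps n Wo vs) = length vs + length ps"
  by (induction ps arbitrary: vs) auto

lemma run_nth_prefix: "u < length vs \<Longrightarrow> run ps n Wo vs ! u = vs ! u"
  by (induction ps arbitrary: vs) (auto simp: nth_append)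

lemma step_cong: "(\<And>u. u \<in> refs p \<Longrightarrow> vs ! u = vs' ! u) \<Longrightarrow> step n Wo vs p = step n Wo vs' p"
  by (cases p) (auto simp: refs_def fun_eq_iff intro!: arg_cong[where f="\<lambda>x. _ x"] cong: map_cong)

text \<open>Evaluation only appends values and instructions refer only backwards, so an instruction
  may be evaluated on the final list. The order of evaluation disappears from the later
  arguments.\<close>

lemma run_nth:
  assumes "i < length ps" "\<And>i u. i < length ps \<Longrightarrow> u \<in> refs (ps ! i) \<Longrightarrow> u < length vs + i"
  shows "run ps n Wo vs ! (length vs + i) = step n Wo (run ps n Wo vs) (ps ! i)"
  using assms
proof (induction ps arbitrary: vs i)
  case (Cons p ps)
  let ?vs = "vs @ [step n Wo vs p]"
  show ?case
  proof (cases i)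
    case 0
    have "run ps n Wo ?vs ! length vs = step n Wo vs p"
      by (subst run_nth_prefix) (auto simp: nth_append)
    also have "\<dots> = step n Wo (run ps n Wo ?vs) p"
    proof (rule step_cong)
      fix u assume "u \<in> refs p"
      then have "u < length vs" using Cons.prems(2)[of 0 u] by simp
      then show "vs ! u = run ps n Wo ?vs ! u" by (subst run_nth_prefix) (auto simp: nth_append)
    qed
    finally show ?thesis using 0 by simp
  next
    case (Suc j)
    have "run ps n Wo ?vs ! (length ?vs + j) = step n Wo (run ps n Wo ?vs) (ps ! j)"
    proof (rule Cons.IH)
      show "j < length ps" using Suc Cons.prems by simp
      fix i u assume "i < length ps" "u \<in> refs (ps ! i)"
      then show "u < length ?vs + i" using Cons.prems(2)[of "Suc i" u] by simp
    qed
    then show ?thesis using Suc by simp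
  qed
qed simp

lemma borel_fun_map_measurable:
  fixes I :: "'i set"
  assumes f: "borel_fun (length args) f" and args: "set args \<subseteq> I"
  shows "(\<lambda>z. f (map z args)) \<in> borel_measurable (PiM I (\<lambda>_. borel))"
proof -
  let ?k = "length args"
  have "(\<lambda>z. f (map (\<lambda>j\<in>{..<?k}. z (args ! j)) [0..<?k])) \<in> borel_measurable (PiM I (\<lambda>_. borel))"
  proof (rule measurable_compose[OF _ f[unfolded borel_fun_def]])
    show "(\<lambda>z. \<lambda>j\<in>{..<?k}. z (args ! j)) \<in> measurable (PiM I (\<lambda>_. borel)) (PiM {..<?k} (\<lambda>_. borel))"
      using args by (intro measurable_restrict measurable_component_singleton) (auto simp: subset_iff)
  qed
  moreover have "map (\<lambda>j\<in>{..<?k}. z (args ! j)) [0..<?k] = map z args" for z :: "'i \<Rightarrow> real"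
    by (rule nth_equalityI) auto
  ultimately show ?thesis by simp
qed

locale netsor = prob_space M for M :: "'w measure" +
  fixes m nA :: nat and ps :: "instr list" and mu_in :: "nat \<Rightarrow> real" and S_in :: "nat \<Rightarrow> nat \<Rightarrow> real"
    and sW2 :: "nat \<Rightarrow> real" and W :: "nat \<Rightarrow> nat \<Rightarrow> 'w \<Rightarrow> nat \<Rightarrow> nat \<Rightarrow> real" and X :: "nat \<Rightarrow> 'w \<Rightarrow> nat \<Rightarrow> nat \<Rightarrow> real"
  assumes wf: "wf_prog m nA ps" and sW2_pos: "\<And>a. a < nA \<Longrightarrow> sW2 a > 0"
    and cov: "cov_matrix {..<m} S_in"
    and smp: "\<And>n. n \<ge> 1 \<Longrightarrow> sampled M n m nA mu_in S_in sW2 (W n) (X n)"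
begin

definition "nv = m + length ps"
definition "Gb v = Gbelow ps m v"
definition "ismm v \<longleftrightarrow> m \<le> v \<and> v < nv \<and> is_matmul (ps ! (v - m))"
definition "avar v = (case ps ! (v - m) of MatMul a x \<Rightarrow> a | _ \<Rightarrow> 0)"
definition "arg v = (case ps ! (v - m) of MatMul a x \<Rightarrow> x | _ \<Rightarrow> 0)"
text \<open>The vector multiplied at \<open>v\<close>, as a function of the G-variables at one
  coordinate.\<close>

definition "\<phi> v = hexpr ps m (arg v)"
definition "val n \<omega> v \<alpha> = (prog_vals ps m n (\<lambda>a. W n a \<omega>) (X n \<omega>) ! v) \<alpha>"
text \<open>The profile of coordinate \<open>\<alpha>\<close> across the G-variables before
  \<open>v\<close>. All other variables are coordinatewise functions of it and are not
  recorded.\<close>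

definition "st n \<omega> v \<alpha> = (\<lambda>g\<in>Gb v. val n \<omega> g \<alpha>)"
definition "sd n a = sqrt (sW2 a / real n)"
definition "T n = {..<nA} \<times> ({..<n} \<times> {..<n::nat})"
text \<open>Entries rescaled to variance 1, so that their joint law is the standard Gaussian product
  measure on \<open>T n\<close>.\<close>

definition "xi n \<omega> = (\<lambda>t\<in>T n. W n (fst t) \<omega> (fst (snd t)) (snd (snd t)) / sd n (fst t))"
definition "past n \<omega> v = (\<lambda>\<alpha>\<in>{..<n}. st n \<omega> v \<alpha>)"
definition "PS n v = PiM {..<n::nat} (\<lambda>_. PiM (Gb v) (\<lambda>_. borel :: real measure))"

lemma finite_Gb [simp]: "finite (Gb v)"
  by (rule finite_subset[of _ "{..<v}"]) (auto simp: Gb_def Gbelow_def)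

lemma finite_T [simp]: "finite (T n)" by (simp add: T_def)

lemma Gb_less: "g \<in> Gb v \<Longrightarrow> g < v" by (auto simp: Gb_def Gbelow_def)

lemma Gb_mono: "u \<le> v \<Longrightarrow> Gb u \<subseteq> Gb v" by (auto simp: Gb_def Gbelow_def)

lemma Gb_m: "v \<le> m \<Longrightarrow> Gb v = {..<v}" by (auto simp: Gb_def Gbelow_def isG_def)

lemma Gb_iff: "g \<in> Gb v \<longleftrightarrow> g < v \<and> (g < m \<or> ismm g)"
  by (auto simp: Gb_def Gbelow_def isG_def ismm_def nv_def)

lemma Gb_Suc: "Gb (Suc v) = (if v < m \<or> ismm v then insert v (Gb v) else Gb v)"
  by (auto simp: Gb_iff less_Suc_eq)

lemma ismmD:
  assumes "ismm v"
  shows "m \<le> v" "v < nv" "ps ! (v - m) = MatMul (avar v) (arg v)" "avar v < nA" "arg v < v"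
proof -
  show v: "m \<le> v" "v < nv" using assms by (auto simp: ismm_def)
  obtain a x where ax: "ps ! (v - m) = MatMul a x"
    using assms by (auto simp: ismm_def is_matmul_def split: instr.splits)
  then show "ps ! (v - m) = MatMul (avar v) (arg v)" by (simp add: avar_def arg_def)
  have "v - m < length ps" using v by (auto simp: nv_def)
  then show "avar v < nA" "arg v < v"
    using wf ax v by (auto simp: wf_prog_def avar_def arg_def split: instr.splits)
qed

lemma wf_nonlin:
  assumes "m \<le> u" "u < nv" "ps ! (u - m) = Nonlin f args"
  shows "set args \<subseteq> Gb u" "controlled (length args) f" "borel_fun (length args) f"
proof -
  have "u - m < length ps" using assms by (auto simp: nv_def)
  then have "case ps ! (u - m) of MatMul a x \<Rightarrow> a < nA \<and> x < m + (u - m)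
    | Nonlin f args \<Rightarrow> (\<forall>w\<in>set args. w < m + (u - m) \<and> isG ps m w) \<and> controlled (length args) f \<and> borel_fun (length args) f"
    using wf unfolding wf_prog_def by blast
  then show "set args \<subseteq> Gb u" "controlled (length args) f" "borel_fun (length args) f"
    using assms by (auto simp: Gb_def Gbelow_def)
qed

lemma instr_cases:
  assumes "u < nv"
  obtains "u < m" | "ismm u" | f args where "m \<le> u" "ps ! (u - m) = Nonlin f args" "\<not> ismm u"
proof (cases "u < m")
  case False
  then show ?thesis using assms that
    by (cases "ps ! (u - m)") (auto simp: ismm_def is_matmul_def)
qed (use that in auto)

lemma refs_less: "i < length ps \<Longrightarrow> u \<in> refs (ps ! i) \<Longrightarrow> u < m + i"
  using wf by (auto simp: wf_prog_def refs_def split: instr.splits)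

lemma val_input: "v < m \<Longrightarrow> val n \<omega> v \<alpha> = X n \<omega> v \<alpha>"
  unfolding val_def prog_vals_def by (subst run_nth_prefix) auto

lemma val_step:
  assumes "m \<le> v" "v < nv"
  shows "val n \<omega> v \<alpha> = step n (\<lambda>a. W n a \<omega>) (prog_vals ps m n (\<lambda>a. W n a \<omega>) (X n \<omega>)) (ps ! (v - m)) \<alpha>"
proof -
  have "v - m < length ps" using assms by (auto simp: nv_def)
  from run_nth[OF this, of "map (X n \<omega>) [0..<m]"] refs_less assms show ?thesis
    unfolding val_def prog_vals_def by simp
qed

lemma val_mm: "ismm v \<Longrightarrow> val n \<omega> v \<alpha> = (\<Sum>\<beta><n. W n (avar v) \<omega> \<alpha> \<beta> * val n \<omega> (arg v) \<beta>)"
  by (subst val_step) (auto simp: ismmD val_def)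

lemma val_nonlin:
  "m \<le> v \<Longrightarrow> v < nv \<Longrightarrow> ps ! (v - m) = Nonlin f args \<Longrightarrow> val n \<omega> v \<alpha> = f (map (\<lambda>u. val n \<omega> u \<alpha>) args)"
  by (subst val_step) (auto simp: val_def)

lemma hexpr_val:
  assumes "u < nv"
  shows "val n \<omega> u \<alpha> = hexpr ps m u (\<lambda>g. val n \<omega> g \<alpha>)"
  using assms
proof (rule instr_cases)
  fix f args assume "m \<le> u" "ps ! (u - m) = Nonlin f args"
  then show ?thesis using assms by (simp add: hexpr_def val_nonlin)
qed (auto simp: hexpr_def ismmD)

lemma hexpr_G: "u < m \<or> ismm u \<Longrightarrow> hexpr ps m u z = z u"
  by (auto simp: hexpr_def ismmD)

lemma hexpr_nonlin: "m \<le> u \<Longrightarrow> ps ! (u - m) = Nonlin f args \<Longrightarrow> hexpr ps m u z = f (map z args)"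
  by (simp add: hexpr_def)

text \<open>\<open>Suc u\<close> and not \<open>u\<close>, because a G-variable is its own defining
  expression.\<close>

lemma hexpr_cong:
  assumes "u < nv" "\<And>g. g \<in> Gb (Suc u) \<Longrightarrow> z g = z' g"
  shows "hexpr ps m u z = hexpr ps m u z'"
  using assms(1)
proof (cases rule: instr_cases)
  case (3 f args)
  then have "map z args = map z' args"
    using wf_nonlin(1)[of u f args] assms Gb_mono[of u "Suc u"] by (intro map_cong) auto
  then show ?thesis unfolding hexpr_nonlin[OF 3(1,2)] by (rule arg_cong)
qed (use assms(2)[of u] in \<open>auto simp: hexpr_G Gb_Suc\<close>)

lemma \<phi>_cong: "ismm v \<Longrightarrow> (\<And>g. g \<in> Gb v \<Longrightarrow> z g = z' g) \<Longrightarrow> \<phi> v z = \<phi> v z'"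
  unfolding \<phi>_def using Gb_mono[of "Suc (arg v)" v] ismmD(2,5)[of v] by (intro hexpr_cong) auto

lemma val_arg: "ismm v \<Longrightarrow> v \<le> w \<Longrightarrow> val n \<omega> (arg v) \<alpha> = \<phi> v (st n \<omega> w \<alpha>)"
  using hexpr_val[of "arg v" n \<omega> \<alpha>] ismmD(2,5)[of v] Gb_mono[of v w]
  by (auto simp: \<phi>_def[symmetric] st_def intro!: \<phi>_cong)

lemma hexpr_measurable:
  assumes "u < nv" "Gb (Suc u) \<subseteq> I"
  shows "hexpr ps m u \<in> borel_measurable (PiM I (\<lambda>_. borel))"
  using assms(1)
proof (cases rule: instr_cases)
  case (3 f args)
  have "set args \<subseteq> I" using wf_nonlin(1)[of u f args] 3 assms Gb_mono[of u "Suc u"] by auto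
  then have "(\<lambda>z. f (map z args)) \<in> borel_measurable (PiM I (\<lambda>_. borel))"
    using 3 assms by (intro borel_fun_map_measurable wf_nonlin(3)[of u]) auto
  moreover have "hexpr ps m u = (\<lambda>z. f (map z args))" using hexpr_nonlin[OF 3(1,2)] by auto
  ultimately show ?thesis by simp
qed (use assms in \<open>auto simp: hexpr_G Gb_Suc intro!: measurable_component_singleton cong: measurable_cong\<close>)

lemma \<phi>_measurable: "ismm v \<Longrightarrow> Gb v \<subseteq> I \<Longrightarrow> \<phi> v \<in> borel_measurable (PiM I (\<lambda>_. borel))"
  unfolding \<phi>_def using Gb_mono[of "Suc (arg v)" v] ismmD(2,5)[of v] by (intro hexpr_measurable) auto

section \<open>Measurability of the computed values\<close>

lemma W_measurable: "n \<ge> 1 \<Longrightarrow> a < nA \<Longrightarrow> i < n \<Longrightarrow> j < n \<Longrightarrow> (\<lambda>\<omega>. W n a \<omega> i j) \<in> borel_measurable M"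
  using smp[of n] by (auto simp: sampled_def)

lemma X_measurable: "n \<ge> 1 \<Longrightarrow> \<alpha> < n \<Longrightarrow> (\<lambda>\<omega>. \<lambda>k\<in>{..<m}. X n \<omega> k \<alpha>) \<in> measurable M (PiM {..<m} (\<lambda>_. borel))"
  using smp[of n] by (auto simp: sampled_def)

lemma val_measurable:
  assumes n: "n \<ge> 1" and "u < nv" "\<alpha> < n"
  shows "(\<lambda>\<omega>. val n \<omega> u \<alpha>) \<in> borel_measurable M"
  using assms(2,3)
proof (induction u arbitrary: \<alpha> rule: less_induct)
  case (less u)
  from less.prems(1) show ?case
  proof (cases rule: instr_cases)
    case 1
    from measurable_compose[OF X_measurable[OF n less.prems(2)] measurable_component_singleton[of u]] 1
    show ?thesis by (simp add: val_input)
  next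
    case 2
    have [measurable]: "(\<lambda>\<omega>. val n \<omega> (arg u) \<beta>) \<in> borel_measurable M" if "\<beta> < n" for \<beta>
      using ismmD[OF 2] that less.IH[of "arg u"] by auto
    have [measurable]: "(\<lambda>\<omega>. W n (avar u) \<omega> \<alpha> \<beta>) \<in> borel_measurable M" if "\<beta> < n" for \<beta>
      using ismmD[OF 2] that n less.prems by (intro W_measurable) auto
    show ?thesis unfolding val_mm[OF 2] by measurable
  next
    case (3 f args)
    note wn = wf_nonlin[OF 3(1) less.prems(1) 3(2)]
    have "(\<lambda>\<omega>. \<lambda>g\<in>Gb u. val n \<omega> g \<alpha>) \<in> measurable M (PiM (Gb u) (\<lambda>_. borel))"
      using less.IH less.prems by (intro measurable_restrict) (auto dest!: Gb_less)
    from measurable_compose[OF this borel_fun_map_measurable[OF wn(3,1)]]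
    have "(\<lambda>\<omega>. f (map (\<lambda>g\<in>Gb u. val n \<omega> g \<alpha>) args)) \<in> borel_measurable M" .
    moreover have "map (\<lambda>g\<in>Gb u. val n \<omega> g \<alpha>) args = map (\<lambda>g. val n \<omega> g \<alpha>) args" for \<omega>
      using wn(1) by auto
    ultimately show ?thesis using 3 less.prems by (simp add: val_nonlin)
  qed
qed

lemma st_measurable:
  "n \<ge> 1 \<Longrightarrow> v \<le> nv \<Longrightarrow> \<alpha> < n \<Longrightarrow> (\<lambda>\<omega>. st n \<omega> v \<alpha>) \<in> measurable M (PiM (Gb v) (\<lambda>_. borel))"
  unfolding st_def by (intro measurable_restrict val_measurable) (auto dest: Gb_less)

lemma past_measurable: "n \<ge> 1 \<Longrightarrow> v \<le> nv \<Longrightarrow> (\<lambda>\<omega>. past n \<omega> v) \<in> measurable M (PS n v)"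
  unfolding past_def PS_def by (intro measurable_restrict st_measurable) auto

lemma xi_measurable: "n \<ge> 1 \<Longrightarrow> xi n \<in> measurable M (PiM (T n) (\<lambda>_. borel))"
  unfolding xi_def by (intro measurable_restrict borel_measurable_divide W_measurable) (auto simp: T_def)

lemma sd_pos: "n \<ge> 1 \<Longrightarrow> a < nA \<Longrightarrow> sd n a > 0"
  using sW2_pos by (simp add: sd_def)

section \<open>Joint law of the inputs and of the normalised matrix entries\<close>

definition "Ms t = (PiM {..<(case t of Inl _ \<Rightarrow> 1 | Inr _ \<Rightarrow> m)} (\<lambda>_. borel :: real measure))"
  for t :: "nat \<times> nat \<times> nat + nat"

definition "Xs n t \<omega> = (case t of Inl (a, i, j) \<Rightarrow> (\<lambda>_\<in>{..<1::nat}. W n a \<omega> i j) | Inr \<alpha> \<Rightarrow> (\<lambda>k\<in>{..<m}. X n \<omega> k \<alpha>))"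

definition "Is n = {Inl (a, i, j) | a i j. a < nA \<and> i < n \<and> j < n} \<union> {Inr \<alpha> | \<alpha>. \<alpha> < (n::nat)}"

lemma Is_eq: "Is n = Inl ` T n \<union> Inr ` {..<n}"
  by (auto simp: Is_def T_def)

lemma indep_Xs: "n \<ge> 1 \<Longrightarrow> indep_vars Ms (Xs n) (Is n)"
  using smp[of n] unfolding sampled_def Is_def Ms_def Xs_def by auto

lemma distr_xi_coord:
  assumes n: "n \<ge> 1" and t: "a < nA" "i < n" "j < n"
  shows "distr M borel (\<lambda>\<omega>. W n a \<omega> i j / sd n a) = std_gauss"
proof -
  have "distr M borel (\<lambda>\<omega>. W n a \<omega> i j) = density lborel (normal_density 0 (sd n a))"
    using smp[OF n] t by (auto simp: sampled_def sd_def)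
  moreover have "distr M lborel (\<lambda>\<omega>. W n a \<omega> i j) = distr M borel (\<lambda>\<omega>. W n a \<omega> i j)"
    by (rule distr_cong) auto
  ultimately have "distributed M lborel (\<lambda>\<omega>. W n a \<omega> i j) (normal_density 0 (sd n a))"
    unfolding distributed_def using W_measurable[OF n t] by auto
  from normal_density_affine[OF this sd_pos[OF n t(1)], of "1 / sd n a" 0] sd_pos[OF n t(1)]
  have "distributed M lborel (\<lambda>\<omega>. W n a \<omega> i j / sd n a) std_normal_density" by simp
  then have "distr M lborel (\<lambda>\<omega>. W n a \<omega> i j / sd n a) = std_gauss" by (rule distributed_distr_eq_density)
  moreover have "distr M lborel (\<lambda>\<omega>. W n a \<omega> i j / sd n a) = distr M borel (\<lambda>\<omega>. W n a \<omega> i j / sd n a)"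
    by (rule distr_cong) auto
  ultimately show ?thesis by simp
qed

lemma distr_xi:
  assumes n: "n \<ge> 1"
  shows "distr M (PiM (T n) (\<lambda>_. borel)) (xi n) = PiM (T n) (\<lambda>_. std_gauss)"
\<comment> \<open>This happens when the program has no A-variable; the characterisation of
  independence by product laws asks for a nonempty family.\<close>
proof (cases "T n = {}")
  case True
  have "distr M (PiM (T n) (\<lambda>_. borel)) (xi n) = PiM (T n) (\<lambda>_. std_gauss)"
  proof (rule std_gauss_prod.PiM_eqI)
    fix A :: "nat \<times> nat \<times> nat \<Rightarrow> real set"
    have "xi n -` {\<lambda>_. undefined} \<inter> space M = space M" using True by (auto simp: xi_def)
    then show "emeasure (distr M (PiM (T n) (\<lambda>_. borel)) (xi n)) (Pi\<^sub>E (T n) A) = (\<Prod>i\<in>T n. emeasure std_gauss (A i))"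
      using True xi_measurable[OF n] by (subst emeasure_distr) (auto simp: sets_PiM_empty emeasure_space_1)
  qed auto
  then show ?thesis .
next
  case False
  let ?Y = "\<lambda>t \<omega>. W n (fst t) \<omega> (fst (snd t)) (snd (snd t)) / sd n (fst t)"
  have "indep_vars (\<lambda>t. Ms (Inl t)) (\<lambda>t. Xs n (Inl t)) (T n)"
    by (rule indep_vars_reindex[OF _ _ indep_Xs[OF n]]) (auto simp: Is_eq inj_on_def)
  then have "indep_vars (\<lambda>_. borel) (\<lambda>t \<omega>. (Xs n (Inl t) \<omega>) 0 / sd n (fst t)) (T n)"
    by (rule indep_vars_compose2) (auto simp: Ms_def intro!: borel_measurable_divide measurable_component_singleton)
  also have "(\<lambda>t \<omega>. (Xs n (Inl t) \<omega>) 0 / sd n (fst t)) = ?Y"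
    by (auto simp: Xs_def fun_eq_iff)
  finally have "distr M (PiM (T n) (\<lambda>_. borel)) (\<lambda>\<omega>. \<lambda>t\<in>T n. ?Y t \<omega>) = PiM (T n) (\<lambda>t. distr M borel (?Y t))"
    using False n W_measurable by (subst (asm) indep_vars_iff_distr_eq_PiM') (auto simp: T_def)
  also have "\<dots> = PiM (T n) (\<lambda>_. std_gauss)"
    using n by (intro PiM_cong refl) (auto simp: T_def distr_xi_coord)
  finally show ?thesis unfolding xi_def[abs_def] .
qed

lemma st_input: "st n \<omega> m \<alpha> = (\<lambda>k\<in>{..<m}. X n \<omega> k \<alpha>)"
  by (auto simp: st_def Gb_m val_input)

lemma distr_past_input:
  assumes n: "n \<ge> 1"
  shows "distr M (PS n m) (\<lambda>\<omega>. past n \<omega> m) = PiM {..<n} (\<lambda>_. gaussian_vec {..<m} mu_in S_in)"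
proof -
  have "indep_vars (\<lambda>t. Ms (Inr t)) (\<lambda>t. Xs n (Inr t)) {..<n}"
    by (rule indep_vars_reindex[OF _ _ indep_Xs[OF n]]) (auto simp: Is_eq inj_on_def)
  then have "indep_vars (\<lambda>_. PiM {..<m} (\<lambda>_. borel)) (\<lambda>\<alpha> \<omega>. \<lambda>k\<in>{..<m}. X n \<omega> k \<alpha>) {..<n}"
    by (simp add: Ms_def Xs_def[abs_def])
  moreover have "0 \<in> {..<n}" using n by simp
  then have "{..<n} \<noteq> {}" by blast
  ultimately have "distr M (PiM {..<n} (\<lambda>_. PiM {..<m} (\<lambda>_. borel))) (\<lambda>\<omega>. \<lambda>\<alpha>\<in>{..<n}. \<lambda>k\<in>{..<m}. X n \<omega> k \<alpha>) =
     PiM {..<n} (\<lambda>\<alpha>. distr M (PiM {..<m} (\<lambda>_. borel)) (\<lambda>\<omega>. \<lambda>k\<in>{..<m}. X n \<omega> k \<alpha>))"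
    using X_measurable[OF n] by (subst (asm) indep_vars_iff_distr_eq_PiM') auto
  also have "\<dots> = PiM {..<n} (\<lambda>_. gaussian_vec {..<m} mu_in S_in)"
    using smp[OF n] by (intro PiM_cong refl) (auto simp: sampled_def)
  finally show ?thesis by (simp add: PS_def past_def st_input Gb_m)
qed

lemma indep_past_xi:
  assumes n: "n \<ge> 1"
  shows "distr M (PS n m \<Otimes>\<^sub>M PiM (T n) (\<lambda>_. borel)) (\<lambda>\<omega>. (past n \<omega> m, xi n \<omega>)) =
    distr M (PS n m) (\<lambda>\<omega>. past n \<omega> m) \<Otimes>\<^sub>M PiM (T n) (\<lambda>_. std_gauss)"
proof -
  have iv: "indep_var (PiM (Inr ` {..<n}) Ms) (\<lambda>\<omega>. restrict (\<lambda>i. Xs n i \<omega>) (Inr ` {..<n}))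
      (PiM (Inl ` T n) Ms) (\<lambda>\<omega>. restrict (\<lambda>i. Xs n i \<omega>) (Inl ` T n))"
    by (rule indep_var_restrict[OF indep_Xs[OF n]]) (auto simp: Is_eq)
  define A where "A = (\<lambda>\<omega>. restrict (\<lambda>i. Xs n i \<omega>) (Inr ` {..<n}))"
  define B where "B = (\<lambda>\<omega>. restrict (\<lambda>i. Xs n i \<omega>) (Inl ` T n))"
  let ?MA = "PiM (Inr ` {..<n}) Ms" and ?MB = "PiM (Inl ` T n) Ms" and ?B = "PiM (T n) (\<lambda>_. borel :: real measure)"
  have AB: "A \<in> measurable M ?MA" "B \<in> measurable M ?MB"
    "distr M ?MA A \<Otimes>\<^sub>M distr M ?MB B = distr M (?MA \<Otimes>\<^sub>M ?MB) (\<lambda>\<omega>. (A \<omega>, B \<omega>))"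
    using iv unfolding indep_var_distribution_eq A_def B_def by auto
  define h1 where "h1 = (\<lambda>F :: nat \<times> nat \<times> nat + nat \<Rightarrow> nat \<Rightarrow> real. \<lambda>\<alpha>\<in>{..<n}. F (Inr \<alpha>))"
  define h2 where "h2 = (\<lambda>F :: nat \<times> nat \<times> nat + nat \<Rightarrow> nat \<Rightarrow> real. \<lambda>t\<in>T n. F (Inl t) 0 / sd n (fst t))"
  have h1: "h1 \<in> measurable ?MA (PS n m)"
    unfolding PS_def h1_def
  proof (rule measurable_restrict)
    fix \<alpha> assume "\<alpha> \<in> {..<n}"
    then have "(\<lambda>F. F (Inr \<alpha>)) \<in> measurable ?MA (Ms (Inr \<alpha>))"
      by (intro measurable_component_singleton) auto
    then show "(\<lambda>F. F (Inr \<alpha>)) \<in> measurable ?MA (PiM (Gb m) (\<lambda>_. borel))"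
      by (simp add: Ms_def Gb_m)
  qed
  have h2: "h2 \<in> measurable ?MB ?B"
    unfolding h2_def
  proof (intro measurable_restrict borel_measurable_divide)
    fix t assume "t \<in> T n"
    then have "(\<lambda>F. F (Inl t)) \<in> measurable ?MB (Ms (Inl t))"
      by (intro measurable_component_singleton) auto
    then show "(\<lambda>F. F (Inl t) 0) \<in> borel_measurable ?MB"
      by (rule measurable_compose) (auto simp: Ms_def intro!: measurable_component_singleton)
  qed auto
  have e1: "h1 (A \<omega>) = past n \<omega> m" and e2: "h2 (B \<omega>) = xi n \<omega>" for \<omega>
    by (auto simp: h1_def h2_def A_def B_def past_def st_input xi_def Xs_def fun_eq_iff)
  have d1: "distr (distr M ?MA A) (PS n m) h1 = distr M (PS n m) (\<lambda>\<omega>. past n \<omega> m)"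
    using AB h1 by (subst distr_distr) (auto simp: comp_def e1)
  have d2: "distr (distr M ?MB B) ?B h2 = PiM (T n) (\<lambda>_. std_gauss)"
    using AB h2 distr_xi[OF n] by (subst distr_distr) (auto simp: comp_def e2[abs_def])
  have "distr M (PS n m) (\<lambda>\<omega>. past n \<omega> m) \<Otimes>\<^sub>M PiM (T n) (\<lambda>_. std_gauss) =
    distr (distr M ?MA A \<Otimes>\<^sub>M distr M ?MB B) (PS n m \<Otimes>\<^sub>M ?B) (\<lambda>(x, y). (h1 x, h2 y))"
    unfolding d1[symmetric] d2[symmetric] using h1 h2
    by (intro pair_measure_distr) (auto simp: d2 intro: prob_space_imp_sigma_finite prob_space_PiM_std_gauss)
  also have "\<dots> = distr M (PS n m \<Otimes>\<^sub>M ?B) (\<lambda>\<omega>. (past n \<omega> m, xi n \<omega>))"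
    unfolding AB(3) using AB h1 h2 by (subst distr_distr) (auto simp: comp_def e1 e2)
  finally show ?thesis ..
qed

end

section \<open>The law of one more matrix multiplication\<close>

lemma resid_measurable:
  assumes "\<And>i j. (\<lambda>x. Q x i j) \<in> borel_measurable N"
  shows "(\<lambda>x. resid J (Q x) bs h i) \<in> borel_measurable N"
proof (induction bs arbitrary: h i)
  case (Cons b bs)
  have [measurable]: "(\<lambda>x. Q x i j) \<in> borel_measurable N" for i j by (rule assms)
  note [measurable] = Cons.IH
  show ?case unfolding resid.simps bil_def by measurable
qed simp

context netsor
begin

text \<open>The earlier products with the same matrix, which are the regressors for the new
  variable.\<close>

definition "Bv v = {i \<in> Gb v. ismm i \<and> avar i = avar v}"
definition "Jv v = insert v (Bv v)"
definition "bs v = sorted_list_of_set (Bv v)"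
text \<open>The empirical Gram matrix of the multiplied vectors, an average over coordinates, so
  that its entries converge by the law of large numbers.\<close>

definition "Qn n v p = (\<lambda>i j. \<Sum>\<beta><n. 1 / real n * (\<phi> i (p \<beta>) * \<phi> j (p \<beta>)))"
definition "un n v p = resid (Jv v) (Qn n v p) (bs v) v"
definition "rn n v p \<beta> = (\<Sum>i\<in>Jv v. un n v p i * \<phi> i (p \<beta>))"
definition "tn n v p = sqrt (bil (Jv v) (Qn n v p) (un n v p) (un n v p))"
text \<open>\<open>y\<close> stands for the normalised matrix applied to the residual,
  \<open>t\<close> in \<open>upd\<close> for standard normals; their scales differ by the norm of
  the residual, see \<open>rn_norm\<close>.\<close>

definition "updy n v p y = (\<lambda>\<alpha>\<in>{..<n::nat}. (p \<alpha>)(v := (\<Sum>i\<in>Bv v. - un n v p i * p \<alpha> i) + sd n (avar v) * y \<alpha>))"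
definition "upd n v p t = (\<lambda>\<alpha>\<in>{..<n::nat}. (p \<alpha>)(v := (\<Sum>i\<in>Bv v. - un n v p i * p \<alpha> i) + sqrt (sW2 (avar v)) * tn n v p * t \<alpha>))"

lemma finite_Bv [simp]: "finite (Bv v)" by (simp add: Bv_def)
lemma finite_Jv [simp]: "finite (Jv v)" by (simp add: Jv_def)
lemma v_notin_Bv [simp]: "v \<notin> Bv v" by (auto simp: Bv_def dest: Gb_less)
lemma bs [simp]: "set (bs v) = Bv v" "distinct (bs v)" by (auto simp: bs_def)
lemma Bv_Gb: "Bv v \<subseteq> Gb v" by (auto simp: Bv_def)

lemma Jv_ismm: "ismm v \<Longrightarrow> i \<in> Jv v \<Longrightarrow> ismm i \<and> Gb i \<subseteq> Gb v"
proof -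
  assume "ismm v" "i \<in> Jv v"
  then have "ismm i" "i \<le> v" using Gb_less[of i v] by (auto simp: Jv_def Bv_def)
  then show ?thesis using Gb_mono by blast
qed

lemma psd_Qn: "psd (Jv v) (Qn n v p)"
  unfolding Qn_def by (rule psd_gram) auto

lemma bil_Qn: "bil (Jv v) (Qn n v p) u w =
    1 / real n * (\<Sum>\<beta><n. (\<Sum>i\<in>Jv v. u i * \<phi> i (p \<beta>)) * (\<Sum>i\<in>Jv v. w i * \<phi> i (p \<beta>)))"
  unfolding Qn_def by (rule bil_gram)

lemma rn_orthogonal:
  assumes n: "n \<ge> 1" and j: "j \<in> Bv v"
  shows "(\<Sum>\<beta><n. rn n v p \<beta> * \<phi> j (p \<beta>)) = 0"
proof -
  have "(\<Sum>i\<in>Jv v. unit_at j i * \<phi> i (p \<beta>)) = (\<Sum>i\<in>Jv v. if i = j then \<phi> i (p \<beta>) else 0)" for \<beta>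
    by (rule sum.cong) (auto simp: unit_at_def)
  then have u: "(\<Sum>i\<in>Jv v. unit_at j i * \<phi> i (p \<beta>)) = \<phi> j (p \<beta>)" for \<beta>
    using j by (simp add: Jv_def)
  have "bil (Jv v) (Qn n v p) (un n v p) (unit_at j) = 0"
    unfolding un_def using j by (intro resid_orthogonal psd_Qn) (auto simp: Jv_def)
  then show ?thesis using n unfolding bil_Qn u by (simp add: rn_def)
qed

text \<open>The factor 1/n in the variance of the entries is the normalisation of the Gram matrix,
  so the noise level has a limit.\<close>

lemma rn_norm:
  assumes n: "n \<ge> 1"
  shows "sd n a * sqrt (\<Sum>\<beta><n. (rn n v p \<beta>)\<^sup>2) = sqrt (sW2 a) * tn n v p"
proof -
  have "bil (Jv v) (Qn n v p) (un n v p) (un n v p) = (\<Sum>\<beta><n. (rn n v p \<beta>)\<^sup>2) / real n"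
    unfolding bil_Qn by (simp add: rn_def power2_eq_square)
  then show ?thesis by (simp add: sd_def tn_def real_sqrt_divide)
qed

lemma rn_eq: "rn n v p \<beta> = \<phi> v (p \<beta>) + (\<Sum>i\<in>Bv v. un n v p i * \<phi> i (p \<beta>))"
  by (simp add: rn_def Jv_def un_def resid_self)

lemma \<phi>_past_measurable:
  assumes v: "ismm v" and p: "p \<in> measurable N (PS n v)" and i: "i \<in> Jv v" and b: "\<beta> < n"
  shows "(\<lambda>x. \<phi> i (p x \<beta>)) \<in> borel_measurable N"
proof -
  have "(\<lambda>x. p x \<beta>) \<in> measurable N (PiM (Gb v) (\<lambda>_. borel))"
    using b by (intro measurable_compose[OF p]) (auto simp: PS_def intro!: measurable_component_singleton)
  from measurable_compose[OF this \<phi>_measurable] show ?thesis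
    using Jv_ismm[OF v i] by blast
qed

lemma Qn_measurable:
  assumes v: "ismm v" and p: "p \<in> measurable N (PS n v)" and i: "i \<in> Jv v" "j \<in> Jv v"
  shows "(\<lambda>x. Qn n v (p x) i j) \<in> borel_measurable N"
  unfolding Qn_def using i
  by (intro borel_measurable_sum borel_measurable_times \<phi>_past_measurable[OF v p]) auto

lemma un_measurable:
  assumes v: "ismm v" and p: "p \<in> measurable N (PS n v)"
  shows "(\<lambda>x. un n v (p x) i) \<in> borel_measurable N"
proof -
  \<comment> \<open>Measurability of \<open>Qn\<close> is available only for indices in
    \<open>Jv v\<close>, whereas \<open>resid_measurable\<close> asks for all entries; setting the
    others to zero leaves \<open>bil\<close>, and hence \<open>resid\<close>, unchanged.\<close>
  define Q where "Q = (\<lambda>x i j. if i \<in> Jv v \<and> j \<in> Jv v then Qn n v (p x) i j else 0)"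
  have "bil (Jv v) (Q x) u w = bil (Jv v) (Qn n v (p x)) u w" for x u w
    unfolding bil_def Q_def by (intro sum.cong) auto
  then have "resid (Jv v) (Q x) bs h = resid (Jv v) (Qn n v (p x)) bs h" for x bs h
    by (induction bs arbitrary: h) auto
  moreover have "(\<lambda>x. resid (Jv v) (Q x) (bs v) v i) \<in> borel_measurable N"
  proof (rule resid_measurable)
    show "(\<lambda>x. Q x i j) \<in> borel_measurable N" for i j
      using Qn_measurable[OF v p, of i j] by (cases "i \<in> Jv v \<and> j \<in> Jv v") (auto simp: Q_def)
  qed
  ultimately show ?thesis by (simp add: un_def)
qed

lemma bil_Qn_measurable:
  assumes v: "ismm v" and p: "p \<in> measurable N (PS n v)"
    and u: "\<And>i. (\<lambda>x. u x i) \<in> borel_measurable N"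
  shows "(\<lambda>x. bil (Jv v) (Qn n v (p x)) (u x) (u x)) \<in> borel_measurable N"
  unfolding bil_def by (intro borel_measurable_sum borel_measurable_times Qn_measurable[OF v p] u)

lemma tn_measurable:
  assumes v: "ismm v" and p: "p \<in> measurable N (PS n v)"
  shows "(\<lambda>x. tn n v (p x)) \<in> borel_measurable N"
proof -
  note [measurable] = bil_Qn_measurable[OF v p un_measurable[OF v p]]
  show ?thesis unfolding tn_def by measurable
qed

lemma rn_measurable:
  assumes v: "ismm v" and p: "p \<in> measurable N (PS n v)" and b: "\<beta> < n"
  shows "(\<lambda>x. rn n v (p x) \<beta>) \<in> borel_measurable N"
  unfolding rn_def
  by (intro borel_measurable_sum borel_measurable_times un_measurable[OF v p] \<phi>_past_measurable[OF v p _ b])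

lemma coordinate_update_measurable:
  assumes v: "ismm v" and p: "p \<in> measurable N (PS n v)" and c: "\<And>i. (\<lambda>x. c x i) \<in> borel_measurable N"
    and y: "\<And>\<alpha>. \<alpha> < n \<Longrightarrow> (\<lambda>x. y x \<alpha>) \<in> borel_measurable N"
  shows "(\<lambda>x. \<lambda>\<alpha>\<in>{..<n}. (p x \<alpha>)(v := (\<Sum>i\<in>Bv v. c x i * p x \<alpha> i) + y x \<alpha>)) \<in> measurable N (PS n (Suc v))"
  unfolding PS_def
proof (rule measurable_restrict)
  fix \<alpha> assume a: "\<alpha> \<in> {..<n}"
  have pa: "(\<lambda>x. p x \<alpha>) \<in> measurable N (PiM (Gb v) (\<lambda>_. borel))"
    using a by (intro measurable_compose[OF p]) (auto simp: PS_def intro!: measurable_component_singleton)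
  have pai: "(\<lambda>x. p x \<alpha> i) \<in> borel_measurable N" if "i \<in> Bv v" for i
    using measurable_compose[OF pa measurable_component_singleton[of i]] that Bv_Gb by auto
  show "(\<lambda>x. (p x \<alpha>)(v := (\<Sum>i\<in>Bv v. c x i * p x \<alpha> i) + y x \<alpha>)) \<in> measurable N (PiM (Gb (Suc v)) (\<lambda>_. borel))"
  proof (rule measurable_fun_upd[where J="Gb v"])
    show "Gb (Suc v) = Gb v \<union> {v}" using v by (simp add: Gb_Suc)
    show "(\<lambda>x. (\<Sum>i\<in>Bv v. c x i * p x \<alpha> i) + y x \<alpha>) \<in> borel_measurable N"
      using a by (intro borel_measurable_add borel_measurable_sum borel_measurable_times c pai y) auto
  qed (rule pa)
qed

lemma updy_measurable:
  assumes v: "ismm v" and p: "p \<in> measurable N (PS n v)" and y: "y \<in> measurable N (PiM {..<n} (\<lambda>_. borel))"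
  shows "(\<lambda>x. updy n v (p x) (y x)) \<in> measurable N (PS n (Suc v))"
  unfolding updy_def using un_measurable[OF v p] measurable_compose[OF y measurable_component_singleton]
  by (intro coordinate_update_measurable[OF v p]) auto

lemma W_eq_xi: "n \<ge> 1 \<Longrightarrow> a < nA \<Longrightarrow> i < n \<Longrightarrow> j < n \<Longrightarrow> W n a \<omega> i j = sd n a * xi n \<omega> (a, i, j)"
  using sd_pos[of n a] by (simp add: xi_def T_def)

lemma past_Suc:
  assumes n: "n \<ge> 1" and v: "ismm v"
  shows "past n \<omega> (Suc v) = updy n v (past n \<omega> v)
    (\<lambda>\<alpha>\<in>{..<n}. \<Sum>\<beta><n. xi n \<omega> (avar v, \<alpha>, \<beta>) * rn n v (past n \<omega> v) \<beta>)"
proof (rule ext)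
  fix \<alpha>
  let ?p = "past n \<omega> v"
  show "past n \<omega> (Suc v) \<alpha> = updy n v ?p (\<lambda>\<alpha>\<in>{..<n}. \<Sum>\<beta><n. xi n \<omega> (avar v, \<alpha>, \<beta>) * rn n v ?p \<beta>) \<alpha>"
  proof (cases "\<alpha> < n")
    case True
    have p: "?p \<beta> = st n \<omega> v \<beta>" if "\<beta> < n" for \<beta> using that by (simp add: past_def)
    have mm: "val n \<omega> i \<alpha> = (\<Sum>\<beta><n. W n (avar v) \<omega> \<alpha> \<beta> * \<phi> i (?p \<beta>))" if "i \<in> Jv v" for i
    proof -
      have "ismm i" "avar i = avar v" "i \<le> v" using that v by (auto simp: Jv_def Bv_def dest: Gb_less)
      then show ?thesis by (simp add: val_mm val_arg[of i v] p)
    qed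
    have pi: "?p \<alpha> i = val n \<omega> i \<alpha>" if "i \<in> Bv v" for i
      using that True Bv_Gb[of v] by (auto simp: p st_def)
    have "val n \<omega> v \<alpha> = (\<Sum>\<beta><n. W n (avar v) \<omega> \<alpha> \<beta> * (rn n v ?p \<beta> - (\<Sum>i\<in>Bv v. un n v ?p i * \<phi> i (?p \<beta>))))"
      unfolding rn_eq by (simp add: mm Jv_def)
    also have "\<dots> = (\<Sum>\<beta><n. W n (avar v) \<omega> \<alpha> \<beta> * rn n v ?p \<beta>)
        - (\<Sum>\<beta><n. \<Sum>i\<in>Bv v. un n v ?p i * (W n (avar v) \<omega> \<alpha> \<beta> * \<phi> i (?p \<beta>)))"
      by (simp add: right_diff_distrib sum_subtractf sum_distrib_left mult.left_commute)
    also have "(\<Sum>\<beta><n. \<Sum>i\<in>Bv v. un n v ?p i * (W n (avar v) \<omega> \<alpha> \<beta> * \<phi> i (?p \<beta>))) =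
        (\<Sum>i\<in>Bv v. un n v ?p i * ?p \<alpha> i)"
      by (subst sum.swap) (simp add: pi mm Jv_def sum_distrib_left)
    also have "(\<Sum>\<beta><n. W n (avar v) \<omega> \<alpha> \<beta> * rn n v ?p \<beta>) =
        sd n (avar v) * (\<Sum>\<beta><n. xi n \<omega> (avar v, \<alpha>, \<beta>) * rn n v ?p \<beta>)"
      using n True ismmD(4)[OF v] by (simp add: W_eq_xi sum_distrib_left mult.assoc)
    finally have val: "val n \<omega> v \<alpha> = (\<Sum>i\<in>Bv v. - un n v ?p i * ?p \<alpha> i) +
        sd n (avar v) * (\<Sum>\<beta><n. xi n \<omega> (avar v, \<alpha>, \<beta>) * rn n v ?p \<beta>)"
      by (simp add: sum_negf)
    have "past n \<omega> (Suc v) \<alpha> = (?p \<alpha>)(v := val n \<omega> v \<alpha>)"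
      using True v by (auto simp: past_def st_def Gb_Suc fun_eq_iff)
    then show ?thesis unfolding val using True by (simp add: updy_def)
  qed (simp add: past_def updy_def)
qed

text \<open>\<open>gaussian_swap\<close> for all rows of one matrix at once: direction
  \<open>\<alpha>\<close> is the unit vector \<open>r / R\<close> placed in row
  \<open>\<alpha>\<close> of matrix \<open>a\<close>. Different rows have disjoint supports, hence
  orthonormality, and \<open>inv\<close> is invariance under adding a rank one matrix with row
  direction \<open>r\<close>.\<close>

lemma swap_row:
  fixes r :: "nat \<Rightarrow> real" and n :: nat
  defines "R \<equiv> sqrt (\<Sum>\<beta><n. (r \<beta>)\<^sup>2)"
  assumes a: "a < nA"
    and f: "(\<lambda>x. f (fst x) (snd x)) \<in> borel_measurable (PiM {..<n} (\<lambda>_. borel) \<Otimes>\<^sub>M PiM (T n) (\<lambda>_. borel))"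
    and inv: "\<And>y w u. y \<in> extensional {..<n} \<Longrightarrow> w \<in> extensional (T n) \<Longrightarrow>
      f y (\<lambda>k\<in>T n. w k + (if fst k = a then u (fst (snd k)) * r (snd (snd k)) else 0)) = f y w"
  shows "(\<integral>\<^sup>+w. f (\<lambda>\<alpha>\<in>{..<n}. \<Sum>\<beta><n. w (a, \<alpha>, \<beta>) * r \<beta>) w \<partial>PiM (T n) (\<lambda>_. std_gauss)) =
    (\<integral>\<^sup>+t. \<integral>\<^sup>+w. f (\<lambda>\<alpha>\<in>{..<n}. R * t \<alpha>) w \<partial>PiM (T n) (\<lambda>_. std_gauss) \<partial>PiM {..<n} (\<lambda>_. std_gauss))"
proof (cases "R = 0")
  case True
  interpret P: prob_space "PiM {..<n} (\<lambda>_. std_gauss)" by (rule prob_space_PiM_std_gauss)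
  have "r \<beta> = 0" if "\<beta> < n" for \<beta>
    using True that by (simp add: R_def sum_nonneg_eq_0_iff)
  then show ?thesis using True by (simp add: P.emeasure_space_1[simplified] cong: restrict_cong)
next
  case False
  have R2: "R\<^sup>2 = (\<Sum>\<beta><n. (r \<beta>)\<^sup>2)" unfolding R_def by (simp add: sum_nonneg)
  define e where "e = (\<lambda>\<alpha> k :: nat \<times> nat \<times> nat. if fst k = a \<and> fst (snd k) = \<alpha> then r (snd (snd k)) / R else 0)"
  have sumT: "(\<Sum>k\<in>T n. e \<alpha> k * g k) = (\<Sum>\<beta><n. r \<beta> / R * g (a, \<alpha>, \<beta>))" if "\<alpha> < n" for \<alpha> g
  proof -
    have "(\<Sum>k\<in>T n. e \<alpha> k * g k) = (\<Sum>k\<in>(\<lambda>\<beta>. (a, \<alpha>, \<beta>)) ` {..<n}. e \<alpha> k * g k)"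
      using that a by (intro sum.mono_neutral_right) (auto simp: T_def e_def)
    also have "\<dots> = (\<Sum>\<beta><n. r \<beta> / R * g (a, \<alpha>, \<beta>))"
      by (subst sum.reindex) (auto simp: inj_on_def e_def)
    finally show ?thesis .
  qed
  have f2[measurable (raw)]: "(\<lambda>x. f (g x) (h x)) \<in> borel_measurable N"
    if "g \<in> measurable N (PiM {..<n} (\<lambda>_. borel))" "h \<in> measurable N (PiM (T n) (\<lambda>_. borel))" for g h and N :: "'n measure"
    using measurable_compose[OF measurable_Pair[OF that] f] by simp
  let ?f = "\<lambda>y w. f (\<lambda>\<alpha>\<in>{..<n}. R * y \<alpha>) w"
  have "(\<integral>\<^sup>+w. ?f (\<lambda>\<alpha>\<in>{..<n}. \<Sum>k\<in>T n. e \<alpha> k * w k) w \<partial>PiM (T n) (\<lambda>_. std_gauss)) =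
    (\<integral>\<^sup>+t. \<integral>\<^sup>+w. ?f t w \<partial>PiM (T n) (\<lambda>_. std_gauss) \<partial>PiM {..<n} (\<lambda>_. std_gauss))"
  proof (rule gaussian_swap[where f="?f"])
    fix i j assume "i \<in> {..<n}" "j \<in> {..<n}"
    then have "(\<Sum>k\<in>T n. e i k * e j k) = (\<Sum>\<beta><n. r \<beta> / R * e j (a, i, \<beta>))" by (simp add: sumT)
    also have "\<dots> = (if i = j then (\<Sum>\<beta><n. (r \<beta>)\<^sup>2) / R\<^sup>2 else 0)"
      by (auto simp: e_def power2_eq_square sum_divide_distrib)
    also have "(\<Sum>\<beta><n. (r \<beta>)\<^sup>2) / R\<^sup>2 = 1" using False by (simp add: R2[symmetric])
    finally show "(\<Sum>k\<in>T n. e i k * e j k) = (if i = j then 1 else 0)" .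
  next
    show "(\<lambda>x. ?f (fst x) (snd x)) \<in> borel_measurable (PiM {..<n} (\<lambda>_. borel) \<Otimes>\<^sub>M PiM (T n) (\<lambda>_. borel))"
      by measurable
  next
    fix y u :: "nat \<Rightarrow> real" and w :: "nat \<times> nat \<times> nat \<Rightarrow> real" assume w: "w \<in> extensional (T n)"
    have "(\<lambda>k\<in>T n. w k + (\<Sum>j\<in>{..<n}. u j * e j k)) =
        (\<lambda>k\<in>T n. w k + (if fst k = a then u (fst (snd k)) / R * r (snd (snd k)) else 0))"
    proof (rule restrict_ext)
      fix k assume "k \<in> T n"
      then have k: "fst (snd k) < n" by (auto simp: T_def)
      have "(\<Sum>j\<in>{..<n}. u j * e j k) = (\<Sum>j\<in>{..<n}. if fst (snd k) = j then (if fst k = a then u j / R * r (snd (snd k)) else 0) else 0)"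
        by (rule sum.cong) (auto simp: e_def)
      also have "\<dots> = (if fst k = a then u (fst (snd k)) / R * r (snd (snd k)) else 0)"
        using k by (subst sum.delta') auto
      finally show "w k + (\<Sum>j\<in>{..<n}. u j * e j k) = w k + (if fst k = a then u (fst (snd k)) / R * r (snd (snd k)) else 0)"
        by simp
    qed
    then show "?f y (\<lambda>k\<in>T n. w k + (\<Sum>j\<in>{..<n}. u j * e j k)) = ?f y w"
      using inv[of "\<lambda>\<alpha>\<in>{..<n}. R * y \<alpha>" w "\<lambda>i. u i / R"] w by simp
  qed auto
  moreover have "(\<lambda>\<alpha>\<in>{..<n}. R * (\<lambda>\<alpha>\<in>{..<n}. \<Sum>k\<in>T n. e \<alpha> k * w k) \<alpha>) = (\<lambda>\<alpha>\<in>{..<n}. \<Sum>\<beta><n. w (a, \<alpha>, \<beta>) * r \<beta>)" for w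
  proof (rule restrict_ext)
    fix \<alpha> assume "\<alpha> \<in> {..<n}"
    then have "R * (\<lambda>\<alpha>\<in>{..<n}. \<Sum>k\<in>T n. e \<alpha> k * w k) \<alpha> = R * (\<Sum>\<beta><n. r \<beta> / R * w (a, \<alpha>, \<beta>))"
      by (simp add: sumT)
    also have "\<dots> = (\<Sum>\<beta><n. w (a, \<alpha>, \<beta>) * r \<beta>)"
      unfolding sum_distrib_left using False by (intro sum.cong) auto
    finally show "R * (\<lambda>\<alpha>\<in>{..<n}. \<Sum>k\<in>T n. e \<alpha> k * w k) \<alpha> = (\<Sum>\<beta><n. w (a, \<alpha>, \<beta>) * r \<beta>)" .
  qed
  ultimately show ?thesis by simp
qed

text \<open>Dependence on the matrices through part of their action only, encoded as equality on any
  two families of matrices with that action. The admissible test vectors \<open>r\<close> depend on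
  the history \<open>p\<close>, as conditioning demands.\<close>

definition "row_inv n v F \<longleftrightarrow> (\<forall>p\<in>space (PS n v). \<forall>w\<in>extensional (T n). \<forall>w'\<in>extensional (T n).
  (\<forall>a<nA. \<forall>r. (\<forall>i\<in>Gb v. ismm i \<longrightarrow> avar i = a \<longrightarrow> (\<Sum>\<beta><n. r \<beta> * \<phi> i (p \<beta>)) = 0) \<longrightarrow>
     (\<forall>\<alpha><n. (\<Sum>\<beta><n. w (a, \<alpha>, \<beta>) * r \<beta>) = (\<Sum>\<beta><n. w' (a, \<alpha>, \<beta>) * r \<beta>))) \<longrightarrow> F p w = F p w')"

lemma row_invD:
  assumes "row_inv n v F" "p \<in> space (PS n v)" "w \<in> extensional (T n)" "w' \<in> extensional (T n)"
    "\<And>a r \<alpha>. a < nA \<Longrightarrow> (\<And>i. i \<in> Gb v \<Longrightarrow> ismm i \<Longrightarrow> avar i = a \<Longrightarrow> (\<Sum>\<beta><n. r \<beta> * \<phi> i (p \<beta>)) = 0) \<Longrightarrow> \<alpha> < n \<Longrightarrow>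
     (\<Sum>\<beta><n. w (a, \<alpha>, \<beta>) * r \<beta>) = (\<Sum>\<beta><n. w' (a, \<alpha>, \<beta>) * r \<beta>)"
  shows "F p w = F p w'"
  using assms unfolding row_inv_def by blast

text \<open>A vector orthogonal to the arguments multiplied before \<open>Suc v\<close> is
  orthogonal to those multiplied before \<open>v\<close>. Since \<open>\<phi> i\<close> reads only
  variables below \<open>i\<close>, the history after the step may replace the one before
  it.\<close>

lemma row_eq_extend:
  fixes r :: "nat \<Rightarrow> real"
  assumes "a < nA"
    and k: "\<And>r. (\<And>i. i \<in> Gb v \<Longrightarrow> ismm i \<Longrightarrow> avar i = a \<Longrightarrow> (\<Sum>\<beta><n. r \<beta> * \<phi> i (p \<beta>)) = 0) \<Longrightarrow> P r"
    and v: "ismm v" and r: "\<And>i. i \<in> Gb (Suc v) \<Longrightarrow> ismm i \<Longrightarrow> avar i = a \<Longrightarrow> (\<Sum>\<beta><n. r \<beta> * \<phi> i (p' \<beta>)) = 0"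
    and p': "\<And>\<beta> g. \<beta> < n \<Longrightarrow> g \<in> Gb v \<Longrightarrow> p' \<beta> g = p \<beta> g"
  shows "P r"
proof (rule k)
  fix i assume i: "i \<in> Gb v" "ismm i" "avar i = a"
  have "i \<le> v" using Gb_less[OF i(1)] by simp
  then have "\<phi> i (p \<beta>) = \<phi> i (p' \<beta>)" if "\<beta> < n" for \<beta>
    using p' that Gb_mono[of i v] by (intro \<phi>_cong i) auto
  then show "(\<Sum>\<beta><n. r \<beta> * \<phi> i (p \<beta>)) = 0"
    using r[of i] i v by (simp add: Gb_Suc)
qed

text \<open>Given the history up to variable \<open>v\<close>, whatever depends on the matrices only through their action on
  vectors orthogonal to the vectors they have been applied to may be evaluated on fresh matrices.
  In the step, \<open>gaussian_swap\<close> splits off the direction of the new residual.\<close>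
lemma resample:
  fixes F :: "(nat \<Rightarrow> nat \<Rightarrow> real) \<Rightarrow> (nat \<times> nat \<times> nat \<Rightarrow> real) \<Rightarrow> ennreal"
  assumes n: "n \<ge> 1" and v: "m \<le> v" "v \<le> nv"
    and F: "(\<lambda>x. F (fst x) (snd x)) \<in> borel_measurable (PS n v \<Otimes>\<^sub>M PiM (T n) (\<lambda>_. borel))"
    and inv: "row_inv n v F"
  shows "(\<integral>\<^sup>+\<omega>. F (past n \<omega> v) (xi n \<omega>) \<partial>M) = (\<integral>\<^sup>+\<omega>. \<integral>\<^sup>+w. F (past n \<omega> v) w \<partial>PiM (T n) (\<lambda>_. std_gauss) \<partial>M)"
  using v F inv
proof (induction v arbitrary: F rule: dec_induct)
  case base
  let ?G = "PiM (T n) (\<lambda>_. std_gauss)"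
  interpret G: prob_space ?G by (rule prob_space_PiM_std_gauss)
  have p[measurable]: "(\<lambda>\<omega>. past n \<omega> m) \<in> measurable M (PS n m)" and x[measurable]: "xi n \<in> measurable M (PiM (T n) (\<lambda>_. borel))"
    using n by (auto simp: past_measurable xi_measurable nv_def)
  note [measurable] = base.prems(2)
  have "(\<integral>\<^sup>+\<omega>. F (past n \<omega> m) (xi n \<omega>) \<partial>M) =
    (\<integral>\<^sup>+x. F (fst x) (snd x) \<partial>distr M (PS n m \<Otimes>\<^sub>M PiM (T n) (\<lambda>_. borel)) (\<lambda>\<omega>. (past n \<omega> m, xi n \<omega>)))"
    by (subst nn_integral_distr) auto
  also have "\<dots> = (\<integral>\<^sup>+p. \<integral>\<^sup>+w. F p w \<partial>?G \<partial>distr M (PS n m) (\<lambda>\<omega>. past n \<omega> m))"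
    unfolding indep_past_xi[OF n] by (subst G.nn_integral_fst[symmetric]) auto
  also have "\<dots> = (\<integral>\<^sup>+\<omega>. \<integral>\<^sup>+w. F (past n \<omega> m) w \<partial>?G \<partial>M)"
    by (rule nn_integral_distr) measurable
  finally show ?case .
next
  case (step v)
  let ?G = "PiM (T n) (\<lambda>_. std_gauss)" and ?Y = "PiM {..<n} (\<lambda>_. borel :: real measure)"
  let ?B = "PiM (T n) (\<lambda>_. borel :: real measure)"
  interpret G: prob_space ?G by (rule prob_space_PiM_std_gauss)
  show ?case
  proof (cases "ismm v")
    case False
    then have "Gb (Suc v) = Gb v" using step.hyps by (simp add: Gb_Suc)
    then have "past n \<omega> (Suc v) = past n \<omega> v" "PS n (Suc v) = PS n v" "row_inv n (Suc v) F = row_inv n v F" for \<omega>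
      by (auto simp: past_def st_def PS_def row_inv_def)
    then show ?thesis using step.IH[of F] step.prems by simp
  next
    case True
    let ?a = "avar v"
    have a: "?a < nA" using ismmD[OF True] by simp
    have Fm[measurable (raw)]: "(\<lambda>x. F (g x) (h x)) \<in> borel_measurable N"
      if "g \<in> measurable N (PS n (Suc v))" "h \<in> measurable N ?B" for g h and N :: "'n measure"
      using measurable_compose[OF measurable_Pair[OF that] step.prems(2)] by simp
    have updm[measurable (raw)]: "(\<lambda>x. updy n v (p x) (y x)) \<in> measurable N (PS n (Suc v))"
      if "p \<in> measurable N (PS n v)" "y \<in> measurable N ?Y" for p y and N :: "'n measure"
      using that by (rule updy_measurable[OF True])
    define row where "row = (\<lambda>p w. \<lambda>\<alpha>\<in>{..<n}. \<Sum>\<beta><n. w (?a, \<alpha>, \<beta>) * rn n v p \<beta>)"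
    have rowm[measurable (raw)]: "(\<lambda>x. row (p x) (w x)) \<in> measurable N ?Y"
      if p: "p \<in> measurable N (PS n v)" and w: "w \<in> measurable N ?B" for p w and N :: "'n measure"
      unfolding row_def
    proof (intro measurable_restrict borel_measurable_sum borel_measurable_times rn_measurable[OF True p])
      fix \<alpha> \<beta> assume "\<alpha> \<in> {..<n}" "\<beta> \<in> {..<n}"
      then show "(\<lambda>x. w x (?a, \<alpha>, \<beta>)) \<in> borel_measurable N"
        using a by (intro measurable_compose[OF w] measurable_component_singleton) (auto simp: T_def)
    qed auto
    define R where "R = (\<lambda>p. sqrt (\<Sum>\<beta><n. (rn n v p \<beta>)\<^sup>2))"
    \<comment> \<open>\<open>G1\<close> computes the new variable and all that follows from the same
      matrices, \<open>G2\<close> draws fresh ones for what follows. The induction hypothesis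
      applies to both, and \<open>swap1\<close> and \<open>swap2\<close> show that their means on
      fresh matrices agree.\<close>
    define G1 where "G1 = (\<lambda>p w. F (updy n v p (row p w)) w)"
    define G2 where "G2 = (\<lambda>p w0. \<integral>\<^sup>+w. F (updy n v p (row p w0)) w \<partial>?G)"
    have pastS: "past n \<omega> (Suc v) = updy n v (past n \<omega> v) (row (past n \<omega> v) (xi n \<omega>))" for \<omega>
      unfolding row_def by (rule past_Suc[OF n True])
    have upd_space: "updy n v p y \<in> space (PS n (Suc v))" if "p \<in> space (PS n v)" for p y
    proof -
      have "p \<in> {..<n} \<rightarrow>\<^sub>E extensional (Gb v)" using that by (simp add: PS_def space_PiM)
      then show ?thesis using True by (auto simp: PS_def space_PiM updy_def Gb_Suc extensional_def PiE_def Pi_def)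
    qed
    have upd_old: "updy n v p y \<beta> g = p \<beta> g" if "\<beta> < n" "g \<in> Gb v" for p y \<beta> g
      using that Gb_less by (fastforce simp: updy_def)
    have rowO: "row p w = row p w'"
      if "\<And>r \<alpha>. (\<And>i. i \<in> Gb v \<Longrightarrow> ismm i \<Longrightarrow> avar i = ?a \<Longrightarrow> (\<Sum>\<beta><n. r \<beta> * \<phi> i (p \<beta>)) = 0) \<Longrightarrow> \<alpha> < n \<Longrightarrow>
        (\<Sum>\<beta><n. w (?a, \<alpha>, \<beta>) * r \<beta>) = (\<Sum>\<beta><n. w' (?a, \<alpha>, \<beta>) * r \<beta>)" for p w w'
      unfolding row_def
    proof (rule restrict_ext)
      fix \<alpha> assume "\<alpha> \<in> {..<n}"
      then show "(\<Sum>\<beta><n. w (?a, \<alpha>, \<beta>) * rn n v p \<beta>) = (\<Sum>\<beta><n. w' (?a, \<alpha>, \<beta>) * rn n v p \<beta>)"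
        using that[of "rn n v p" \<alpha>] rn_orthogonal[OF n, of _ v p] by (auto simp: Bv_def)
    qed
    have inv1: "row_inv n v G1"
      unfolding row_inv_def
    proof (intro ballI impI)
      fix p w w' assume p: "p \<in> space (PS n v)" and w: "w \<in> extensional (T n)" "w' \<in> extensional (T n)"
        and *: "\<forall>a<nA. \<forall>r. (\<forall>i\<in>Gb v. ismm i \<longrightarrow> avar i = a \<longrightarrow> (\<Sum>\<beta><n. r \<beta> * \<phi> i (p \<beta>)) = 0) \<longrightarrow>
     (\<forall>\<alpha><n. (\<Sum>\<beta><n. w (a, \<alpha>, \<beta>) * r \<beta>) = (\<Sum>\<beta><n. w' (a, \<alpha>, \<beta>) * r \<beta>))"
      have "row p w = row p w'" using * a by (intro rowO) blast
      moreover have "F (updy n v p (row p w)) w = F (updy n v p (row p w)) w'"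
      proof (rule row_invD[OF step.prems(3) upd_space[OF p] w])
        fix a r \<alpha> assume A: "a < nA" "\<alpha> < n"
          and r: "\<And>i. i \<in> Gb (Suc v) \<Longrightarrow> ismm i \<Longrightarrow> avar i = a \<Longrightarrow> (\<Sum>\<beta><n. r \<beta> * \<phi> i (updy n v p (row p w) \<beta>)) = 0"
        show "(\<Sum>\<beta><n. w (a, \<alpha>, \<beta>) * r \<beta>) = (\<Sum>\<beta><n. w' (a, \<alpha>, \<beta>) * r \<beta>)"
          using * A by (rule_tac row_eq_extend[OF A(1) _ True r upd_old]) auto
      qed
      ultimately show "G1 p w = G1 p w'" by (simp add: G1_def)
    qed
    have inv2: "row_inv n v G2"
      unfolding row_inv_def
    proof (intro ballI impI)
      fix p w w' assume "\<forall>a<nA. \<forall>r. (\<forall>i\<in>Gb v. ismm i \<longrightarrow> avar i = a \<longrightarrow> (\<Sum>\<beta><n. r \<beta> * \<phi> i (p \<beta>)) = 0) \<longrightarrow>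
     (\<forall>\<alpha><n. (\<Sum>\<beta><n. w (a, \<alpha>, \<beta>) * r \<beta>) = (\<Sum>\<beta><n. w' (a, \<alpha>, \<beta>) * r \<beta>))"
      then have "row p w = row p w'" using a by (intro rowO) blast
      then show "G2 p w = G2 p w'" by (simp add: G2_def)
    qed
    have swap1: "(\<integral>\<^sup>+w. G1 p w \<partial>?G) =
        (\<integral>\<^sup>+t. \<integral>\<^sup>+w. F (updy n v p (\<lambda>\<alpha>\<in>{..<n}. R p * t \<alpha>)) w \<partial>?G \<partial>PiM {..<n} (\<lambda>_. std_gauss))"
      if p: "p \<in> space (PS n v)" for p
      unfolding G1_def row_def R_def
    proof (rule swap_row[OF a])
      have [measurable]: "(\<lambda>_. p) \<in> measurable N (PS n v)" for N :: "'n measure" using p by simp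
      show "(\<lambda>x. F (updy n v p (fst x)) (snd x)) \<in> borel_measurable (?Y \<Otimes>\<^sub>M ?B)" by measurable
      fix y u :: "nat \<Rightarrow> real" and w :: "nat \<times> nat \<times> nat \<Rightarrow> real" assume w: "w \<in> extensional (T n)"
      show "F (updy n v p y) (\<lambda>k\<in>T n. w k + (if fst k = ?a then u (fst (snd k)) * rn n v p (snd (snd k)) else 0)) = F (updy n v p y) w"
      proof (rule row_invD[OF step.prems(3) upd_space[OF p] _ w])
        fix a r \<alpha> assume A: "a < nA" "\<alpha> < n"
          and r: "\<And>i. i \<in> Gb (Suc v) \<Longrightarrow> ismm i \<Longrightarrow> avar i = a \<Longrightarrow> (\<Sum>\<beta><n. r \<beta> * \<phi> i (updy n v p y \<beta>)) = 0"
        have o: "(\<Sum>\<beta><n. r \<beta> * \<phi> i (p \<beta>)) = 0" if "i \<in> Jv v" "a = ?a" for i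
        proof -
          have i: "i \<in> Gb (Suc v)" "ismm i" "avar i = a" using that True by (auto simp: Jv_def Bv_def Gb_Suc)
          have "Gb i \<subseteq> Gb v" using Jv_ismm[OF True that(1)] by simp
          then have "\<phi> i (updy n v p y \<beta>) = \<phi> i (p \<beta>)" if "\<beta> < n" for \<beta>
            using upd_old that by (intro \<phi>_cong i) auto
          then show ?thesis using r[OF i] by simp
        qed
        \<comment> \<open>For the matrix just used, \<open>r\<close> is orthogonal to all arguments
          including the new one, hence to the residual; a rank one change along the residual is then
          invisible to \<open>r\<close>.\<close>
        have "(\<Sum>\<beta><n. r \<beta> * rn n v p \<beta>) = 0" if "a = ?a"
        proof -
          have "(\<Sum>\<beta><n. r \<beta> * rn n v p \<beta>) = (\<Sum>i\<in>Jv v. un n v p i * (\<Sum>\<beta><n. r \<beta> * \<phi> i (p \<beta>)))"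
            unfolding rn_def sum_distrib_left by (subst sum.swap) (simp add: mult.left_commute)
          also have "\<dots> = 0" using o that by simp
          finally show ?thesis .
        qed
        then have z: "(\<Sum>\<beta><n. u \<alpha> * rn n v p \<beta> * r \<beta>) = 0" if "a = ?a"
          using that by (simp add: sum_distrib_left[symmetric] mult.assoc mult.commute[of "rn n v p _"])
        then show "(\<Sum>\<beta><n. (\<lambda>k\<in>T n. w k + (if fst k = ?a then u (fst (snd k)) * rn n v p (snd (snd k)) else 0)) (a, \<alpha>, \<beta>) * r \<beta>) =
            (\<Sum>\<beta><n. w (a, \<alpha>, \<beta>) * r \<beta>)"
          using A z by (cases "a = ?a") (simp_all add: T_def distrib_right sum.distrib)
      qed (rule restrict_extensional)
    qed
    have swap2: "(\<integral>\<^sup>+w. G2 p w \<partial>?G) =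
        (\<integral>\<^sup>+t. \<integral>\<^sup>+w. F (updy n v p (\<lambda>\<alpha>\<in>{..<n}. R p * t \<alpha>)) w \<partial>?G \<partial>PiM {..<n} (\<lambda>_. std_gauss))"
      if p: "p \<in> space (PS n v)" for p
    proof -
      have [measurable]: "(\<lambda>_. p) \<in> measurable N (PS n v)" for N :: "'n measure" using p by simp
      have "(\<integral>\<^sup>+w. G2 p w \<partial>?G) =
        (\<integral>\<^sup>+t. \<integral>\<^sup>+w0. (\<integral>\<^sup>+w. F (updy n v p (\<lambda>\<alpha>\<in>{..<n}. R p * t \<alpha>)) w \<partial>?G) \<partial>?G \<partial>PiM {..<n} (\<lambda>_. std_gauss))"
        unfolding G2_def row_def R_def
      proof (rule swap_row[where f="\<lambda>y w0. \<integral>\<^sup>+w. F (updy n v p y) w \<partial>?G" and r="rn n v p", OF a])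
        have [measurable]: "(\<lambda>y. \<integral>\<^sup>+w. F (updy n v p y) w \<partial>?G) \<in> borel_measurable ?Y"
          by measurable
        show "(\<lambda>x. \<integral>\<^sup>+w. F (updy n v p (fst x)) w \<partial>?G) \<in> borel_measurable (?Y \<Otimes>\<^sub>M ?B)"
          by measurable
      qed (rule refl)
      then show ?thesis by (simp add: G.emeasure_space_1[simplified])
    qed
    have pastsp: "past n \<omega> v \<in> space (PS n v)" for \<omega>
      by (auto simp: past_def PS_def space_PiM st_def)
    have "(\<integral>\<^sup>+\<omega>. F (past n \<omega> (Suc v)) (xi n \<omega>) \<partial>M) = (\<integral>\<^sup>+\<omega>. G1 (past n \<omega> v) (xi n \<omega>) \<partial>M)"
      by (simp add: pastS G1_def)
    also have "\<dots> = (\<integral>\<^sup>+\<omega>. \<integral>\<^sup>+w. G1 (past n \<omega> v) w \<partial>?G \<partial>M)"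
    proof (rule step.IH[OF _ _ inv1])
      show "(\<lambda>x. G1 (fst x) (snd x)) \<in> borel_measurable (PS n v \<Otimes>\<^sub>M ?B)" unfolding G1_def by measurable
    qed (use step.prems in simp)
    also have "\<dots> = (\<integral>\<^sup>+\<omega>. \<integral>\<^sup>+w. G2 (past n \<omega> v) w \<partial>?G \<partial>M)"
      by (simp add: swap1 swap2 pastsp)
    also have "\<dots> = (\<integral>\<^sup>+\<omega>. G2 (past n \<omega> v) (xi n \<omega>) \<partial>M)"
    proof (rule step.IH[OF _ _ inv2, symmetric])
      show "(\<lambda>x. G2 (fst x) (snd x)) \<in> borel_measurable (PS n v \<Otimes>\<^sub>M ?B)" unfolding G2_def by measurable
    qed (use step.prems in simp)
    also have "\<dots> = (\<integral>\<^sup>+\<omega>. \<integral>\<^sup>+w. F (past n \<omega> (Suc v)) w \<partial>?G \<partial>M)"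
      by (simp add: pastS G2_def)
    finally show ?thesis .
  qed
qed

text \<open>The distribution of the matrices enters all later arguments through this formula: given
  the past, the new coordinates are independent normals around the regression. The functional sees
  the matrices through one product with the residual, so \<open>resample\<close> applies, and
  \<open>swap_row\<close> evaluates that product.\<close>

lemma one_step:
  assumes n: "n \<ge> 1" and v: "ismm v" and [measurable]: "\<Phi> \<in> borel_measurable (PS n (Suc v))"
  shows "(\<integral>\<^sup>+\<omega>. \<Phi> (past n \<omega> (Suc v)) \<partial>M) =
    (\<integral>\<^sup>+\<omega>. \<integral>\<^sup>+t. \<Phi> (upd n v (past n \<omega> v) t) \<partial>PiM {..<n} (\<lambda>_. std_gauss) \<partial>M)"
proof -
  let ?G = "PiM (T n) (\<lambda>_. std_gauss)" and ?Y = "PiM {..<n} (\<lambda>_. borel :: real measure)"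
  let ?B = "PiM (T n) (\<lambda>_. borel :: real measure)" and ?a = "avar v"
  interpret G: prob_space ?G by (rule prob_space_PiM_std_gauss)
  note vD = ismmD[OF v]
  define row where "row = (\<lambda>p w. \<lambda>\<alpha>\<in>{..<n}. \<Sum>\<beta><n. w (?a, \<alpha>, \<beta>) * rn n v p \<beta>)"
  have updm[measurable (raw)]: "(\<lambda>x. updy n v (p x) (y x)) \<in> measurable N (PS n (Suc v))"
    if "p \<in> measurable N (PS n v)" "y \<in> measurable N ?Y" for p y and N :: "'n measure"
    using that by (rule updy_measurable[OF v])
  have rowm[measurable (raw)]: "(\<lambda>x. row (p x) (w x)) \<in> measurable N ?Y"
    if p: "p \<in> measurable N (PS n v)" and w: "w \<in> measurable N ?B" for p w and N :: "'n measure"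
    unfolding row_def
  proof (intro measurable_restrict borel_measurable_sum borel_measurable_times rn_measurable[OF v p])
    fix \<alpha> \<beta> assume "\<alpha> \<in> {..<n}" "\<beta> \<in> {..<n}"
    then show "(\<lambda>x. w x (?a, \<alpha>, \<beta>)) \<in> borel_measurable N"
      using vD by (intro measurable_compose[OF w] measurable_component_singleton) (auto simp: T_def)
  qed auto
  have "(\<integral>\<^sup>+\<omega>. \<Phi> (past n \<omega> (Suc v)) \<partial>M) = (\<integral>\<^sup>+\<omega>. \<Phi> (updy n v (past n \<omega> v) (row (past n \<omega> v) (xi n \<omega>))) \<partial>M)"
    unfolding row_def by (simp only: past_Suc[OF n v])
  also have "\<dots> = (\<integral>\<^sup>+\<omega>. \<integral>\<^sup>+w. \<Phi> (updy n v (past n \<omega> v) (row (past n \<omega> v) w)) \<partial>?G \<partial>M)"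
  proof (rule resample[OF n, of v "\<lambda>p w. \<Phi> (updy n v p (row p w))"])
    show "row_inv n v (\<lambda>p w. \<Phi> (updy n v p (row p w)))"
      unfolding row_inv_def
    proof (intro ballI impI)
      fix p w w' assume *: "\<forall>a<nA. \<forall>r. (\<forall>i\<in>Gb v. ismm i \<longrightarrow> avar i = a \<longrightarrow> (\<Sum>\<beta><n. r \<beta> * \<phi> i (p \<beta>)) = 0) \<longrightarrow>
     (\<forall>\<alpha><n. (\<Sum>\<beta><n. w (a, \<alpha>, \<beta>) * r \<beta>) = (\<Sum>\<beta><n. w' (a, \<alpha>, \<beta>) * r \<beta>))"
      have "row p w = row p w'"
        unfolding row_def
      proof (rule restrict_ext)
        fix \<alpha> assume "\<alpha> \<in> {..<n}"
        moreover have "\<forall>i\<in>Gb v. ismm i \<longrightarrow> avar i = ?a \<longrightarrow> (\<Sum>\<beta><n. rn n v p \<beta> * \<phi> i (p \<beta>)) = 0"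
          using rn_orthogonal[OF n, of _ v p] by (auto simp: Bv_def)
        ultimately show "(\<Sum>\<beta><n. w (?a, \<alpha>, \<beta>) * rn n v p \<beta>) = (\<Sum>\<beta><n. w' (?a, \<alpha>, \<beta>) * rn n v p \<beta>)"
          using * vD(4) by blast
      qed
      then show "\<Phi> (updy n v p (row p w)) = \<Phi> (updy n v p (row p w'))" by simp
    qed
    show "(\<lambda>x. \<Phi> (updy n v (fst x) (row (fst x) (snd x)))) \<in> borel_measurable (PS n v \<Otimes>\<^sub>M ?B)" by measurable
  qed (use vD in auto)
  also have "\<dots> = (\<integral>\<^sup>+\<omega>. \<integral>\<^sup>+t. \<Phi> (upd n v (past n \<omega> v) t) \<partial>PiM {..<n} (\<lambda>_. std_gauss) \<partial>M)"
  proof (rule nn_integral_cong)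
    fix \<omega>
    let ?p = "past n \<omega> v"
    have "?p \<in> space (PS n v)" by (auto simp: past_def PS_def space_PiM st_def)
    then have [measurable]: "(\<lambda>_. ?p) \<in> measurable N (PS n v)" for N :: "'n measure" by simp
    have "(\<integral>\<^sup>+w. \<Phi> (updy n v ?p (row ?p w)) \<partial>?G) =
      (\<integral>\<^sup>+t. \<integral>\<^sup>+w. \<Phi> (updy n v ?p (\<lambda>\<alpha>\<in>{..<n}. sqrt (\<Sum>\<beta><n. (rn n v ?p \<beta>)\<^sup>2) * t \<alpha>)) \<partial>?G \<partial>PiM {..<n} (\<lambda>_. std_gauss))"
      unfolding row_def
    proof (rule swap_row[where f="\<lambda>y w. \<Phi> (updy n v ?p y)" and r="rn n v ?p", OF vD(4)])
      show "(\<lambda>x. \<Phi> (updy n v ?p (fst x))) \<in> borel_measurable (?Y \<Otimes>\<^sub>M ?B)"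
        by measurable
    qed (rule refl)
    also have "\<dots> = (\<integral>\<^sup>+t. \<Phi> (upd n v ?p t) \<partial>PiM {..<n} (\<lambda>_. std_gauss))"
    proof (rule nn_integral_cong)
      fix t
      have "updy n v ?p (\<lambda>\<alpha>\<in>{..<n}. sqrt (\<Sum>\<beta><n. (rn n v ?p \<beta>)\<^sup>2) * t \<alpha>) = upd n v ?p t"
        unfolding updy_def upd_def rn_norm[OF n, symmetric] by (intro restrict_ext) (simp add: mult.assoc)
      then show "(\<integral>\<^sup>+w. \<Phi> (updy n v ?p (\<lambda>\<alpha>\<in>{..<n}. sqrt (\<Sum>\<beta><n. (rn n v ?p \<beta>)\<^sup>2) * t \<alpha>)) \<partial>?G) = \<Phi> (upd n v ?p t)"
        by (simp add: G.emeasure_space_1[simplified])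
    qed
    finally show "(\<integral>\<^sup>+w. \<Phi> (updy n v ?p (row ?p w)) \<partial>?G) = (\<integral>\<^sup>+t. \<Phi> (upd n v ?p t) \<partial>PiM {..<n} (\<lambda>_. std_gauss))" .
  qed
  finally show ?thesis .
qed

end

section \<open>The limiting Gaussian law\<close>

lemma growth_mono: "finite J \<Longrightarrow> I \<subseteq> J \<Longrightarrow> growth p I z \<le> growth p J z"
  unfolding growth_def by (intro add_left_mono sum_mono2) auto

lemma ctrl_mono:
  assumes f: "ctrl p I f" and J: "finite J" "I \<subseteq> J" and restr: "\<And>z. f (restrict z I) = f z"
  shows "ctrl p J f"
proof -
  obtain K where K: "K \<ge> 0" "\<And>z. z \<in> extensional I \<Longrightarrow> \<bar>f z\<bar> \<le> exp (K * growth p I z)"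
    using f by (metis ctrlE)
  show ?thesis
  proof (rule ctrlI[OF K(1)])
    fix z :: "'a \<Rightarrow> real"
    have "\<bar>f (restrict z I)\<bar> \<le> exp (K * growth p I (restrict z I))" by (rule K(2)) simp
    also have "growth p I (restrict z I) = growth p I z" by (simp add: growth_def)
    also have "exp (K * growth p I z) \<le> exp (K * growth p J z)"
      using growth_mono[OF J] K by (simp add: mult_left_mono)
    finally show "\<bar>f z\<bar> \<le> exp (K * growth p J z)" unfolding restr .
  qed
qed

text \<open>Only countably many tolerances, so that their exceptional null sets can be united in
  \<open>AE_tendsto_0I\<close>.\<close>

lemma averages_tendsto_0:
  fixes Y :: "nat \<Rightarrow> real"
  assumes "\<And>k. \<forall>\<^sub>F n in sequentially. \<bar>Y n\<bar> < 1 / real (Suc k) * real n"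
  shows "(\<lambda>n. Y n / real n) \<longlonglongrightarrow> 0"
proof (rule tendstoI)
  fix e :: real assume "e > 0"
  then obtain k where k: "1 / real (Suc k) < e" using nat_approx_posE by blast
  from assms[of k] eventually_gt_at_top[of 0]
  show "\<forall>\<^sub>F n in sequentially. dist (Y n / real n) 0 < e"
  proof eventually_elim
    case (elim n)
    then have "\<bar>Y n\<bar> / real n < 1 / real (Suc k)" by (simp add: divide_less_eq)
    then show ?case using k by simp
  qed
qed

text \<open>The lower bound 1 on \<open>ex\<close> makes single coordinates controlled;
  \<open>smooth_part\<close> averages squares of sums of them.\<close>

locale netsor_ctrl = netsor +
  fixes ex :: real
  assumes ex: "1 \<le> ex" "ex < 2" and \<phi>_ctrl_self: "\<And>v. ismm v \<Longrightarrow> ctrl ex (Gb v) (\<phi> v)"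
begin

definition "mu = mu_lim m mu_in"
definition "Sg v = Sig ps m mu_in S_in sW2 v"
definition "\<gamma> v = gaussian_vec (Gb v) mu (Sg v)"
text \<open>The deterministic limits of \<open>Qn\<close>, \<open>un\<close> and \<open>tn\<close>,
  see \<open>un_tendsto\<close>.\<close>

definition "Q v i j = (\<integral>z. \<phi> i z * \<phi> j z \<partial>\<gamma> v)"
definition "uL v = resid (Jv v) (Q v) (bs v) v"
definition "tL v = sqrt (bil (Jv v) (Q v) (uL v) (uL v))"

lemma \<phi>_ctrl: "ismm i \<Longrightarrow> Gb i \<subseteq> J \<Longrightarrow> finite J \<Longrightarrow> ctrl ex J (\<phi> i)"
  by (rule ctrl_mono[OF \<phi>_ctrl_self]) (auto intro!: \<phi>_cong)

lemma ex_pos: "0 < ex" using ex by simp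

sublocale \<gamma>: prob_space "\<gamma> v" for v
  unfolding \<gamma>_def by (rule prob_space_gaussian_vec)

lemma sets_\<gamma> [simp, measurable_cong]: "sets (\<gamma> v) = sets (PiM (Gb v) (\<lambda>_. borel))" by (simp add: \<gamma>_def)
lemma space_\<gamma> [simp]: "space (\<gamma> v) = extensional (Gb v)" by (simp add: \<gamma>_def)

lemma integrable_\<gamma>: "ctrl ex (Gb v) f \<Longrightarrow> f \<in> borel_measurable (PiM (Gb v) (\<lambda>_. borel)) \<Longrightarrow> integrable (\<gamma> v) f"
  unfolding \<gamma>_def using ex by (intro integrable_gaussian_vec) auto

lemma \<phi>_Jv:
  assumes "ismm v" "i \<in> Jv v"
  shows "ctrl ex (Gb v) (\<phi> i)" "\<phi> i \<in> borel_measurable (PiM (Gb v) (\<lambda>_. borel))"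
  using Jv_ismm[OF assms] by (auto intro!: \<phi>_ctrl \<phi>_measurable)

lemma bil_Q:
  assumes v: "ismm v"
  shows "bil (Jv v) (Q v) u u = (\<integral>z. (\<Sum>i\<in>Jv v. u i * \<phi> i z)\<^sup>2 \<partial>\<gamma> v)"
proof -
  have int: "integrable (\<gamma> v) (\<lambda>z. u i * (\<phi> i z * \<phi> j z) * u j)" if "i \<in> Jv v" "j \<in> Jv v" for i j
    using \<phi>_Jv[OF v] that
    by (intro integrable_mult_left integrable_mult_right integrable_\<gamma> ctrl_mult borel_measurable_times) auto
  have "(\<integral>z. (\<Sum>i\<in>Jv v. u i * \<phi> i z)\<^sup>2 \<partial>\<gamma> v) = (\<integral>z. (\<Sum>i\<in>Jv v. \<Sum>j\<in>Jv v. u i * (\<phi> i z * \<phi> j z) * u j) \<partial>\<gamma> v)"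
    by (intro Bochner_Integration.integral_cong refl) (simp add: power2_eq_square sum_product mult_ac)
  also have "\<dots> = (\<Sum>i\<in>Jv v. \<integral>z. (\<Sum>j\<in>Jv v. u i * (\<phi> i z * \<phi> j z) * u j) \<partial>\<gamma> v)"
    using int by (intro Bochner_Integration.integral_sum Bochner_Integration.integrable_sum) auto
  also have "\<dots> = (\<Sum>i\<in>Jv v. \<Sum>j\<in>Jv v. \<integral>z. u i * (\<phi> i z * \<phi> j z) * u j \<partial>\<gamma> v)"
    using int by (intro sum.cong refl Bochner_Integration.integral_sum) auto
  also have "\<dots> = bil (Jv v) (Q v) u u" by (simp add: bil_def Q_def)
  finally show ?thesis ..
qed

lemma psd_Q: "ismm v \<Longrightarrow> psd (Jv v) (Q v)"
  unfolding psd_def by (auto simp: bil_Q Q_def mult.commute)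

lemma Sg_Suc_old: "i < v \<Longrightarrow> j < v \<Longrightarrow> Sg (Suc v) i j = Sg v i j"
  by (simp add: Sg_def)

lemma Sg_Suc_new:
  assumes v: "ismm v" and j: "j \<in> Gb (Suc v)"
  shows "Sg (Suc v) v j = (if m \<le> j \<and> avar j = avar v then sW2 (avar v) * Q v v j else 0)"
    and "Sg (Suc v) j v = (if m \<le> j \<and> avar j = avar v then sW2 (avar v) * Q v v j else 0)"
proof -
  note vD = ismmD[OF v]
  have jv: "j \<le> v" using Gb_less[OF j] by simp
  have mm: "ismm j" if "m \<le> j" using j that by (auto simp: Gb_iff)
  show "Sg (Suc v) v j = (if m \<le> j \<and> avar j = avar v then sW2 (avar v) * Q v v j else 0)"
  proof (cases "m \<le> j")
    case True
    show ?thesis using vD(1,3) jv ismmD(1,3)[OF mm[OF True]]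
      by (auto simp: Sg_def Q_def \<phi>_def \<gamma>_def Gb_def mu_def)
  qed (use vD(1) jv in \<open>auto simp: Sg_def\<close>)
  show "Sg (Suc v) j v = (if m \<le> j \<and> avar j = avar v then sW2 (avar v) * Q v v j else 0)"
  proof (cases "m \<le> j")
    case True
    show ?thesis using vD(1,3) jv ismmD(1,3)[OF mm[OF True]]
      by (auto simp: Sg_def Q_def \<phi>_def \<gamma>_def Gb_def mu_def mult.commute)
  qed (use vD(1) jv in \<open>auto simp: Sg_def\<close>)
qed

lemma Sg_input: "v \<le> m \<Longrightarrow> i < v \<Longrightarrow> j < v \<Longrightarrow> Sg v i j = S_in i j"
proof (induction v)
  case (Suc v)
  then show ?case by (cases "i < v \<and> j < v") (auto simp: Sg_def)
qed simp

text \<open>The entries are expressed by the current \<open>Q v\<close>, not by the one of the stage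
  that created them; \<open>\<gamma>_marginal\<close> keeps this true at the next stage.
  Factorability is part of the invariant because the recursion for the covariance does not display
  semidefiniteness.\<close>

definition "cov_ok v \<longleftrightarrow> factorable (Gb v) (Sg v) \<and> (\<forall>i\<in>Gb v. \<forall>j\<in>Gb v. Sg v i j = Sg v j i \<and>
   (m \<le> i \<longrightarrow> j < m \<longrightarrow> Sg v i j = 0) \<and>
   (m \<le> i \<longrightarrow> m \<le> j \<longrightarrow> Sg v i j = (if avar i = avar j then sW2 (avar i) * Q v i j else 0)))"

lemma cov_ok_base: "cov_ok m"
proof -
  have "factorable {..<m} S_in" using cov by (intro factorable_if_psd[of "{..<m}"]) (auto simp: psd_eq_cov_matrix)
  then have "factorable (Gb m) (Sg m)" by (simp add: factorable_def Gb_m Sg_input)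
  moreover have "Sg m i j = Sg m j i" if "i < m" "j < m" for i j
    using that cov by (simp add: Sg_input cov_matrix_def)
  ultimately show ?thesis by (simp add: cov_ok_def Gb_m)
qed

lemma \<gamma>_Suc_not_mm: "m \<le> v \<Longrightarrow> \<not> ismm v \<Longrightarrow> Gb (Suc v) = Gb v \<and> \<gamma> (Suc v) = \<gamma> v"
proof -
  assume "m \<le> v" "\<not> ismm v"
  then have G: "Gb (Suc v) = Gb v" by (simp add: Gb_Suc)
  moreover have "\<gamma> (Suc v) = \<gamma> v"
    unfolding \<gamma>_def G by (rule gaussian_vec_cong) (auto dest!: Gb_less simp: Sg_Suc_old)
  ultimately show ?thesis by simp
qed

lemma sum_Bv_Gb:
  assumes "\<And>i. i \<in> Gb v \<Longrightarrow> i \<notin> Bv v \<Longrightarrow> c i = 0"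
  shows "(\<Sum>i\<in>Gb v. c i * (z i :: real)) = (\<Sum>i\<in>Bv v. c i * z i)"
  using assms Bv_Gb by (intro sum.mono_neutral_right) auto

lemma uL_outside: "i \<in> Gb v \<Longrightarrow> i \<notin> Bv v \<Longrightarrow> uL v i = 0"
  using Gb_less[of i v] by (auto simp: uL_def intro!: resid_support)

text \<open>On the products with the same matrix the covariance is a multiple of the limiting Gram
  matrix of the multiplied vectors, so \<open>psd_row_decomposition\<close> yields the regression
  that \<open>gaussian_vec_insert\<close> asks for. Against variables outside \<open>Bv v\<close>
  both sides of the cross equation vanish.\<close>

lemma \<gamma>_Suc_mm:
  assumes v: "ismm v" and ok: "cov_ok v"
  shows "\<gamma> (Suc v) = distr (\<gamma> v \<Otimes>\<^sub>M std_gauss) (PiM (Gb (Suc v)) (\<lambda>_. borel))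
      (\<lambda>(z, t). z(v := (\<Sum>i\<in>Gb v. - uL v i * z i) + sqrt (sW2 (avar v)) * tL v * t))"
    and "factorable (Gb (Suc v)) (Sg (Suc v))"
proof -
  note vD = ismmD[OF v]
  let ?c = "\<lambda>i. - uL v i" and ?s = "sqrt (sW2 (avar v)) * tL v" and ?S = "Sg (Suc v)"
  have G: "Gb (Suc v) = insert v (Gb v)" using v by (simp add: Gb_Suc)
  have vG: "v \<notin> Gb v" by (auto dest: Gb_less)
  have Sold: "?S i j = Sg v i j" if "i \<in> Gb v" "j \<in> Gb v" for i j
    using that by (auto dest!: Gb_less simp: Sg_Suc_old)
  have pos: "sW2 (avar v) > 0" using sW2_pos vD by simp
  have BB: "?S i j = sW2 (avar v) * Q v i j" if "i \<in> Bv v" "j \<in> Bv v" for i j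
  proof -
    have "i \<in> Gb v" "j \<in> Gb v" "m \<le> i" "m \<le> j" "avar i = avar v" "avar j = avar v"
      using that by (auto simp: Bv_def dest: ismmD)
    then show ?thesis using ok Sold by (simp add: cov_ok_def)
  qed
  have rows: "Q v v j = (\<Sum>i\<in>Bv v. ?c i * Q v i j)" if "j \<in> Bv v" for j
    using psd_row_decomposition(1)[OF psd_Q[OF v], of "bs v" v ?c j] that by (auto simp: Jv_def uL_def)
  have diagQ: "Q v v v = (\<Sum>i\<in>Bv v. \<Sum>j\<in>Bv v. ?c i * Q v i j * ?c j) + (tL v)\<^sup>2"
    using psd_row_decomposition(2)[OF psd_Q[OF v], of "bs v" v ?c] psd_Q[OF v]
    by (simp add: Jv_def uL_def tL_def psd_def subset_insertI)
  have sumG: "(\<Sum>i\<in>Gb v. ?c i * z i) = (\<Sum>i\<in>Bv v. ?c i * z i)" for z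
    using uL_outside by (intro sum_Bv_Gb) auto
  have cross: "?S v j = (\<Sum>i\<in>Gb v. ?c i * ?S i j)" if j: "j \<in> Gb v" for j
  proof (cases "j \<in> Bv v")
    case True
    have "?S v j = sW2 (avar v) * Q v v j"
      using Sg_Suc_new(1)[OF v, of j] True G by (auto simp: Bv_def dest: ismmD)
    also have "\<dots> = (\<Sum>i\<in>Bv v. ?c i * ?S i j)"
      unfolding rows[OF True] using True by (simp add: sum_distrib_left BB mult.left_commute)
    finally show ?thesis unfolding sumG .
  next
    case False
    have "?S v j = 0"
      using Sg_Suc_new(1)[OF v, of j] False j G by (auto simp: Bv_def Gb_iff)
    moreover have "?S i j = 0" if "i \<in> Bv v" for i
    proof -
      have i: "i \<in> Gb v" "m \<le> i" "avar i = avar v" using that by (auto simp: Bv_def dest: ismmD)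
      have "j < m \<or> (m \<le> j \<and> avar j \<noteq> avar v)" using False j by (auto simp: Bv_def Gb_iff)
      then show ?thesis using ok i j Sold[OF i(1) j] by (auto simp: cov_ok_def)
    qed
    ultimately show ?thesis unfolding sumG by simp
  qed
  have sym: "?S j v = ?S v j" if "j \<in> Gb v" for j
    using Sg_Suc_new[OF v, of j] that G by simp
  have diag: "?S v v = (\<Sum>i\<in>Gb v. \<Sum>j\<in>Gb v. ?c i * ?S i j * ?c j) + ?s\<^sup>2"
  proof -
    have "(\<Sum>i\<in>Gb v. \<Sum>j\<in>Gb v. ?c i * ?S i j * ?c j) = (\<Sum>i\<in>Gb v. ?c i * (\<Sum>j\<in>Gb v. ?c j * ?S i j))"
      by (simp add: sum_distrib_left mult_ac)
    also have "\<dots> = (\<Sum>i\<in>Bv v. ?c i * (\<Sum>j\<in>Bv v. ?c j * ?S i j))" unfolding sumG ..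
    also have "\<dots> = sW2 (avar v) * (\<Sum>i\<in>Bv v. \<Sum>j\<in>Bv v. ?c i * Q v i j * ?c j)"
      by (simp add: sum_distrib_left BB mult_ac)
    finally show ?thesis
      using Sg_Suc_new(1)[OF v, of v] vD(1) G pos
      by (simp add: diagQ power_mult_distrib distrib_left)
  qed
  have muz: "mu v = (\<Sum>i\<in>Gb v. ?c i * mu i)"
  proof -
    have "mu i = 0" if "i \<in> Bv v" for i
      using that ismmD(1)[of i] by (auto simp: mu_def mu_lim_def Bv_def)
    then show ?thesis unfolding sumG using vD(1) by (simp add: mu_def mu_lim_def)
  qed
  have fac: "factorable (Gb v) ?S" using ok Sold by (simp add: cov_ok_def factorable_def)
  have gv: "gaussian_vec (Gb v) mu ?S = \<gamma> v" unfolding \<gamma>_def by (rule gaussian_vec_cong) (auto simp: Sold)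
  show "\<gamma> (Suc v) = distr (\<gamma> v \<Otimes>\<^sub>M std_gauss) (PiM (Gb (Suc v)) (\<lambda>_. borel))
      (\<lambda>(z, t). z(v := (\<Sum>i\<in>Gb v. - uL v i * z i) + sqrt (sW2 (avar v)) * tL v * t))"
    using gaussian_vec_insert(1)[OF finite_Gb vG fac cross sym diag muz] unfolding gv G \<gamma>_def[of "Suc v"] .
  show "factorable (Gb (Suc v)) (Sg (Suc v))"
    using gaussian_vec_insert(2)[OF finite_Gb vG fac cross sym diag muz] unfolding G .
qed

lemma Y_measurable:
  fixes c :: "'n \<Rightarrow> nat \<Rightarrow> real"
  assumes v: "ismm v" and z: "f \<in> measurable N (PiM (Gb v) (\<lambda>_. borel))"
    and c: "\<And>i. (\<lambda>x. c x i) \<in> borel_measurable N" and s: "s \<in> borel_measurable N" "t \<in> borel_measurable N"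
  shows "(\<lambda>x. (f x)(v := (\<Sum>i\<in>Gb v. c x i * f x i) + s x * t x)) \<in> measurable N (PiM (Gb (Suc v)) (\<lambda>_. borel))"
proof (rule measurable_fun_upd[where J="Gb v"])
  show "Gb (Suc v) = Gb v \<union> {v}" using v by (simp add: Gb_Suc)
  show "(\<lambda>x. (\<Sum>i\<in>Gb v. c x i * f x i) + s x * t x) \<in> borel_measurable N"
  proof (intro borel_measurable_add borel_measurable_sum borel_measurable_times c s)
    fix i assume "i \<in> Gb v"
    then show "(\<lambda>x. f x i) \<in> borel_measurable N"
      by (intro measurable_compose[OF z] measurable_component_singleton)
  qed
qed (rule z)

text \<open>Consistency of the limiting laws along the program. By \<open>restr\<close> the function
  ignores the new variable, so the same expression can be integrated under both laws.\<close>

lemma \<gamma>_marginal: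
  assumes v: "ismm v" and ok: "cov_ok v" and f: "f \<in> borel_measurable (PiM (Gb v) (\<lambda>_. borel))"
    and restr: "\<And>z. f (restrict z (Gb v)) = f z"
  shows "(\<integral>z. f z \<partial>\<gamma> (Suc v)) = (\<integral>z. (f z :: real) \<partial>\<gamma> v)"
proof -
  let ?Y = "\<lambda>(z, t). z(v := (\<Sum>i\<in>Gb v. - uL v i * z i) + sqrt (sW2 (avar v)) * tL v * t)"
  let ?B = "PiM (Gb (Suc v)) (\<lambda>_. borel :: real measure)"
  have vG: "v \<notin> Gb v" by (auto dest: Gb_less)
  have Y: "?Y \<in> measurable (\<gamma> v \<Otimes>\<^sub>M std_gauss) ?B"
    unfolding case_prod_beta by (rule Y_measurable[OF v]) auto
  have r: "(\<lambda>z. restrict z (Gb v)) \<in> measurable ?B (PiM (Gb v) (\<lambda>_. borel))"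
    by (rule measurable_restrict_subset) (use Gb_mono[of v "Suc v"] in auto)
  have fB: "f \<in> borel_measurable ?B"
    using measurable_compose[OF r f] by (simp add: restr)
  have "(\<integral>z. f z \<partial>\<gamma> (Suc v)) = (\<integral>x. f (?Y x) \<partial>(\<gamma> v \<Otimes>\<^sub>M std_gauss))"
    unfolding \<gamma>_Suc_mm(1)[OF v ok] by (rule integral_distr[OF Y fB])
  also have "\<dots> = (\<integral>x. f (fst x) \<partial>(\<gamma> v \<Otimes>\<^sub>M std_gauss))"
  proof (rule Bochner_Integration.integral_cong[OF refl])
    fix x :: "(nat \<Rightarrow> real) \<times> real"
    have "restrict (?Y x) (Gb v) = restrict (fst x) (Gb v)"
      using vG by (auto simp: case_prod_beta fun_eq_iff restrict_def)
    then have "f (restrict (?Y x) (Gb v)) = f (restrict (fst x) (Gb v))" by (rule arg_cong)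
    then show "f (?Y x) = f (fst x)" by (simp only: restr)
  qed
  also have "\<dots> = (\<integral>z. f z \<partial>distr (\<gamma> v \<Otimes>\<^sub>M std_gauss) (\<gamma> v) fst)"
    using f by (intro integral_distr[symmetric]) auto
  also have "\<dots> = (\<integral>z. f z \<partial>\<gamma> v)" by (simp only: std_gauss.distr_pair_fst)
  finally show ?thesis .
qed

lemma cov_ok_Suc_mm:
  assumes v: "ismm v" and ok: "cov_ok v"
  shows "cov_ok (Suc v)"
proof -
  note vD = ismmD[OF v]
  have G: "Gb (Suc v) = insert v (Gb v)" using v by (simp add: Gb_Suc)
  have Qm: "Q (Suc v) i j = Q v i j" if "i \<in> Gb (Suc v)" "j \<in> Gb (Suc v)" "m \<le> i" "m \<le> j" for i j
  proof -
    have mm: "ismm i" "ismm j" "i \<le> v" "j \<le> v" using that by (auto simp: Gb_iff)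
    then have sub: "Gb i \<subseteq> Gb v" "Gb j \<subseteq> Gb v" using Gb_mono by auto
    show ?thesis unfolding Q_def
    proof (rule \<gamma>_marginal[OF v ok])
      show "(\<lambda>z. \<phi> i z * \<phi> j z) \<in> borel_measurable (PiM (Gb v) (\<lambda>_. borel))"
        using mm sub by (intro borel_measurable_times \<phi>_measurable) auto
      fix z
      have "\<phi> i (restrict z (Gb v)) = \<phi> i z" "\<phi> j (restrict z (Gb v)) = \<phi> j z"
        using sub by (auto intro!: \<phi>_cong mm)
      then show "\<phi> i (restrict z (Gb v)) * \<phi> j (restrict z (Gb v)) = \<phi> i z * \<phi> j z" by simp
    qed
  qed
  have Qc: "Q v i j = Q v j i" for i j by (simp add: Q_def mult.commute)
  show ?thesis
    unfolding cov_ok_def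
  proof (intro conjI ballI \<gamma>_Suc_mm(2)[OF v ok] impI)
    fix i j assume ij: "i \<in> Gb (Suc v)" "j \<in> Gb (Suc v)"
    consider "i = v" | "j = v" | "i \<in> Gb v" "j \<in> Gb v" using ij G by auto
    note cs = this
    show "Sg (Suc v) i j = Sg (Suc v) j i"
      using cs
    proof cases
      case 3
      then have "i < v" "j < v" by (auto dest: Gb_less)
      moreover have "Sg v i j = Sg v j i" using ok 3 by (simp add: cov_ok_def)
      ultimately show ?thesis by (simp add: Sg_Suc_old)
    qed (use Sg_Suc_new[OF v] ij in auto)
    show "Sg (Suc v) i j = 0" if "m \<le> i" "j < m"
      using cs
    proof cases
      case 3
      then have "i < v" "j < v" by (auto dest: Gb_less)
      moreover have "Sg v i j = 0" using ok 3 that by (simp add: cov_ok_def)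
      ultimately show ?thesis by (simp add: Sg_Suc_old)
    qed (use Sg_Suc_new[OF v] ij that vD(1) in auto)
    show "Sg (Suc v) i j = (if avar i = avar j then sW2 (avar i) * Q (Suc v) i j else 0)" if "m \<le> i" "m \<le> j"
      using cs
    proof cases
      case 1 then show ?thesis using Sg_Suc_new(1)[OF v ij(2)] that Qm[OF ij that] by auto
    next
      case 2 then show ?thesis using Sg_Suc_new(2)[OF v ij(1)] that Qm[OF ij that] Qc by auto
    next
      case 3
      then have "i < v" "j < v" by (auto dest: Gb_less)
      then show ?thesis using ok 3 that Qm[OF ij that] by (simp add: cov_ok_def Sg_Suc_old)
    qed
  qed
qed

lemma cov_ok: "m \<le> v \<Longrightarrow> v \<le> nv \<Longrightarrow> cov_ok v"
proof (induction v rule: dec_induct)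
  case base show ?case by (rule cov_ok_base)
next
  case (step v)
  then have ok: "cov_ok v" by simp
  show ?case
  proof (cases "ismm v")
    case False
    then have G: "Gb (Suc v) = Gb v" and g: "\<gamma> (Suc v) = \<gamma> v" using \<gamma>_Suc_not_mm step by auto
    have S: "Sg (Suc v) i j = Sg v i j" if "i \<in> Gb v" "j \<in> Gb v" for i j
      using that by (auto dest!: Gb_less simp: Sg_Suc_old)
    show ?thesis using ok by (auto simp: cov_ok_def G g Q_def S factorable_def)
  qed (use cov_ok_Suc_mm ok in blast)
qed

text \<open>The exceptional null set may depend on \<open>\<psi>\<close>; each step of the induction
  uses finitely many functions.\<close>

definition "lln v \<longleftrightarrow> (\<forall>\<psi>. ctrl ex (Gb v) \<psi> \<longrightarrow> \<psi> \<in> borel_measurable (PiM (Gb v) (\<lambda>_. borel)) \<longrightarrow>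
   (AE \<omega> in M. (\<lambda>n. (\<Sum>\<alpha><n. \<psi> (st n \<omega> v \<alpha>)) / real n) \<longlonglongrightarrow> (\<integral>z. \<psi> z \<partial>\<gamma> v)))"

text \<open>All coordinates at once: a single exceptional coordinate would spoil an exact linear
  relation, although no average would notice it. \<open>P\<close> may be any predicate, since its
  exceptional set lies in a measurable null set.\<close>

definition "rank_stable v \<longleftrightarrow> (\<forall>P. (AE z in \<gamma> v. P z) \<longrightarrow> (AE \<omega> in M. \<forall>\<^sub>F n in sequentially. \<forall>\<alpha><n. P (st n \<omega> v \<alpha>)))"

lemma \<gamma>_m: "\<gamma> m = gaussian_vec {..<m} mu_in S_in"
  unfolding \<gamma>_def Gb_m[OF order_refl] by (rule gaussian_vec_cong) (auto simp: Sg_input mu_def mu_lim_def)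

lemma AE_tendsto_0I:
  assumes "\<And>e. e > 0 \<Longrightarrow> AE \<omega> in M. \<forall>\<^sub>F n in sequentially. \<bar>Y n \<omega>\<bar> < e * real n"
  shows "AE \<omega> in M. (\<lambda>n. Y n \<omega> / real n) \<longlonglongrightarrow> 0"
proof -
  have "AE \<omega> in M. \<forall>k. \<forall>\<^sub>F n in sequentially. \<bar>Y n \<omega>\<bar> < 1 / real (Suc k) * real n"
    by (subst AE_all_countable, intro allI assms) simp
  then show ?thesis by eventually_elim (intro averages_tendsto_0, blast)
qed

text \<open>For each \<open>n\<close> the input profiles are independent with law
  \<open>\<gamma> m\<close>, but nothing links different \<open>n\<close>; hence the tail bound with
  Borel-Cantelli.\<close>

lemma lln_base: "lln m"
  unfolding lln_def
proof (intro allI impI)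
  fix \<psi> assume c: "ctrl ex (Gb m) \<psi>" and [measurable]: "\<psi> \<in> borel_measurable (PiM (Gb m) (\<lambda>_. borel))"
  let ?I = "\<integral>z. \<psi> z \<partial>\<gamma> m"
  define C where "C = (\<integral>z. \<psi> z ^ 4 \<partial>\<gamma> m)"
  have int4: "integrable (\<gamma> m) (\<lambda>z. \<psi> z ^ 4)" using c by (intro integrable_\<gamma> ctrl_power) auto
  have "AE \<omega> in M. (\<lambda>n. (\<Sum>\<alpha><n. \<psi> (st n \<omega> m \<alpha>) - ?I) / real n) \<longlonglongrightarrow> 0"
  proof (rule AE_tendsto_0I)
    fix e :: real assume e: "e > 0"
    define A where "A = (\<lambda>n. {\<omega> \<in> space M. e * real n \<le> \<bar>\<Sum>\<alpha><n. \<psi> (st n \<omega> m \<alpha>) - ?I\<bar>})"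
    have "AE \<omega> in M. \<forall>\<^sub>F n in sequentially. \<omega> \<notin> A n"
    proof (rule AE_eventually_notin)
      fix n :: nat assume n: "n \<ge> 1"
      have st[measurable]: "(\<lambda>\<omega>. st n \<omega> m \<alpha>) \<in> measurable M (PiM (Gb m) (\<lambda>_. borel))" if "\<alpha> < n" for \<alpha>
        using that n by (intro st_measurable) (auto simp: nv_def)
      have past[measurable]: "(\<lambda>\<omega>. past n \<omega> m) \<in> measurable M (PS n m)"
        using n by (intro past_measurable) (auto simp: nv_def)
      show "A n \<in> events" unfolding A_def by measurable
      let ?P = "PiM {..<n} (\<lambda>_. \<gamma> m)"
      have PS: "sets ?P = sets (PS n m)" unfolding PS_def by (rule sets_PiM_cong) auto
      then have sp: "space ?P = space (PS n m)" by (rule sets_eq_imp_space_eq)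
      define E where "E = {x \<in> space ?P. e * real n \<le> \<bar>\<Sum>i<n. \<psi> (x i) - ?I\<bar>}"
      have E: "E \<in> sets (PS n m)" unfolding E_def sp
        unfolding PS_def by measurable
      have "prob (A n) = measure (distr M (PS n m) (\<lambda>\<omega>. past n \<omega> m)) E"
      proof (subst measure_distr[OF past E], rule arg_cong[where f=prob])
        show "A n = (\<lambda>\<omega>. past n \<omega> m) -` E \<inter> space M"
          using measurable_space[OF past] by (auto simp: A_def E_def sp past_def)
      qed
      also have "\<dots> = measure ?P E" unfolding distr_past_input[OF n] \<gamma>_m ..
      also have "\<dots> \<le> 48 * C / (e ^ 4 * (real n)\<^sup>2)"
        unfolding E_def
        by (rule \<gamma>.PiM_coordinates_tail[of n "\<lambda>_. \<psi>"]) (use int4 e n in \<open>auto simp: C_def\<close>)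
      finally show "prob (A n) \<le> (48 * C / e ^ 4) / (real n)\<^sup>2" by simp
    qed
    moreover have "AE \<omega> in M. \<omega> \<in> space M" by simp
    ultimately show "AE \<omega> in M. \<forall>\<^sub>F n in sequentially. \<bar>\<Sum>\<alpha><n. \<psi> (st n \<omega> m \<alpha>) - ?I\<bar> < e * real n"
      by eventually_elim (auto simp: A_def not_le elim!: eventually_mono)
  qed
  then show "AE \<omega> in M. (\<lambda>n. (\<Sum>\<alpha><n. \<psi> (st n \<omega> m \<alpha>)) / real n) \<longlonglongrightarrow> ?I"
  proof eventually_elim
    case (elim \<omega>)
    then have "(\<lambda>n. (\<Sum>\<alpha><n. \<psi> (st n \<omega> m \<alpha>) - ?I) / real n + ?I) \<longlonglongrightarrow> 0 + ?I"
      by (intro tendsto_add tendsto_const)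
    moreover have "\<forall>\<^sub>F n in sequentially. (\<Sum>\<alpha><n. \<psi> (st n \<omega> m \<alpha>) - ?I) / real n + ?I = (\<Sum>\<alpha><n. \<psi> (st n \<omega> m \<alpha>)) / real n"
      using eventually_gt_at_top[of 0] by eventually_elim (simp add: sum_subtractf diff_divide_distrib)
    ultimately show ?case by (simp add: tendsto_cong)
  qed
qed

text \<open>Every input profile has law \<open>\<gamma> m\<close> exactly, and there are countably
  many pairs of \<open>n\<close> and \<open>\<alpha>\<close>.\<close>

lemma rank_stable_base: "rank_stable m"
  unfolding rank_stable_def
proof (intro allI impI)
  fix P assume P: "AE z in \<gamma> m. P z"
  have "AE \<omega> in M. P (st n \<omega> m \<alpha>)" if "n \<ge> 1" "\<alpha> < n" for n \<alpha>
  proof -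
    have d: "distr M (PiM {..<m} (\<lambda>_. borel)) (\<lambda>\<omega>. st n \<omega> m \<alpha>) = \<gamma> m"
      using smp[OF that(1)] that(2) unfolding \<gamma>_m st_input by (auto simp: sampled_def)
    have "(\<lambda>\<omega>. st n \<omega> m \<alpha>) \<in> measurable M (PiM {..<m} (\<lambda>_. borel))"
      unfolding st_input using X_measurable that by blast
    then show ?thesis using P unfolding d[symmetric] by (rule AE_distrD)
  qed
  then have "AE \<omega> in M. \<forall>n \<alpha>. \<alpha> < n \<longrightarrow> P (st n \<omega> m \<alpha>)"
    by (subst AE_all_countable, intro allI, subst AE_all_countable, intro allI) (case_tac "i < n"; auto)
  then show "AE \<omega> in M. \<forall>\<^sub>F n in sequentially. \<forall>\<alpha><n. P (st n \<omega> m \<alpha>)"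
    by eventually_elim simp
qed

end

section \<open>Rank stability\<close>

context netsor_ctrl
begin

definition "ext v z c s t = z(v := (\<Sum>i\<in>Gb v. c i * z i) + s * (t :: real))"
definition "sg v = sqrt (sW2 (avar v))"
text \<open>The conditional mean of \<open>\<psi>\<close> after the step. Coefficients and noise
  level stay arguments, so that random and limiting values can be compared.\<close>

definition "Psi v \<psi> z c s = (\<integral>t. \<psi> (ext v z c s t) \<partial>std_gauss)" for \<psi> :: "(nat \<Rightarrow> real) \<Rightarrow> real"

lemma un_outside: "i \<in> Gb v \<Longrightarrow> i \<notin> Bv v \<Longrightarrow> un n v p i = 0"
  using Gb_less[of i v] by (auto simp: un_def intro!: resid_support)

lemma upd_eq: "\<alpha> < n \<Longrightarrow> upd n v p t \<alpha> = ext v (p \<alpha>) (\<lambda>i. - un n v p i) (sg v * tn n v p) (t \<alpha>)"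
  unfolding upd_def ext_def sg_def
  by (subst sum_Bv_Gb) (simp_all add: un_outside)

lemma sg_pos: "ismm v \<Longrightarrow> sg v > 0"
  using sW2_pos ismmD(4) by (simp add: sg_def)

lemma past_space: "past n \<omega> v \<in> space (PS n v)"
  by (auto simp: past_def PS_def space_PiM st_def)

lemma st_extensional: "st n \<omega> v \<alpha> \<in> extensional (Gb v)"
  by (simp add: st_def)

lemma past_nth: "\<alpha> < n \<Longrightarrow> past n \<omega> v \<alpha> = st n \<omega> v \<alpha>"
  by (simp add: past_def)

lemma ext_measurable:
  fixes c :: "'n \<Rightarrow> nat \<Rightarrow> real"
  assumes "ismm v" "f \<in> measurable N (PiM (Gb v) (\<lambda>_. borel))"
    "\<And>i. (\<lambda>x. c x i) \<in> borel_measurable N" "s \<in> borel_measurable N" "t \<in> borel_measurable N"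
  shows "(\<lambda>x. ext v (f x) (c x) (s x) (t x)) \<in> measurable N (PiM (Gb (Suc v)) (\<lambda>_. borel))"
  unfolding ext_def using assms by (rule Y_measurable)

lemma Psi_measurable:
  fixes c :: "'n \<Rightarrow> nat \<Rightarrow> real"
  assumes v: "ismm v" and f: "f \<in> measurable N (PiM (Gb v) (\<lambda>_. borel))"
    and c: "\<And>i. (\<lambda>x. c x i) \<in> borel_measurable N" and s: "s \<in> borel_measurable N"
    and \<psi>: "\<psi> \<in> borel_measurable (PiM (Gb (Suc v)) (\<lambda>_. borel))"
  shows "(\<lambda>x. Psi v \<psi> (f x) (c x) (s x)) \<in> borel_measurable N"
proof -
  note [measurable] = f c s \<psi>
  have "(\<lambda>x. ext v (f (fst x)) (c (fst x)) (s (fst x)) (snd x)) \<in> measurable (N \<Otimes>\<^sub>M std_gauss) (PiM (Gb (Suc v)) (\<lambda>_. borel))"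
    by (rule ext_measurable[OF v]) measurable
  from measurable_compose[OF this \<psi>]
  have "(\<lambda>(x, t). \<psi> (ext v (f x) (c x) (s x) t)) \<in> borel_measurable (N \<Otimes>\<^sub>M std_gauss)"
    by (simp add: case_prod_beta)
  then show ?thesis unfolding Psi_def by (rule std_gauss.borel_measurable_lebesgue_integral)
qed

lemma growth_measurable: "growth ex (Gb v) \<in> borel_measurable (PiM (Gb v) (\<lambda>_. borel))"
  unfolding growth_def[abs_def] by measurable

text \<open>One \<open>K\<close> for all coefficients below \<open>B\<close> and all powers:
  \<open>k = 4\<close> serves the fluctuations, \<open>k = 1\<close> and \<open>k = 2\<close> the
  change of coefficients. The factor in \<open>z\<close> is the envelope whose averages converge by
  induction.\<close>

lemma ext_bounds:
  assumes v: "ismm v" and B: "B \<ge> 0" and c\<psi>: "ctrl ex (Gb (Suc v)) \<psi>"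
    and \<psi>: "\<psi> \<in> borel_measurable (PiM (Gb (Suc v)) (\<lambda>_. borel))"
  obtains K where "K \<ge> 0"
    "\<And>z c s k. z \<in> extensional (Gb v) \<Longrightarrow> (\<And>i. i \<in> Gb v \<Longrightarrow> \<bar>c i\<bar> \<le> B) \<Longrightarrow> \<bar>s\<bar> \<le> B \<Longrightarrow>
      integrable std_gauss (\<lambda>t. \<psi> (ext v z c s t) ^ k) \<and>
      (\<integral>t. \<bar>\<psi> (ext v z c s t) ^ k\<bar> \<partial>std_gauss) \<le>
        exp (real k * K * growth ex (Gb v) z) * (\<integral>t. exp (real k * K * \<bar>t\<bar> powr ex) \<partial>std_gauss)"
proof -
  have G: "Gb (Suc v) = insert v (Gb v)" using v by (simp add: Gb_Suc)
  have vG: "v \<notin> Gb v" by (auto dest: Gb_less)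
  obtain K where K: "K \<ge> 0" "\<forall>z c s t. z \<in> extensional (Gb v) \<longrightarrow> (\<forall>i\<in>Gb v. \<bar>c i\<bar> \<le> B) \<longrightarrow> \<bar>s\<bar> \<le> B \<longrightarrow>
       \<bar>\<psi> (z(v := (\<Sum>i\<in>Gb v. c i * z i) + s * t))\<bar> \<le> exp (K * growth ex (Gb v) z) * exp (K * \<bar>t\<bar> powr ex)"
      using ctrl_update_bound[OF finite_Gb vG ex_pos ex(2) B c\<psi>[unfolded G]] by blast
  show thesis
  proof (rule that[OF K(1)])
    fix z c :: "nat \<Rightarrow> real" and s :: real and k :: nat
    assume z: "z \<in> extensional (Gb v)" and c: "\<And>i. i \<in> Gb v \<Longrightarrow> \<bar>c i\<bar> \<le> B" and s: "\<bar>s\<bar> \<le> B"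
    let ?b = "\<lambda>t. exp (real k * K * growth ex (Gb v) z) * exp (real k * K * \<bar>t\<bar> powr ex)"
    have bi: "integrable std_gauss ?b"
      by (intro integrable_mult_right integrable_std_gauss_exp_powr ex_pos ex)
    have le: "\<bar>\<psi> (ext v z c s t) ^ k\<bar> \<le> ?b t" for t
    proof -
      have "\<bar>\<psi> (ext v z c s t)\<bar> ^ k \<le> (exp (K * growth ex (Gb v) z) * exp (K * \<bar>t\<bar> powr ex)) ^ k"
        using K(2) z c s by (intro power_mono) (auto simp: ext_def)
      also have "\<dots> = ?b t"
        by (simp add: power_mult_distrib exp_of_nat_mult[symmetric] mult.assoc)
      finally show ?thesis by (simp add: power_abs)
    qed
    have zs: "z \<in> space (PiM (Gb v) (\<lambda>_. borel))" using z by simp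
    have "(\<lambda>t. ext v z c s t) \<in> measurable borel (PiM (Gb (Suc v)) (\<lambda>_. borel))"
      using zs by (intro ext_measurable[OF v]) auto
    then have m: "(\<lambda>t. \<psi> (ext v z c s t) ^ k) \<in> borel_measurable std_gauss"
      using \<psi> by (intro borel_measurable_power) (simp add: measurable_compose)
    have i: "integrable std_gauss (\<lambda>t. \<psi> (ext v z c s t) ^ k)"
      by (rule Bochner_Integration.integrable_bound[OF bi m]) (use le in \<open>auto intro!: AE_I2\<close>)
    have "(\<integral>t. \<bar>\<psi> (ext v z c s t) ^ k\<bar> \<partial>std_gauss) \<le> (\<integral>t. ?b t \<partial>std_gauss)"
      using i bi le by (intro integral_mono integrable_abs) auto
    then show "integrable std_gauss (\<lambda>t. \<psi> (ext v z c s t) ^ k) \<and>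
      (\<integral>t. \<bar>\<psi> (ext v z c s t) ^ k\<bar> \<partial>std_gauss) \<le>
        exp (real k * K * growth ex (Gb v) z) * (\<integral>t. exp (real k * K * \<bar>t\<bar> powr ex) \<partial>std_gauss)"
      using i by simp
  qed
qed

lemma \<gamma>_Suc_ext:
  assumes v: "ismm v"
  shows "\<gamma> (Suc v) = distr (\<gamma> v \<Otimes>\<^sub>M std_gauss) (PiM (Gb (Suc v)) (\<lambda>_. borel))
      (\<lambda>x. ext v (fst x) (\<lambda>i. - uL v i) (sg v * tL v) (snd x))"
proof -
  have "cov_ok v" using ismmD[OF v] by (intro cov_ok) auto
  then show ?thesis using \<gamma>_Suc_mm(1)[OF v] unfolding ext_def sg_def case_prod_beta' by simp
qed

lemma ext_pair_measurable:
  "ismm v \<Longrightarrow> (\<lambda>x. ext v (fst x) (\<lambda>i. - uL v i) s (snd x)) \<in> measurable (\<gamma> v \<Otimes>\<^sub>M std_gauss) (PiM (Gb (Suc v)) (\<lambda>_. borel))"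
  by (rule ext_measurable) auto

text \<open>A null direction of the limiting Gram matrix is an almost sure linear relation, which is
  the form that \<open>rank_stable\<close> can use.\<close>

lemma bil_zero_AE:
  assumes v: "ismm v" and b: "bil (Jv v) (Q v) u u = 0"
  shows "AE z in \<gamma> v. (\<Sum>i\<in>Jv v. u i * \<phi> i z) = 0"
proof -
  have "integrable (\<gamma> v) (\<lambda>z. (\<Sum>i\<in>Jv v. u i * \<phi> i z)\<^sup>2)"
    using \<phi>_Jv[OF v]
    by (intro integrable_\<gamma> ctrl_power ctrl_sum ctrl_mult ctrl_const borel_measurable_power borel_measurable_sum borel_measurable_times) auto
  from integral_nonneg_eq_0_iff_AE[OF this] b
  have "AE z in \<gamma> v. (\<Sum>i\<in>Jv v. u i * \<phi> i z)\<^sup>2 = 0" by (simp add: bil_Q[OF v])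
  then show ?thesis by eventually_elim simp
qed

lemma un_tendsto:
  assumes v: "ismm v" and lln: "lln v" and rs: "rank_stable v"
  shows "AE \<omega> in M. (\<forall>i. (\<lambda>n. un n v (past n \<omega> v) i) \<longlonglongrightarrow> uL v i) \<and> (\<lambda>n. tn n v (past n \<omega> v)) \<longlonglongrightarrow> tL v"
proof -
  let ?J = "Jv v"
  have 1: "AE \<omega> in M. \<forall>i\<in>?J. \<forall>j\<in>?J. (\<lambda>n. Qn n v (past n \<omega> v) i j) \<longlonglongrightarrow> Q v i j"
  proof (intro AE_finite_allI finite_Jv)
    fix i j assume ij: "i \<in> ?J" "j \<in> ?J"
    have "AE \<omega> in M. (\<lambda>n. (\<Sum>\<alpha><n. \<phi> i (st n \<omega> v \<alpha>) * \<phi> j (st n \<omega> v \<alpha>)) / real n) \<longlonglongrightarrow> Q v i j"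
      unfolding Q_def using lln \<phi>_Jv[OF v] ij unfolding lln_def
      by (auto intro!: ctrl_mult borel_measurable_times)
    moreover have "Qn n v (past n \<omega> v) i j = (\<Sum>\<alpha><n. \<phi> i (st n \<omega> v \<alpha>) * \<phi> j (st n \<omega> v \<alpha>)) / real n" for n \<omega>
      by (simp add: Qn_def past_nth sum_divide_distrib)
    ultimately show "AE \<omega> in M. (\<lambda>n. Qn n v (past n \<omega> v) i j) \<longlonglongrightarrow> Q v i j" by simp
  qed
  \<comment> \<open>The limiting residuals have deterministic coefficients and there are countably
    many lists, so rank stability applies to all vanishing pivots outside one null set.\<close>
  have 2: "AE \<omega> in M. \<forall>b bs. bil ?J (Q v) (resid ?J (Q v) bs b) (resid ?J (Q v) bs b) = 0 \<longrightarrow>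
      (\<forall>\<^sub>F n in sequentially. bil ?J (Qn n v (past n \<omega> v)) (resid ?J (Q v) bs b) (resid ?J (Q v) bs b) = 0)"
  proof (subst AE_all_countable, intro allI, subst AE_all_countable, intro allI)
    fix b bs
    let ?u = "resid ?J (Q v) bs b"
    show "AE \<omega> in M. bil ?J (Q v) ?u ?u = 0 \<longrightarrow> (\<forall>\<^sub>F n in sequentially. bil ?J (Qn n v (past n \<omega> v)) ?u ?u = 0)"
    proof (cases "bil ?J (Q v) ?u ?u = 0")
      case True
      from rs[unfolded rank_stable_def, rule_format, OF bil_zero_AE[OF v True]]
      have "AE \<omega> in M. \<forall>\<^sub>F n in sequentially. \<forall>\<alpha><n. (\<Sum>i\<in>?J. ?u i * \<phi> i (st n \<omega> v \<alpha>)) = 0" .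
      then show ?thesis
      proof eventually_elim
        case (elim \<omega>)
        then have "\<forall>\<^sub>F n in sequentially. bil ?J (Qn n v (past n \<omega> v)) ?u ?u = 0"
          by eventually_elim (simp add: bil_Qn past_nth)
        then show ?case by simp
      qed
    qed simp
  qed
  from 1 2 show ?thesis
  proof eventually_elim
    case (elim \<omega>)
    have u: "(\<lambda>n. un n v (past n \<omega> v) i) \<longlonglongrightarrow> uL v i" for i
      unfolding un_def uL_def
    proof (rule resid_tendsto[OF psd_Q[OF v] psd_Qn])
      show "set (bs v) \<subseteq> ?J" "distinct (bs v)" "v \<in> ?J" by (auto simp: Jv_def)
    qed (use elim in auto)
    moreover have "(\<lambda>n. tn n v (past n \<omega> v)) \<longlonglongrightarrow> tL v"
      unfolding tn_def tL_def bil_def using elim(1) u by (auto intro!: tendsto_intros)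
    ultimately show ?case by simp
  qed
qed

section \<open>Steps whose limiting residual vanishes\<close>

lemma \<gamma>_Suc_degenerate:
  assumes v: "ismm v" and t: "tL v = 0"
  shows "\<gamma> (Suc v) = distr (\<gamma> v) (PiM (Gb (Suc v)) (\<lambda>_. borel)) (\<lambda>z. ext v z (\<lambda>i. - uL v i) 0 0)"
proof -
  let ?e = "\<lambda>z. ext v z (\<lambda>i. - uL v i) 0 0"
  have e: "?e \<in> measurable (\<gamma> v) (PiM (Gb (Suc v)) (\<lambda>_. borel))" by (rule ext_measurable[OF v]) auto
  have "\<gamma> (Suc v) = distr (\<gamma> v \<Otimes>\<^sub>M std_gauss) (PiM (Gb (Suc v)) (\<lambda>_. borel)) (?e \<circ> fst)"
    unfolding \<gamma>_Suc_ext[OF v] by (simp add: t ext_def comp_def)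
  also have "\<dots> = distr (distr (\<gamma> v \<Otimes>\<^sub>M std_gauss) (\<gamma> v) fst) (PiM (Gb (Suc v)) (\<lambda>_. borel)) ?e"
    using e by (intro distr_distr[symmetric]) auto
  finally show ?thesis by (simp only: std_gauss.distr_pair_fst)
qed

text \<open>A deterministic identity: a linear relation that holds exactly at every coordinate of
  the multiplied vectors passes through the matrix to the products, with the limiting coefficients
  in place of the random ones.\<close>

lemma st_Suc_degenerate:
  assumes v: "ismm v" and z: "\<forall>\<beta><n. (\<Sum>i\<in>Jv v. uL v i * \<phi> i (st n \<omega> v \<beta>)) = 0" and a: "\<alpha> < n"
  shows "st n \<omega> (Suc v) \<alpha> = ext v (st n \<omega> v \<alpha>) (\<lambda>i. - uL v i) 0 0"
proof -
  have mm: "val n \<omega> i \<alpha> = (\<Sum>\<beta><n. W n (avar v) \<omega> \<alpha> \<beta> * \<phi> i (st n \<omega> v \<beta>))" if "i \<in> Jv v" for i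
  proof -
    have "ismm i" "avar i = avar v" "i \<le> v" using that v by (auto simp: Jv_def Bv_def dest: Gb_less)
    then show ?thesis by (simp add: val_mm val_arg[of i v])
  qed
  have \<phi>v: "\<phi> v (st n \<omega> v \<beta>) = (\<Sum>i\<in>Bv v. - uL v i * \<phi> i (st n \<omega> v \<beta>))" if "\<beta> < n" for \<beta>
    using z that by (simp add: Jv_def uL_def resid_self sum_negf add_eq_0_iff2)
  have "val n \<omega> v \<alpha> = (\<Sum>\<beta><n. \<Sum>i\<in>Bv v. - uL v i * (W n (avar v) \<omega> \<alpha> \<beta> * \<phi> i (st n \<omega> v \<beta>)))"
    using mm[of v] by (simp add: Jv_def \<phi>v sum_distrib_left mult.left_commute)
  also have "\<dots> = (\<Sum>i\<in>Bv v. - uL v i * val n \<omega> i \<alpha>)"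
    by (subst sum.swap) (simp add: sum_distrib_left mm Jv_def)
  also have "\<dots> = (\<Sum>i\<in>Bv v. - uL v i * st n \<omega> v \<alpha> i)"
    using Bv_Gb by (intro sum.cong) (auto simp: st_def)
  also have "\<dots> = (\<Sum>i\<in>Gb v. - uL v i * st n \<omega> v \<alpha> i)"
    by (rule sum_Bv_Gb[symmetric]) (simp add: uL_outside)
  finally show ?thesis
    using v by (auto simp: ext_def st_def Gb_Suc fun_eq_iff)
qed

lemma step_degenerate:
  assumes v: "ismm v" and lln: "lln v" and rs: "rank_stable v" and t: "tL v = 0"
  shows "lln (Suc v)" "rank_stable (Suc v)"
proof -
  let ?e = "\<lambda>z. ext v z (\<lambda>i. - uL v i) 0 0"
  have em: "?e \<in> measurable (PiM (Gb v) (\<lambda>_. borel)) (PiM (Gb (Suc v)) (\<lambda>_. borel))"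
    by (rule ext_measurable[OF v]) auto
  then have em': "?e \<in> measurable (\<gamma> v) (PiM (Gb (Suc v)) (\<lambda>_. borel))" by simp
  have G: "Gb (Suc v) = insert v (Gb v)" using v by (simp add: Gb_Suc)
  have vG: "v \<notin> Gb v" by (auto dest: Gb_less)
  have "bil (Jv v) (Q v) (uL v) (uL v) = 0" using t by (simp add: tL_def)
  from rs[unfolded rank_stable_def, rule_format, OF bil_zero_AE[OF v this]]
  have exact: "AE \<omega> in M. \<forall>\<^sub>F n in sequentially. \<forall>\<alpha><n. st n \<omega> (Suc v) \<alpha> = ?e (st n \<omega> v \<alpha>)"
    by eventually_elim (auto elim!: eventually_mono intro!: st_Suc_degenerate[OF v])
  show "lln (Suc v)"
    unfolding lln_def
  proof (intro allI impI)
    fix \<psi> assume c: "ctrl ex (Gb (Suc v)) \<psi>" and m: "\<psi> \<in> borel_measurable (PiM (Gb (Suc v)) (\<lambda>_. borel))"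
    define B where "B = (\<Sum>i\<in>Gb v. \<bar>uL v i\<bar>)"
    have B: "B \<ge> 0" "\<And>i. i \<in> Gb v \<Longrightarrow> \<bar>- uL v i\<bar> \<le> B"
      unfolding B_def by (auto intro!: sum_nonneg member_le_sum)
    obtain K where K: "K \<ge> 0" "\<forall>z c s t. z \<in> extensional (Gb v) \<longrightarrow> (\<forall>i\<in>Gb v. \<bar>c i\<bar> \<le> B) \<longrightarrow> \<bar>s\<bar> \<le> B \<longrightarrow>
       \<bar>\<psi> (z(v := (\<Sum>i\<in>Gb v. c i * z i) + s * t))\<bar> \<le> exp (K * growth ex (Gb v) z) * exp (K * \<bar>t\<bar> powr ex)"
      using ctrl_update_bound[OF finite_Gb vG ex_pos ex(2) B(1) c[unfolded G]] by blast
    have "ctrl ex (Gb v) (\<lambda>z. \<psi> (?e z))"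
    proof (rule ctrlI[OF K(1)])
      fix z :: "nat \<Rightarrow> real" assume "z \<in> extensional (Gb v)"
      then have "\<bar>\<psi> (z(v := (\<Sum>i\<in>Gb v. - uL v i * z i) + 0 * 0))\<bar> \<le> exp (K * growth ex (Gb v) z) * exp (K * \<bar>0\<bar> powr ex)"
        using B by (intro K(2)[rule_format]) auto
      then show "\<bar>\<psi> (?e z)\<bar> \<le> exp (K * growth ex (Gb v) z)" by (simp add: ext_def)
    qed
    moreover have "(\<lambda>z. \<psi> (?e z)) \<in> borel_measurable (PiM (Gb v) (\<lambda>_. borel))"
      by (rule measurable_compose[OF em m])
    ultimately have "AE \<omega> in M. (\<lambda>n. (\<Sum>\<alpha><n. \<psi> (?e (st n \<omega> v \<alpha>))) / real n) \<longlonglongrightarrow> (\<integral>z. \<psi> (?e z) \<partial>\<gamma> v)"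
      using lln unfolding lln_def by blast
    moreover have "(\<integral>z. \<psi> (?e z) \<partial>\<gamma> v) = (\<integral>z. \<psi> z \<partial>\<gamma> (Suc v))"
      unfolding \<gamma>_Suc_degenerate[OF v t] using em' m by (intro integral_distr[symmetric])
    ultimately have A: "AE \<omega> in M. (\<lambda>n. (\<Sum>\<alpha><n. \<psi> (?e (st n \<omega> v \<alpha>))) / real n) \<longlonglongrightarrow> (\<integral>z. \<psi> z \<partial>\<gamma> (Suc v))"
      by (simp only:)
    from A exact show "AE \<omega> in M. (\<lambda>n. (\<Sum>\<alpha><n. \<psi> (st n \<omega> (Suc v) \<alpha>)) / real n) \<longlonglongrightarrow> (\<integral>z. \<psi> z \<partial>\<gamma> (Suc v))"
    proof eventually_elim
      case (elim \<omega>)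
      from elim(2) have "\<forall>\<^sub>F n in sequentially. (\<Sum>\<alpha><n. \<psi> (?e (st n \<omega> v \<alpha>))) / real n = (\<Sum>\<alpha><n. \<psi> (st n \<omega> (Suc v) \<alpha>)) / real n"
        by eventually_elim simp
      with elim(1) show ?case by (rule Lim_transform_eventually)
    qed
  qed
  show "rank_stable (Suc v)"
    unfolding rank_stable_def
  proof (intro allI impI)
    fix P assume P: "AE z in \<gamma> (Suc v). P z"
    have "AE z in \<gamma> v. P (?e z)" using P unfolding \<gamma>_Suc_degenerate[OF v t] by (rule AE_distrD[OF em'])
    from rs[unfolded rank_stable_def, rule_format, OF this] exact
    show "AE \<omega> in M. \<forall>\<^sub>F n in sequentially. \<forall>\<alpha><n. P (st n \<omega> (Suc v) \<alpha>)"
    proof eventually_elim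
      case (elim \<omega>) then show ?case by eventually_elim simp
    qed
  qed
qed

text \<open>Recovers the past at \<open>v\<close> from the history at \<open>Suc v\<close>, so that
  an event about both becomes a set of histories as \<open>one_step\<close> requires.\<close>

definition "rst n v p = (\<lambda>\<alpha>\<in>{..<n::nat}. restrict (p \<alpha>) (Gb v) :: nat \<Rightarrow> real)"

lemma rst_measurable: "rst n v \<in> measurable (PS n (Suc v)) (PS n v)"
  unfolding rst_def PS_def
proof (rule measurable_restrict)
  fix \<alpha> assume "\<alpha> \<in> {..<n}"
  then have c: "(\<lambda>p. p \<alpha>) \<in> measurable (PiM {..<n} (\<lambda>_. PiM (Gb (Suc v)) (\<lambda>_. borel :: real measure))) (PiM (Gb (Suc v)) (\<lambda>_. borel))"
    by (rule measurable_component_singleton)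
  have "(\<lambda>z. restrict z (Gb v)) \<in> measurable (PiM (Gb (Suc v)) (\<lambda>_. borel :: real measure)) (PiM (Gb v) (\<lambda>_. borel))"
    by (rule measurable_restrict_subset) (use Gb_mono[of v "Suc v"] in auto)
  from measurable_compose[OF c this]
  show "(\<lambda>p. restrict (p \<alpha>) (Gb v)) \<in> measurable (PiM {..<n} (\<lambda>_. PiM (Gb (Suc v)) (\<lambda>_. borel :: real measure))) (PiM (Gb v) (\<lambda>_. borel))" .
qed

lemma rst_upd:
  assumes "p \<in> space (PS n v)"
  shows "rst n v (upd n v p t) = p"
proof -
  have "p \<in> {..<n} \<rightarrow>\<^sub>E extensional (Gb v)" using assms by (simp add: PS_def space_PiM)
  moreover have "v \<notin> Gb v" by (auto dest: Gb_less)
  ultimately show ?thesis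
    by (auto simp: rst_def upd_def fun_eq_iff restrict_def PiE_def extensional_def Pi_def)
qed

lemma rst_past: "rst n v (past n \<omega> (Suc v)) = past n \<omega> v"
  using Gb_mono[of v "Suc v"] by (auto simp: rst_def past_def st_def fun_eq_iff)

lemma PS_component_measurable: "\<alpha> \<in> {..<n} \<Longrightarrow> (\<lambda>p. p \<alpha>) \<in> measurable (PS n v) (PiM (Gb v) (\<lambda>_. borel))"
  unfolding PS_def by (rule measurable_component_singleton)

text \<open>Given the past, the actual and the limiting law of the new coordinate are both
  nondegenerate normals, hence share their null sets whatever the coefficients. So for each fixed
  \<open>n\<close> the bad event has probability zero where \<open>tn\<close> is positive, and
  \<open>tn\<close> is eventually positive because its limit is.\<close>

lemma rank_stable_step:
  assumes v: "ismm v" and lln: "lln v" and rs: "rank_stable v" and t: "tL v > 0"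
  shows "rank_stable (Suc v)"
  unfolding rank_stable_def
proof (intro allI impI)
  fix P assume "AE z in \<gamma> (Suc v). P z"
  then obtain N where N: "N \<in> null_sets (\<gamma> (Suc v))" "{z \<in> space (\<gamma> (Suc v)). \<not> P z} \<subseteq> N"
    unfolding eventually_ae_filter by blast
  let ?B = "PiM (Gb (Suc v)) (\<lambda>_. borel :: real measure)"
  let ?e = "\<lambda>z. ext v z (\<lambda>i. - uL v i) (sg v * tL v)"
  interpret pair_sigma_finite "\<gamma> v" std_gauss ..
  have Ns[measurable]: "N \<in> sets ?B" using N by auto
  have "AE z in \<gamma> (Suc v). z \<notin> N" using N(1) by (rule AE_not_in)
  then have "AE x in \<gamma> v \<Otimes>\<^sub>M std_gauss. ?e (fst x) (snd x) \<notin> N"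
    unfolding \<gamma>_Suc_ext[OF v] by (rule AE_distrD[OF ext_pair_measurable[OF v]])
  \<comment> \<open>By Fubini almost every section of \<open>N\<close> is null. That the section at
    \<open>z\<close> is null is itself a property of \<open>z\<close>, to which rank stability at
    \<open>v\<close> applies.\<close>
  from AE_pair[OF this] have "AE z in \<gamma> v. AE t in std_gauss. ?e z t \<notin> N" by simp
  from rs[unfolded rank_stable_def, rule_format, OF this]
  have 1: "AE \<omega> in M. \<forall>\<^sub>F n in sequentially. \<forall>\<alpha><n. AE t in std_gauss. ?e (st n \<omega> v \<alpha>) t \<notin> N" .
  have key: "AE t in std_gauss. ext v z c s t \<notin> N"
    if z: "z \<in> extensional (Gb v)" and s: "s > 0" and a: "AE t in std_gauss. ?e z t \<notin> N" for z c :: "nat \<Rightarrow> real" and s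
  proof -
    define A where "A = {y. z(v := y) \<in> N}"
    have zs: "z \<in> space (PiM (Gb v) (\<lambda>_. borel))" using z by simp
    have "(\<lambda>y. ext v z (\<lambda>_. 0) 1 y) \<in> measurable borel ?B"
      using zs by (intro ext_measurable[OF v]) auto
    from measurable_sets[OF this Ns] have A: "A \<in> sets borel"
      by (simp add: ext_def A_def vimage_def)
    have iff: "(AE t in std_gauss. ext v z c s t \<notin> N) \<longleftrightarrow> emeasure std_gauss {t. (\<Sum>i\<in>Gb v. c i * z i) + s * t \<in> A} = 0" for c s
    proof -
      have "{t. (\<Sum>i\<in>Gb v. c i * z i) + s * t \<in> A} \<in> sets std_gauss"
        using measurable_sets[of "\<lambda>t. (\<Sum>i\<in>Gb v. c i * z i) + s * t" borel borel A] A by (simp add: vimage_def)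
      then show ?thesis
        by (subst AE_iff_measurable[OF _ refl]) (auto simp: ext_def A_def)
    qed
    show ?thesis
      using a unfolding iff by (rule std_gauss_null_affine[OF _ s A, rotated]) (use sg_pos[OF v] t in simp)
  qed
  have 2: "AE \<omega> in M. \<forall>n\<ge>1. (\<forall>\<alpha><n. AE t in std_gauss. ?e (st n \<omega> v \<alpha>) t \<notin> N) \<longrightarrow> tn n v (past n \<omega> v) > 0 \<longrightarrow>
     (\<forall>\<alpha><n. st n \<omega> (Suc v) \<alpha> \<notin> N)"
  proof (subst AE_all_countable, intro allI)
    fix n :: nat
    show "AE \<omega> in M. 1 \<le> n \<longrightarrow> (\<forall>\<alpha><n. AE t in std_gauss. ?e (st n \<omega> v \<alpha>) t \<notin> N) \<longrightarrow> tn n v (past n \<omega> v) > 0 \<longrightarrow>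
     (\<forall>\<alpha><n. st n \<omega> (Suc v) \<alpha> \<notin> N)"
    proof (cases "n \<ge> 1")
      case n: True
      note rst = rst_measurable[of n v]
      define h where "h = (\<lambda>z. emeasure std_gauss {t \<in> space std_gauss. ?e z t \<in> N})"
      have pm: "{x \<in> space (PiM (Gb v) (\<lambda>_. borel) \<Otimes>\<^sub>M std_gauss). ?e (fst x) (snd x) \<in> N} \<in> sets (PiM (Gb v) (\<lambda>_. borel) \<Otimes>\<^sub>M std_gauss)"
      proof -
        have "(\<lambda>x. ?e (fst x) (snd x)) \<in> measurable (PiM (Gb v) (\<lambda>_. borel) \<Otimes>\<^sub>M std_gauss) ?B"
          by (rule ext_measurable[OF v]) auto
        from measurable_sets[OF this Ns] show ?thesis by (simp add: vimage_def Int_def conj_commute)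
      qed
      have hm: "h \<in> borel_measurable (PiM (Gb v) (\<lambda>_. borel))"
      proof -
        have "(\<lambda>z. emeasure std_gauss (Pair z -` {x \<in> space (PiM (Gb v) (\<lambda>_. borel) \<Otimes>\<^sub>M std_gauss). ?e (fst x) (snd x) \<in> N}))
          \<in> borel_measurable (PiM (Gb v) (\<lambda>_. borel))"
          by (rule std_gauss.measurable_emeasure_Pair[OF pm])
        then show ?thesis
          by (rule measurable_cong[THEN iffD1, rotated]) (auto simp: h_def space_pair_measure intro!: arg_cong[where f="emeasure std_gauss"])
      qed
      have h0: "h z = 0 \<longleftrightarrow> (AE t in std_gauss. ?e z t \<notin> N)" if "z \<in> extensional (Gb v)" for z
      proof -
        have "{t \<in> space std_gauss. ?e z t \<in> N} \<in> sets std_gauss"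
        proof -
          have "(\<lambda>t. ?e z t) \<in> measurable std_gauss ?B"
            using that by (intro ext_measurable[OF v]) auto
          from measurable_sets[OF this Ns] show ?thesis by (simp add: vimage_def Int_def conj_commute)
        qed
        then show ?thesis unfolding h_def by (subst AE_iff_measurable[OF _ refl]) auto
      qed
      \<comment> \<open>The hypothesis of the claim concerns the past, its failure the new variable;
        through \<open>rst\<close> both become one measurable set of histories. The function
        \<open>h\<close> makes the almost everywhere condition on sections measurable.\<close>
      define Bad where "Bad = {p' \<in> space (PS n (Suc v)). (\<forall>\<alpha>\<in>{..<n}. h (rst n v p' \<alpha>) = 0) \<and> tn n v (rst n v p') > 0 \<and> (\<exists>\<alpha>\<in>{..<n}. p' \<alpha> \<in> N)}"
      note comp[measurable] = PS_component_measurable[of _ n]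
      note [measurable] = tn_measurable[OF v rst] hm rst
      have [measurable]: "(\<lambda>p'. h (rst n v p' \<alpha>)) \<in> borel_measurable (PS n (Suc v))" if "\<alpha> \<in> {..<n}" for \<alpha>
        by (rule measurable_compose[OF measurable_compose[OF rst comp[OF that]] hm])
      have Bad: "Bad \<in> sets (PS n (Suc v))" unfolding Bad_def by measurable
      have "(\<integral>\<^sup>+\<omega>. indicator Bad (past n \<omega> (Suc v)) \<partial>M) =
        (\<integral>\<^sup>+\<omega>. \<integral>\<^sup>+t. indicator Bad (upd n v (past n \<omega> v) t) \<partial>PiM {..<n} (\<lambda>_. std_gauss) \<partial>M)"
        using Bad by (intro one_step[OF n v]) auto
      also have "\<dots> = (\<integral>\<^sup>+\<omega>. 0 \<partial>M)"
      proof (rule nn_integral_cong)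
        fix \<omega>
        let ?p = "past n \<omega> v" and ?G = "PiM {..<n} (\<lambda>_. std_gauss)"
        have "AE t in ?G. upd n v ?p t \<notin> Bad"
        proof (cases "(\<forall>\<alpha>\<in>{..<n}. h (?p \<alpha>) = 0) \<and> tn n v ?p > 0")
          case True
          have "AE t in ?G. \<forall>\<alpha>\<in>{..<n}. ext v (?p \<alpha>) (\<lambda>i. - un n v ?p i) (sg v * tn n v ?p) (t \<alpha>) \<notin> N"
          proof (intro AE_finite_allI)
            fix \<alpha> assume a: "\<alpha> \<in> {..<n}"
            have e: "?p \<alpha> \<in> extensional (Gb v)" using a by (simp add: past_def st_def)
            have "AE t in std_gauss. ext v (?p \<alpha>) (\<lambda>i. - un n v ?p i) (sg v * tn n v ?p) t \<notin> N"
            proof (rule key[OF e])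
              show "0 < sg v * tn n v ?p" using True sg_pos[OF v] by simp
              have "h (?p \<alpha>) = 0" using True a by blast
              then show "AE t in std_gauss. ?e (?p \<alpha>) t \<notin> N" by (simp only: h0[OF e])
            qed
            then show "AE t in ?G. ext v (?p \<alpha>) (\<lambda>i. - un n v ?p i) (sg v * tn n v ?p) (t \<alpha>) \<notin> N"
              by (rule AE_PiM_component[where M="\<lambda>_. std_gauss" and I="{..<n}", OF std_gauss.prob_space_axioms a])
          qed simp
          then show ?thesis by eventually_elim (auto simp: Bad_def upd_eq)
        next
          case False
          then show ?thesis by (auto simp: Bad_def rst_upd[OF past_space])
        qed
        then show "(\<integral>\<^sup>+t. indicator Bad (upd n v ?p t) \<partial>?G) = 0"
          by (subst nn_integral_cong_AE[where v="\<lambda>_. 0"]) (auto elim!: eventually_mono)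
      qed
      finally have "(\<integral>\<^sup>+\<omega>. indicator Bad (past n \<omega> (Suc v)) \<partial>M) = 0" by simp
      moreover have "(\<lambda>\<omega>. indicator Bad (past n \<omega> (Suc v)) :: ennreal) \<in> borel_measurable M"
        using Bad past_measurable[OF n, of "Suc v"] ismmD(2)[OF v] by simp
      ultimately have "AE \<omega> in M. indicator Bad (past n \<omega> (Suc v)) = (0 :: ennreal)"
        by (subst (asm) nn_integral_0_iff_AE) auto
      then show ?thesis
      proof eventually_elim
        case (elim \<omega>)
        then have "past n \<omega> (Suc v) \<notin> Bad" by (auto simp: indicator_def split: if_splits)
        then show ?case
          by (auto simp: Bad_def past_space rst_past past_nth h0[OF st_extensional])
      qed
    qed simp
  qed
  from 1 2 un_tendsto[OF v lln rs]
  show "AE \<omega> in M. \<forall>\<^sub>F n in sequentially. \<forall>\<alpha><n. P (st n \<omega> (Suc v) \<alpha>)"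
  proof eventually_elim
    case (elim \<omega>)
    have "\<forall>\<^sub>F n in sequentially. tn n v (past n \<omega> v) > 0"
      by (rule order_tendstoD(1)[OF conjunct2[OF elim(3)] t])
    with elim(1) eventually_ge_at_top[of 1] show ?case
    proof eventually_elim
      case (elim n)
      have "\<forall>\<alpha><n. st n \<omega> (Suc v) \<alpha> \<notin> N" using \<open>\<forall>n\<ge>1. _ n\<close> elim by blast
      moreover have "st n \<omega> (Suc v) \<alpha> \<in> space (\<gamma> (Suc v))" for \<alpha> by (simp add: st_extensional)
      ultimately show ?case using N(2) by blast
    qed
  qed
qed

end

section \<open>The law of large numbers\<close>

text \<open>\<open>\<kappa>\<close> is fixed before the limit: the first summand vanishes for each
  \<open>\<kappa>\<close>, the second is at most a bounded multiple of \<open>\<kappa>\<close>,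
  chosen as half the tolerance.\<close>

lemma small_limit:
  fixes X x y :: "nat \<Rightarrow> real"
  assumes le: "\<And>\<kappa>. \<kappa> > 0 \<Longrightarrow> \<forall>\<^sub>F n in sequentially. \<bar>X n\<bar> \<le> x n / (2 * \<kappa>) + \<kappa> * y n"
    and x: "x \<longlonglongrightarrow> 0" and y: "y \<longlonglongrightarrow> Y"
  shows "X \<longlonglongrightarrow> 0"
proof (rule tendstoI)
  fix e :: real assume e: "e > 0"
  define \<kappa> where "\<kappa> = e / (2 * (\<bar>Y\<bar> + 1))"
  have k: "\<kappa> > 0" using e by (simp add: \<kappa>_def add_nonneg_pos)
  have "\<forall>\<^sub>F n in sequentially. y n < \<bar>Y\<bar> + 1" using y by (rule order_tendstoD) linarith
  moreover have "\<forall>\<^sub>F n in sequentially. x n < e * \<kappa>" using x by (rule order_tendstoD) (use e k in simp)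
  ultimately show "\<forall>\<^sub>F n in sequentially. dist (X n) 0 < e"
    using le[OF k]
  proof eventually_elim
    case (elim n)
    have "x n / (2 * \<kappa>) < e / 2" using elim(2) k by (simp add: divide_less_eq)
    moreover have "\<kappa> * y n \<le> \<kappa> * (\<bar>Y\<bar> + 1)" using elim(1) k by (intro mult_left_mono) auto
    moreover have "\<kappa> * (\<bar>Y\<bar> + 1) = e / 2"
    proof -
      have *: "e / (2 * c) * c = e / 2" if "c > 0" for c using that by simp
      show ?thesis unfolding \<kappa>_def by (rule *) simp
    qed
    ultimately show ?case using elim(3) by simp
  qed
qed

context netsor_ctrl
begin

lemma eventually_bounded:
  assumes "\<And>i. (\<lambda>n. c n i) \<longlonglongrightarrow> c' i" "s \<longlonglongrightarrow> (s' :: real)" "finite I"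
  shows "\<forall>\<^sub>F n in sequentially. (\<forall>i\<in>I. \<bar>c n i :: real\<bar> \<le> 1 + (\<Sum>i\<in>I. \<bar>c' i\<bar>) + \<bar>s'\<bar>) \<and> \<bar>s n\<bar> \<le> 1 + (\<Sum>i\<in>I. \<bar>c' i\<bar>) + \<bar>s'\<bar>"
proof (intro eventually_conj eventually_ball_finite ballI \<open>finite I\<close>)
  let ?B = "1 + (\<Sum>i\<in>I. \<bar>c' i\<bar>) + \<bar>s'\<bar>"
  fix i assume "i \<in> I"
  then have "\<bar>c' i\<bar> \<le> (\<Sum>i\<in>I. \<bar>c' i\<bar>)" using \<open>finite I\<close> by (intro member_le_sum) auto
  then have "\<bar>c' i\<bar> < ?B" by linarith
  moreover have "(\<lambda>n. \<bar>c n i\<bar>) \<longlonglongrightarrow> \<bar>c' i\<bar>" by (intro tendsto_rabs assms)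
  ultimately have "\<forall>\<^sub>F n in sequentially. \<bar>c n i\<bar> < ?B" by (intro order_tendstoD(2))
  then show "\<forall>\<^sub>F n in sequentially. \<bar>c n i\<bar> \<le> ?B" by eventually_elim simp
next
  have "\<bar>s'\<bar> < 1 + (\<Sum>i\<in>I. \<bar>c' i\<bar>) + \<bar>s'\<bar>" by (simp add: add_pos_nonneg sum_nonneg)
  moreover have "(\<lambda>n. \<bar>s n\<bar>) \<longlonglongrightarrow> \<bar>s'\<bar>" by (intro tendsto_rabs assms)
  ultimately have "\<forall>\<^sub>F n in sequentially. \<bar>s n\<bar> < 1 + (\<Sum>i\<in>I. \<bar>c' i\<bar>) + \<bar>s'\<bar>" by (intro order_tendstoD(2))
  then show "\<forall>\<^sub>F n in sequentially. \<bar>s n\<bar> \<le> 1 + (\<Sum>i\<in>I. \<bar>c' i\<bar>) + \<bar>s'\<bar>" by eventually_elim simp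
qed

lemma envelope_ctrl: "ctrl ex (Gb v) (\<lambda>z. exp (K * growth ex (Gb v) z) * c)"
  "(\<lambda>z. exp (K * growth ex (Gb v) z) * c) \<in> borel_measurable (PiM (Gb v) (\<lambda>_. borel))"
proof -
  note [measurable] = growth_measurable[of v]
  show "ctrl ex (Gb v) (\<lambda>z. exp (K * growth ex (Gb v) z) * c)"
    by (intro ctrl_mult ctrl_exp_growth ctrl_const)
  show "(\<lambda>z. exp (K * growth ex (Gb v) z) * c) \<in> borel_measurable (PiM (Gb v) (\<lambda>_. borel))"
    by measurable
qed

definition "cn n \<omega> v i = - un n v (past n \<omega> v) i"
definition "sn n \<omega> v = sg v * tn n v (past n \<omega> v)"
definition "cL v i = - uL v i"
definition "sL v = sg v * tL v"
text \<open>Strictly above all limiting coefficients, hence eventually a bound for the random ones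
  too, and deterministic, so that it can define events of the past.\<close>

definition "Bd v = 1 + (\<Sum>i\<in>Gb v. \<bar>cL v i\<bar>) + \<bar>sL v\<bar>"

lemma Bd: "0 \<le> Bd v" "i \<in> Gb v \<Longrightarrow> \<bar>cL v i\<bar> \<le> Bd v" "\<bar>sL v\<bar> \<le> Bd v"
proof -
  have s: "0 \<le> (\<Sum>i\<in>Gb v. \<bar>cL v i\<bar>)" by (intro sum_nonneg) auto
  then show "0 \<le> Bd v" "\<bar>sL v\<bar> \<le> Bd v" by (auto simp: Bd_def)
  assume "i \<in> Gb v"
  then have "\<bar>cL v i\<bar> \<le> (\<Sum>i\<in>Gb v. \<bar>cL v i\<bar>)" by (intro member_le_sum) auto
  then show "\<bar>cL v i\<bar> \<le> Bd v" unfolding Bd_def by linarith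
qed

lemma cn_sn_tendsto:
  assumes "ismm v" "lln v" "rank_stable v"
  shows "AE \<omega> in M. (\<forall>i. (\<lambda>n. cn n \<omega> v i) \<longlonglongrightarrow> cL v i) \<and> (\<lambda>n. sn n \<omega> v) \<longlonglongrightarrow> sL v \<and>
    (\<forall>\<^sub>F n in sequentially. (\<forall>i\<in>Gb v. \<bar>cn n \<omega> v i\<bar> \<le> Bd v) \<and> \<bar>sn n \<omega> v\<bar> \<le> Bd v)"
  using un_tendsto[OF assms]
proof eventually_elim
  case (elim \<omega>)
  have c: "(\<lambda>n. cn n \<omega> v i) \<longlonglongrightarrow> cL v i" for i
    unfolding cn_def cL_def using elim by (intro tendsto_minus) auto
  have s: "(\<lambda>n. sn n \<omega> v) \<longlonglongrightarrow> sL v"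
    unfolding sn_def sL_def using elim by (intro tendsto_mult tendsto_const) auto
  show ?case
    using c s eventually_bounded[where c="\<lambda>n. cn n \<omega> v" and c'="cL v", OF c s finite_Gb[of v]] unfolding Bd_def by blast
qed

text \<open>Given the past, the new coordinates are independent and \<open>Psi\<close> is the mean
  of each summand. The fourth moments are dominated by the envelope \<open>U\<close>, itself a
  controlled function of the past, so \<open>lln v\<close> bounds their average.\<close>

lemma fluctuation:
  assumes v: "ismm v" and lln: "lln v" and rs: "rank_stable v"
    and c\<psi>: "ctrl ex (Gb (Suc v)) \<psi>" and \<psi>: "\<psi> \<in> borel_measurable (PiM (Gb (Suc v)) (\<lambda>_. borel))"
  shows "AE \<omega> in M. (\<lambda>n. (\<Sum>\<alpha><n. \<psi> (st n \<omega> (Suc v) \<alpha>) - Psi v \<psi> (st n \<omega> v \<alpha>) (cn n \<omega> v) (sn n \<omega> v)) / real n) \<longlonglongrightarrow> 0"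
proof (rule AE_tendsto_0I)
  fix e :: real assume e: "e > 0"
  obtain K where K: "K \<ge> 0"
    "\<And>z c s k. z \<in> extensional (Gb v) \<Longrightarrow> (\<And>i. i \<in> Gb v \<Longrightarrow> \<bar>c i\<bar> \<le> Bd v) \<Longrightarrow> \<bar>s\<bar> \<le> Bd v \<Longrightarrow>
      integrable std_gauss (\<lambda>t. \<psi> (ext v z c s t) ^ k) \<and>
      (\<integral>t. \<bar>\<psi> (ext v z c s t) ^ k\<bar> \<partial>std_gauss) \<le>
        exp (real k * K * growth ex (Gb v) z) * (\<integral>t. exp (real k * K * \<bar>t\<bar> powr ex) \<partial>std_gauss)"
    by (rule ext_bounds[OF v Bd(1)[of v] c\<psi> \<psi>]) blast
  define U where "U = (\<lambda>z. exp (real 4 * K * growth ex (Gb v) z) * (\<integral>t. exp (real 4 * K * \<bar>t\<bar> powr ex) \<partial>std_gauss))"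
  have Uc: "ctrl ex (Gb v) U" and Um: "U \<in> borel_measurable (PiM (Gb v) (\<lambda>_. borel))"
    unfolding U_def by (rule envelope_ctrl)+
  \<comment> \<open>Strictly above the limit of the averages of \<open>U\<close>, so eventually
    above the averages themselves.\<close>
  define C where "C = (\<integral>z. U z \<partial>\<gamma> v) + 1"
  define D where "D = (\<lambda>n p' p. \<Sum>\<alpha><n. \<psi> (p' \<alpha>) - Psi v \<psi> (p \<alpha>) (\<lambda>i. - un n v p i) (sg v * tn n v p))"
  \<comment> \<open>The good event depends on the past alone. On it the tail bound has deterministic
    constants, off it no history counts as bad, and it holds eventually.\<close>
  define Gd where "Gd = (\<lambda>n p. (\<forall>i\<in>Gb v. \<bar>- un n v p i\<bar> \<le> Bd v) \<and> \<bar>sg v * tn n v p\<bar> \<le> Bd v \<and> (\<Sum>\<alpha><n. U (p \<alpha>)) \<le> real n * C)"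
  define Bad where "Bad = (\<lambda>n. {p' \<in> space (PS n (Suc v)). Gd n (rst n v p') \<and> e * real n \<le> \<bar>D n p' (rst n v p')\<bar>})"
  define A where "A = (\<lambda>n. {\<omega> \<in> space M. past n \<omega> (Suc v) \<in> Bad n})"
  have vn: "Suc v \<le> nv" using ismmD[OF v] by simp
  have "AE \<omega> in M. \<forall>\<^sub>F n in sequentially. \<omega> \<notin> A n"
  proof (rule AE_eventually_notin)
    fix n :: nat assume n: "n \<ge> 1"
    note rst[measurable] = rst_measurable[of n v]
    note comp = PS_component_measurable[of _ n]
    note [measurable] = tn_measurable[OF v rst] un_measurable[OF v rst]
    have [measurable]: "(\<lambda>p'. U (rst n v p' \<alpha>)) \<in> borel_measurable (PS n (Suc v))" if "\<alpha> \<in> {..<n}" for \<alpha>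
      by (rule measurable_compose[OF measurable_compose[OF rst comp[OF that]] Um])
    have [measurable]: "(\<lambda>p'. \<psi> (p' \<alpha>)) \<in> borel_measurable (PS n (Suc v))" if "\<alpha> \<in> {..<n}" for \<alpha>
      by (rule measurable_compose[OF comp[OF that] \<psi>])
    have [measurable]: "(\<lambda>p'. Psi v \<psi> (rst n v p' \<alpha>) (\<lambda>i. - un n v (rst n v p') i) (sg v * tn n v (rst n v p')))
        \<in> borel_measurable (PS n (Suc v))" if "\<alpha> \<in> {..<n}" for \<alpha>
      by (rule Psi_measurable[OF v measurable_compose[OF rst comp[OF that]] _ _ \<psi>]) measurable
    have Bad: "Bad n \<in> sets (PS n (Suc v))"
      unfolding Bad_def Gd_def D_def by measurable
    have pm: "(\<lambda>\<omega>. past n \<omega> (Suc v)) \<in> measurable M (PS n (Suc v))" by (rule past_measurable[OF n vn])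
    have "A n = (\<lambda>\<omega>. past n \<omega> (Suc v)) -` Bad n \<inter> space M" by (auto simp: A_def)
    then show An: "A n \<in> events" using measurable_sets[OF pm Bad] by simp
    have C0: "0 \<le> C" unfolding C_def U_def by (intro add_nonneg_nonneg Bochner_Integration.integral_nonneg mult_nonneg_nonneg) auto
    let ?G = "PiM {..<n} (\<lambda>_. std_gauss)"
    interpret G: prob_space ?G by (rule prob_space_PiM_std_gauss)
    have inner: "(\<integral>\<^sup>+t. indicator (Bad n) (upd n v p t) \<partial>?G) \<le> ennreal (48 * C / (e ^ 4 * (real n)\<^sup>2))"
      if p: "p \<in> space (PS n v)" for p
    proof (cases "Gd n p")
      case False
      then have "upd n v p t \<notin> Bad n" for t by (simp add: Bad_def rst_upd[OF p])
      then show ?thesis by simp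
    next
      case True
      let ?c = "\<lambda>i. - un n v p i" and ?s = "sg v * tn n v p"
      define f where "f = (\<lambda>\<alpha> t. \<psi> (ext v (p \<alpha>) ?c ?s t))"
      have pe: "p \<alpha> \<in> extensional (Gb v)" if "\<alpha> < n" for \<alpha>
      proof -
        have "p \<in> {..<n} \<rightarrow>\<^sub>E extensional (Gb v)" using p by (simp add: PS_def space_PiM)
        then show ?thesis using that by auto
      qed
      have fm: "f \<alpha> \<in> borel_measurable std_gauss" if "\<alpha> < n" for \<alpha>
        unfolding f_def using pe[OF that]
        by (intro measurable_compose[OF ext_measurable[OF v] \<psi>]) auto
      have K4: "integrable std_gauss (\<lambda>t. f \<alpha> t ^ 4)" "(\<integral>t. f \<alpha> t ^ 4 \<partial>std_gauss) \<le> U (p \<alpha>)" if "\<alpha> < n" for \<alpha>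
        using K(2)[OF pe[OF that], of ?c ?s 4] True unfolding f_def U_def Gd_def by auto
      define S where "S = {t \<in> space ?G. e * real n \<le> \<bar>\<Sum>\<alpha><n. f \<alpha> (t \<alpha>) - (\<integral>t. f \<alpha> t \<partial>std_gauss)\<bar>}"
      have [measurable]: "(\<lambda>t. f \<alpha> (t \<alpha>)) \<in> borel_measurable ?G" if "\<alpha> \<in> {..<n}" for \<alpha>
        using fm that by (intro measurable_compose[OF measurable_component_singleton]) auto
      have S: "S \<in> sets ?G" unfolding S_def by measurable
      have "(\<integral>\<^sup>+t. indicator (Bad n) (upd n v p t) \<partial>?G) \<le> (\<integral>\<^sup>+t. indicator S t \<partial>?G)"
      proof (rule nn_integral_mono)
        fix t assume t: "t \<in> space ?G"
        have "t \<in> S" if "upd n v p t \<in> Bad n"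
        proof -
          have "D n (upd n v p t) p = (\<Sum>\<alpha><n. f \<alpha> (t \<alpha>) - (\<integral>t. f \<alpha> t \<partial>std_gauss))"
            unfolding D_def f_def Psi_def by (intro sum.cong) (auto simp: upd_eq)
          then show ?thesis using that t by (simp add: Bad_def rst_upd[OF p] S_def)
        qed
        then show "indicator (Bad n) (upd n v p t) \<le> (indicator S t :: ennreal)"
          by (auto simp: indicator_def)
      qed
      also have "\<dots> = ennreal (measure ?G S)" using S by (simp add: G.emeasure_eq_measure)
      also have "measure ?G S \<le> 48 * C / (e ^ 4 * (real n)\<^sup>2)"
        unfolding S_def
      proof (rule std_gauss.PiM_coordinates_tail[OF fm K4(1) _ e n])
        have "(\<Sum>\<alpha><n. \<integral>t. f \<alpha> t ^ 4 \<partial>std_gauss) \<le> (\<Sum>\<alpha><n. U (p \<alpha>))" by (intro sum_mono K4) auto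
        also have "\<dots> \<le> real n * C" using True by (simp add: Gd_def)
        finally show "(\<Sum>\<alpha><n. \<integral>t. f \<alpha> t ^ 4 \<partial>std_gauss) \<le> real n * C" .
      qed auto
      finally show ?thesis by (simp add: ennreal_leI)
    qed
    have "(\<integral>\<^sup>+\<omega>. indicator (A n) \<omega> \<partial>M) = (\<integral>\<^sup>+\<omega>. indicator (Bad n) (past n \<omega> (Suc v)) \<partial>M)"
      by (rule nn_integral_cong) (simp add: A_def indicator_def)
    then have "emeasure M (A n) = (\<integral>\<^sup>+\<omega>. indicator (Bad n) (past n \<omega> (Suc v)) \<partial>M)"
      using An by simp
    also have "\<dots> = (\<integral>\<^sup>+\<omega>. \<integral>\<^sup>+t. indicator (Bad n) (upd n v (past n \<omega> v) t) \<partial>?G \<partial>M)"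
      using Bad by (intro one_step[OF n v]) auto
    also have "\<dots> \<le> (\<integral>\<^sup>+\<omega>. ennreal (48 * C / (e ^ 4 * (real n)\<^sup>2)) \<partial>M)"
      by (intro nn_integral_mono inner past_space)
    also have "\<dots> = ennreal (48 * C / (e ^ 4 * (real n)\<^sup>2))" by (simp add: emeasure_space_1)
    finally show "prob (A n) \<le> (48 * C / e ^ 4) / (real n)\<^sup>2"
      using C0 by (simp add: emeasure_eq_measure)
  qed
  moreover have "AE \<omega> in M. (\<lambda>n. (\<Sum>\<alpha><n. U (st n \<omega> v \<alpha>)) / real n) \<longlonglongrightarrow> (\<integral>z. U z \<partial>\<gamma> v)"
    using lln Uc Um unfolding lln_def by blast
  moreover have "AE \<omega> in M. \<omega> \<in> space M" by simp
  ultimately show "AE \<omega> in M. \<forall>\<^sub>F n in sequentially.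
      \<bar>\<Sum>\<alpha><n. \<psi> (st n \<omega> (Suc v) \<alpha>) - Psi v \<psi> (st n \<omega> v \<alpha>) (cn n \<omega> v) (sn n \<omega> v)\<bar> < e * real n"
    using cn_sn_tendsto[OF v lln rs]
  proof eventually_elim
    case (elim \<omega>)
    have "\<forall>\<^sub>F n in sequentially. (\<Sum>\<alpha><n. U (st n \<omega> v \<alpha>)) / real n < C"
      using elim(2) by (rule order_tendstoD) (simp add: C_def)
    moreover have "\<forall>\<^sub>F n in sequentially. (\<forall>i\<in>Gb v. \<bar>cn n \<omega> v i\<bar> \<le> Bd v) \<and> \<bar>sn n \<omega> v\<bar> \<le> Bd v"
      using elim(4) by blast
    ultimately show ?case using elim(1) eventually_gt_at_top[of 0]
    proof eventually_elim
      case (elim n)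
      have "Gd n (past n \<omega> v)"
        using elim(1,2,4) by (simp add: Gd_def cn_def sn_def past_nth divide_less_eq mult.commute)
      then have "\<not> e * real n \<le> \<bar>D n (past n \<omega> (Suc v)) (past n \<omega> v)\<bar>"
        using elim(3) \<open>\<omega> \<in> space M\<close> past_space by (auto simp: A_def Bad_def rst_past)
      then show ?case by (simp add: D_def past_nth cn_def[abs_def] sn_def)
    qed
  qed
qed

text \<open>In units of the normal law given by \<open>c\<close> and \<open>s\<close>, the other one
  has mean \<open>a\<close> and deviation \<open>b\<close>. The bound for \<open>a\<close> separates
  the coefficient differences from \<open>z\<close>, so that it can be averaged over the
  coordinates.\<close>

lemma Psi_perturbation:
  assumes z: "z \<in> extensional (Gb v)" and v: "ismm v" and \<psi>: "\<psi> \<in> borel_measurable (PiM (Gb (Suc v)) (\<lambda>_. borel))"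
    and s: "s > 0" "s' > 0" and k: "\<kappa> > 0"
    and i1: "integrable std_gauss (\<lambda>t. \<psi> (ext v z c s t))" "integrable std_gauss (\<lambda>t. (\<psi> (ext v z c s t))\<^sup>2)"
    and i2: "integrable std_gauss (\<lambda>t. \<psi> (ext v z c' s' t))" "integrable std_gauss (\<lambda>t. (\<psi> (ext v z c' s' t))\<^sup>2)"
    and U: "(\<integral>t. (\<psi> (ext v z c s t))\<^sup>2 \<partial>std_gauss) \<le> U" "(\<integral>t. (\<psi> (ext v z c' s' t))\<^sup>2 \<partial>std_gauss) \<le> U"
  shows "\<bar>Psi v \<psi> z c' s' - Psi v \<psi> z c s\<bar> \<le>
    (2 * (1 - sqrt (2 * (s' / s) / (1 + (s' / s)\<^sup>2))) + ((\<Sum>i\<in>Gb v. \<bar>c' i - c i\<bar>) / s)\<^sup>2 * (\<Sum>i\<in>Gb v. \<bar>z i\<bar>)\<^sup>2) / (2 * \<kappa>) + \<kappa> * (2 * U)"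
proof -
  define m1 where "m1 = (\<Sum>i\<in>Gb v. c i * z i)"
  define m2 where "m2 = (\<Sum>i\<in>Gb v. c' i * z i)"
  define a where "a = (m2 - m1) / s"
  define b where "b = s' / s"
  define f where "f = (\<lambda>u. \<psi> (z(v := m1 + s * u)))"
  have e1: "\<psi> (ext v z c s t) = f t" for t by (simp add: ext_def f_def m1_def)
  have e2: "\<psi> (ext v z c' s' t) = f (a + b * t)" for t
    using s by (simp add: ext_def f_def m2_def[symmetric] a_def b_def distrib_left)
  have "(\<lambda>u. ext v z c s u) \<in> measurable borel (PiM (Gb (Suc v)) (\<lambda>_. borel))"
    using z by (intro ext_measurable[OF v]) auto
  from measurable_compose[OF this \<psi>] have fm: "f \<in> borel_measurable borel" unfolding e1 .
  have b: "b > 0" using s by (simp add: b_def)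
  have dm: "\<bar>m2 - m1\<bar> \<le> (\<Sum>i\<in>Gb v. \<bar>c' i - c i\<bar>) * (\<Sum>i\<in>Gb v. \<bar>z i\<bar>)"
  proof -
    have "\<bar>m2 - m1\<bar> = \<bar>\<Sum>i\<in>Gb v. (c' i - c i) * z i\<bar>"
      by (simp add: m1_def m2_def sum_subtractf left_diff_distrib)
    also have "\<dots> \<le> (\<Sum>i\<in>Gb v. \<bar>c' i - c i\<bar> * \<bar>z i\<bar>)"
      by (rule order_trans[OF sum_abs]) (simp add: abs_mult)
    also have "\<dots> \<le> (\<Sum>i\<in>Gb v. \<bar>c' i - c i\<bar> * (\<Sum>i\<in>Gb v. \<bar>z i\<bar>))"
      by (intro sum_mono mult_left_mono member_le_sum) auto
    finally show ?thesis by (simp add: sum_distrib_right)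
  qed
  have a2: "a\<^sup>2 \<le> ((\<Sum>i\<in>Gb v. \<bar>c' i - c i\<bar>) / s)\<^sup>2 * (\<Sum>i\<in>Gb v. \<bar>z i\<bar>)\<^sup>2"
  proof -
    have "\<bar>a\<bar> \<le> (\<Sum>i\<in>Gb v. \<bar>c' i - c i\<bar>) / s * (\<Sum>i\<in>Gb v. \<bar>z i\<bar>)"
      using divide_right_mono[OF dm, of s] s by (simp add: a_def)
    then have "\<bar>a\<bar>\<^sup>2 \<le> ((\<Sum>i\<in>Gb v. \<bar>c' i - c i\<bar>) / s * (\<Sum>i\<in>Gb v. \<bar>z i\<bar>))\<^sup>2" by (intro power_mono) auto
    then show ?thesis by (simp only: power2_abs power_mult_distrib)
  qed
  have "\<bar>Psi v \<psi> z c' s' - Psi v \<psi> z c s\<bar> \<le>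
    (2 * (1 - sqrt (2 * b / (1 + b\<^sup>2))) + a\<^sup>2) / (2 * \<kappa>) +
    \<kappa> * ((\<integral>t. (f t)\<^sup>2 \<partial>std_gauss) + (\<integral>t. (f (a + b * t))\<^sup>2 \<partial>std_gauss))"
    unfolding Psi_def e1 e2
    using i1 i2 unfolding e1 e2 by (intro gaussian_perturbation[OF b k fm])
  also have "\<dots> \<le> (2 * (1 - sqrt (2 * b / (1 + b\<^sup>2))) + ((\<Sum>i\<in>Gb v. \<bar>c' i - c i\<bar>) / s)\<^sup>2 * (\<Sum>i\<in>Gb v. \<bar>z i\<bar>)\<^sup>2) / (2 * \<kappa>) + \<kappa> * (2 * U)"
    using U a2 k unfolding e1 e2 by (intro add_mono divide_right_mono mult_left_mono) auto
  finally show ?thesis by (simp only: b_def)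
qed

text \<open>The differences of mean and variance factor out of the sum over coordinates and tend to
  zero, while the averages of \<open>L\<close> and \<open>U\<close> converge by induction;
  \<open>small_limit\<close> then removes \<open>\<kappa>\<close>. Positivity of the limiting noise
  level keeps the quotients by \<open>sL v\<close> meaningful.\<close>

lemma smooth_part:
  assumes v: "ismm v" and lln: "lln v" and rs: "rank_stable v" and t: "tL v > 0"
    and c\<psi>: "ctrl ex (Gb (Suc v)) \<psi>" and \<psi>: "\<psi> \<in> borel_measurable (PiM (Gb (Suc v)) (\<lambda>_. borel))"
  shows "AE \<omega> in M. (\<lambda>n. (\<Sum>\<alpha><n. Psi v \<psi> (st n \<omega> v \<alpha>) (cn n \<omega> v) (sn n \<omega> v) -
      Psi v \<psi> (st n \<omega> v \<alpha>) (cL v) (sL v)) / real n) \<longlonglongrightarrow> 0"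
proof -
  obtain K where K: "K \<ge> 0"
    "\<And>z c s k. z \<in> extensional (Gb v) \<Longrightarrow> (\<And>i. i \<in> Gb v \<Longrightarrow> \<bar>c i\<bar> \<le> Bd v) \<Longrightarrow> \<bar>s\<bar> \<le> Bd v \<Longrightarrow>
      integrable std_gauss (\<lambda>t. \<psi> (ext v z c s t) ^ k) \<and>
      (\<integral>t. \<bar>\<psi> (ext v z c s t) ^ k\<bar> \<partial>std_gauss) \<le>
        exp (real k * K * growth ex (Gb v) z) * (\<integral>t. exp (real k * K * \<bar>t\<bar> powr ex) \<partial>std_gauss)"
    by (rule ext_bounds[OF v Bd(1)[of v] c\<psi> \<psi>]) blast
  define U where "U = (\<lambda>z. exp (real 2 * K * growth ex (Gb v) z) * (\<integral>t. exp (real 2 * K * \<bar>t\<bar> powr ex) \<partial>std_gauss))"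
  have Uc: "ctrl ex (Gb v) U" and Um: "U \<in> borel_measurable (PiM (Gb v) (\<lambda>_. borel))"
    unfolding U_def by (rule envelope_ctrl)+
  define L where "L = (\<lambda>z :: nat \<Rightarrow> real. (\<Sum>i\<in>Gb v. \<bar>z i\<bar>)\<^sup>2)"
  have Lc: "ctrl ex (Gb v) L"
    unfolding L_def using ex by (intro ctrl_power ctrl_sum ctrl_abs ctrl_coord) auto
  have Lm: "L \<in> borel_measurable (PiM (Gb v) (\<lambda>_. borel))" unfolding L_def by measurable
  have s0: "sL v > 0" using sg_pos[OF v] t by (simp add: sL_def)
  define av where "av g n \<omega> = (\<Sum>\<alpha><n. g (st n \<omega> v \<alpha>)) / real n" for g :: "(nat \<Rightarrow> real) \<Rightarrow> real" and n \<omega>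
  have "AE \<omega> in M. (\<lambda>n. av U n \<omega>) \<longlonglongrightarrow> (\<integral>z. U z \<partial>\<gamma> v)" "AE \<omega> in M. (\<lambda>n. av L n \<omega>) \<longlonglongrightarrow> (\<integral>z. L z \<partial>\<gamma> v)"
    using lln Uc Um Lc Lm unfolding lln_def av_def by blast+
  then show ?thesis using cn_sn_tendsto[OF v lln rs]
  proof eventually_elim
    case (elim \<omega>)
    have cl: "(\<lambda>n. cn n \<omega> v i) \<longlonglongrightarrow> cL v i" for i using elim(3) by blast
    have sl: "(\<lambda>n. sn n \<omega> v) \<longlonglongrightarrow> sL v" using elim(3) by blast
    have bd: "\<forall>\<^sub>F n in sequentially. (\<forall>i\<in>Gb v. \<bar>cn n \<omega> v i\<bar> \<le> Bd v) \<and> \<bar>sn n \<omega> v\<bar> \<le> Bd v" using elim(3) by blast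
    have sp: "\<forall>\<^sub>F n in sequentially. sn n \<omega> v > 0" using sl s0 by (rule order_tendstoD)
    \<comment> \<open>\<open>q\<close> is the contribution of the noise level, \<open>d\<close> that
      of the regression coefficients; both vanish at the limiting values.\<close>
    define q where "q = (\<lambda>n. 2 * (1 - sqrt (2 * (sn n \<omega> v / sL v) / (1 + (sn n \<omega> v / sL v)\<^sup>2))))"
    define d where "d = (\<lambda>n. ((\<Sum>i\<in>Gb v. \<bar>cn n \<omega> v i - cL v i\<bar>) / sL v)\<^sup>2)"
    have "(\<lambda>n. sn n \<omega> v / sL v) \<longlonglongrightarrow> sL v / sL v" using s0 by (intro tendsto_divide sl tendsto_const) auto
    then have b1: "(\<lambda>n. sn n \<omega> v / sL v) \<longlonglongrightarrow> 1" using s0 by simp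
    have "q \<longlonglongrightarrow> 2 * (1 - sqrt (2 * 1 / (1 + 1\<^sup>2)))"
      unfolding q_def by (intro tendsto_intros b1) simp
    then have q0: "q \<longlonglongrightarrow> 0" by simp
    have "d \<longlonglongrightarrow> ((\<Sum>i\<in>Gb v. \<bar>cL v i - cL v i\<bar>) / sL v)\<^sup>2"
      unfolding d_def using s0 by (intro tendsto_intros cl) auto
    then have d0: "d \<longlonglongrightarrow> 0" by simp
    show ?case
    proof (rule small_limit)
      have "(\<lambda>n. q n + d n * av L n \<omega>) \<longlonglongrightarrow> 0 + 0 * (\<integral>z. L z \<partial>\<gamma> v)"
        by (intro tendsto_add tendsto_mult q0 d0 elim)
      then show "(\<lambda>n. q n + d n * av L n \<omega>) \<longlonglongrightarrow> 0" by simp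
      show "(\<lambda>n. 2 * av U n \<omega>) \<longlonglongrightarrow> 2 * (\<integral>z. U z \<partial>\<gamma> v)"
        by (intro tendsto_mult tendsto_const elim)
      fix \<kappa> :: real assume k: "\<kappa> > 0"
      show "\<forall>\<^sub>F n in sequentially. \<bar>(\<Sum>\<alpha><n. Psi v \<psi> (st n \<omega> v \<alpha>) (cn n \<omega> v) (sn n \<omega> v) -
          Psi v \<psi> (st n \<omega> v \<alpha>) (cL v) (sL v)) / real n\<bar> \<le> (q n + d n * av L n \<omega>) / (2 * \<kappa>) + \<kappa> * (2 * av U n \<omega>)"
        using bd sp eventually_gt_at_top[of 0]
      proof eventually_elim
        case (elim n)
        have n: "real n > 0" using elim by simp
        have one: "\<bar>Psi v \<psi> z (cn n \<omega> v) (sn n \<omega> v) - Psi v \<psi> z (cL v) (sL v)\<bar> \<le> (q n + d n * L z) / (2 * \<kappa>) + \<kappa> * (2 * U z)"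
          if z: "z \<in> extensional (Gb v)" for z
          unfolding q_def d_def L_def
        proof (rule Psi_perturbation[OF z v \<psi> s0 elim(2) k])
          show "integrable std_gauss (\<lambda>t. \<psi> (ext v z (cL v) (sL v) t))" "integrable std_gauss (\<lambda>t. (\<psi> (ext v z (cL v) (sL v) t))\<^sup>2)"
            "(\<integral>t. (\<psi> (ext v z (cL v) (sL v) t))\<^sup>2 \<partial>std_gauss) \<le> U z"
            using K(2)[of z "cL v" "sL v" 1, OF z Bd(2,3)]
              K(2)[of z "cL v" "sL v" 2, OF z Bd(2,3)] by (auto simp: U_def)
          show "integrable std_gauss (\<lambda>t. \<psi> (ext v z (cn n \<omega> v) (sn n \<omega> v) t))" "integrable std_gauss (\<lambda>t. (\<psi> (ext v z (cn n \<omega> v) (sn n \<omega> v) t))\<^sup>2)"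
            "(\<integral>t. (\<psi> (ext v z (cn n \<omega> v) (sn n \<omega> v) t))\<^sup>2 \<partial>std_gauss) \<le> U z"
            using K(2)[of z "cn n \<omega> v" "sn n \<omega> v" 1, OF z] K(2)[of z "cn n \<omega> v" "sn n \<omega> v" 2, OF z] elim(1) by (auto simp: U_def)
        qed
        have "\<bar>(\<Sum>\<alpha><n. Psi v \<psi> (st n \<omega> v \<alpha>) (cn n \<omega> v) (sn n \<omega> v) - Psi v \<psi> (st n \<omega> v \<alpha>) (cL v) (sL v))\<bar>
          \<le> (\<Sum>\<alpha><n. (q n + d n * L (st n \<omega> v \<alpha>)) / (2 * \<kappa>) + \<kappa> * (2 * U (st n \<omega> v \<alpha>)))"
          by (rule order_trans[OF sum_abs]) (intro sum_mono one st_extensional)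
        also have "\<dots> = (real n * q n + d n * (\<Sum>\<alpha><n. L (st n \<omega> v \<alpha>))) / (2 * \<kappa>) + \<kappa> * (2 * (\<Sum>\<alpha><n. U (st n \<omega> v \<alpha>)))"
          by (simp add: sum.distrib sum_distrib_left sum_divide_distrib[symmetric])
        finally have "\<bar>(\<Sum>\<alpha><n. Psi v \<psi> (st n \<omega> v \<alpha>) (cn n \<omega> v) (sn n \<omega> v) - Psi v \<psi> (st n \<omega> v \<alpha>) (cL v) (sL v))\<bar> / real n
          \<le> ((real n * q n + d n * (\<Sum>\<alpha><n. L (st n \<omega> v \<alpha>))) / (2 * \<kappa>) + \<kappa> * (2 * (\<Sum>\<alpha><n. U (st n \<omega> v \<alpha>)))) / real n"
          using n by (intro divide_right_mono) auto
        also have "\<dots> = (q n + d n * av L n \<omega>) / (2 * \<kappa>) + \<kappa> * (2 * av U n \<omega>)"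
          using n k by (simp add: av_def field_simps)
        finally show ?case using n by simp
      qed
    qed
  qed
qed

lemma lln_step:
  assumes v: "ismm v" and lln: "lln v" and rs: "rank_stable v" and t: "tL v > 0"
  shows "lln (Suc v)"
  unfolding lln_def
proof (intro allI impI)
  fix \<psi> assume c\<psi>: "ctrl ex (Gb (Suc v)) \<psi>" and \<psi>: "\<psi> \<in> borel_measurable (PiM (Gb (Suc v)) (\<lambda>_. borel))"
  interpret pr: pair_sigma_finite "\<gamma> v" std_gauss ..
  let ?P = "\<lambda>z. Psi v \<psi> z (cL v) (sL v)"
  obtain K where K: "K \<ge> 0"
    "\<And>z c s k. z \<in> extensional (Gb v) \<Longrightarrow> (\<And>i. i \<in> Gb v \<Longrightarrow> \<bar>c i\<bar> \<le> Bd v) \<Longrightarrow> \<bar>s\<bar> \<le> Bd v \<Longrightarrow>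
      integrable std_gauss (\<lambda>t. \<psi> (ext v z c s t) ^ k) \<and>
      (\<integral>t. \<bar>\<psi> (ext v z c s t) ^ k\<bar> \<partial>std_gauss) \<le>
        exp (real k * K * growth ex (Gb v) z) * (\<integral>t. exp (real k * K * \<bar>t\<bar> powr ex) \<partial>std_gauss)"
    by (rule ext_bounds[OF v Bd(1)[of v] c\<psi> \<psi>]) blast
  have "ctrl ex (Gb v) ?P"
  proof (rule ctrl_le[OF envelope_ctrl(1)])
    fix z :: "nat \<Rightarrow> real" assume z: "z \<in> extensional (Gb v)"
    have "\<bar>?P z\<bar> \<le> (\<integral>t. \<bar>\<psi> (ext v z (cL v) (sL v) t)\<bar> \<partial>std_gauss)"
      unfolding Psi_def by (rule integral_abs_bound)
    also have "\<dots> \<le> exp (real 1 * K * growth ex (Gb v) z) * (\<integral>t. exp (real 1 * K * \<bar>t\<bar> powr ex) \<partial>std_gauss)"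
      using K(2)[of z "cL v" "sL v" 1, OF z Bd(2,3)] by simp
    finally show "\<bar>?P z\<bar> \<le> \<bar>exp (real 1 * K * growth ex (Gb v) z) * (\<integral>t. exp (real 1 * K * \<bar>t\<bar> powr ex) \<partial>std_gauss)\<bar>"
      by linarith
  qed
  moreover have "?P \<in> borel_measurable (PiM (Gb v) (\<lambda>_. borel))"
    by (rule Psi_measurable[OF v _ _ _ \<psi>]) auto
  ultimately have 1: "AE \<omega> in M. (\<lambda>n. (\<Sum>\<alpha><n. ?P (st n \<omega> v \<alpha>)) / real n) \<longlonglongrightarrow> (\<integral>z. ?P z \<partial>\<gamma> v)"
    using lln unfolding lln_def by blast
  have e: "(\<lambda>x. ext v (fst x) (cL v) (sL v) (snd x)) \<in> measurable (\<gamma> v \<Otimes>\<^sub>M std_gauss) (PiM (Gb (Suc v)) (\<lambda>_. borel))"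
    unfolding cL_def[abs_def] by (rule ext_pair_measurable[OF v])
  have g: "\<gamma> (Suc v) = distr (\<gamma> v \<Otimes>\<^sub>M std_gauss) (PiM (Gb (Suc v)) (\<lambda>_. borel)) (\<lambda>x. ext v (fst x) (cL v) (sL v) (snd x))"
    using \<gamma>_Suc_ext[OF v] by (simp add: cL_def[abs_def] sL_def)
  have "integrable (\<gamma> (Suc v)) \<psi>" using c\<psi> \<psi> by (rule integrable_\<gamma>)
  then have int: "integrable (\<gamma> v \<Otimes>\<^sub>M std_gauss) (\<lambda>x. \<psi> (ext v (fst x) (cL v) (sL v) (snd x)))"
    unfolding g using e \<psi> by (subst (asm) integrable_distr_eq) auto
  have "(\<integral>z. \<psi> z \<partial>\<gamma> (Suc v)) = (\<integral>x. \<psi> (ext v (fst x) (cL v) (sL v) (snd x)) \<partial>(\<gamma> v \<Otimes>\<^sub>M std_gauss))"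
    unfolding g by (rule integral_distr[OF e \<psi>])
  also have "\<dots> = (\<integral>z. ?P z \<partial>\<gamma> v)"
    unfolding Psi_def using int by (subst pr.integral_fst'[symmetric]) auto
  finally have lim: "(\<integral>z. ?P z \<partial>\<gamma> v) = (\<integral>z. \<psi> z \<partial>\<gamma> (Suc v))" ..
  \<comment> \<open>The average splits into fluctuation around the conditional means, change to the
    limiting coefficients, and the average of a fixed controlled function of the past.\<close>
  from 1 fluctuation[OF v lln rs c\<psi> \<psi>] smooth_part[OF v lln rs t c\<psi> \<psi>]
  show "AE \<omega> in M. (\<lambda>n. (\<Sum>\<alpha><n. \<psi> (st n \<omega> (Suc v) \<alpha>)) / real n) \<longlonglongrightarrow> (\<integral>z. \<psi> z \<partial>\<gamma> (Suc v))"
  proof eventually_elim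
    case (elim \<omega>)
    from tendsto_add[OF tendsto_add[OF elim(2,3)] elim(1)] show ?case
      unfolding lim by (simp add: sum_subtractf diff_divide_distrib)
  qed
qed

theorem lln_rank_stable:
  assumes "m \<le> v" "v \<le> nv"
  shows "lln v \<and> rank_stable v"
  using assms
proof (induction v rule: dec_induct)
  case base show ?case using lln_base rank_stable_base by blast
next
  case (step v)
  then have IH: "lln v" "rank_stable v" by auto
  show ?case
  proof (cases "ismm v")
    case False
    then have e: "Gb (Suc v) = Gb v" "\<gamma> (Suc v) = \<gamma> v" using \<gamma>_Suc_not_mm step.hyps by auto
    show ?thesis using IH unfolding lln_def rank_stable_def st_def e by blast
  next
    case True
    have "tL v \<ge> 0" using psd_Q[OF True] by (simp add: tL_def psd_def)
    then consider "tL v = 0" | "tL v > 0" by linarith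
    then show ?thesis
      using step_degenerate[OF True IH] lln_step[OF True IH] rank_stable_step[OF True IH] by cases auto
  qed
qed

end

section \<open>One exponent for the whole program\<close>

lemma ctrl_of_controlled:
  assumes f: "controlled (length args) f" and args: "set args \<subseteq> I" and I: "finite I"
  shows "\<exists>q<2. \<forall>p. q \<le> p \<longrightarrow> 1 \<le> p \<longrightarrow> p < 2 \<longrightarrow> ctrl p I (\<lambda>z. f (map z args))"
proof -
  obtain C c \<epsilon> where C: "C > 0" "c > 0" "\<epsilon> > 0" "\<epsilon> < 2"
    "\<And>x. length x = length args \<Longrightarrow> \<bar>f x\<bar> \<le> exp (C * list_norm x powr (2 - \<epsilon>) + c)"
    using f unfolding controlled_def by blast
  show ?thesis
  proof (intro exI[of _ "2 - \<epsilon>"] conjI allI impI)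
    show "2 - \<epsilon> < 2" using C by simp
    fix p :: real assume p: "2 - \<epsilon> \<le> p" "1 \<le> p" "p < 2"
    \<comment> \<open>\<open>args\<close> may contain repetitions, so a coordinate is counted up to
      \<open>?n\<close> times.\<close>
    let ?n = "real (length args)"
    obtain D where D: "D \<ge> 0"
      "\<And>b l z. \<bar>b\<bar> \<le> ?n \<Longrightarrow> (\<And>k. k \<in> I \<Longrightarrow> \<bar>l k\<bar> \<le> ?n) \<Longrightarrow> \<bar>b + (\<Sum>k\<in>I. l k * z k)\<bar> powr p \<le> D * growth p I z"
      by (rule affine_powr_le[OF I, of p ?n]) (use p in auto)
    show "ctrl p I (\<lambda>z. f (map z args))"
    proof (rule ctrlI[of "C * (1 + D) + c"])
      fix z :: "'a \<Rightarrow> real"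
      let ?x = "map z args" and ?g = "growth p I z"
      have "list_norm ?x \<le> (\<Sum>i\<in>I. ?n * \<bar>z i\<bar>)"
      proof -
        have S: "(\<Sum>t\<leftarrow>xs. t\<^sup>2) \<le> (\<Sum>t\<leftarrow>xs. \<bar>t\<bar>)\<^sup>2 \<and> 0 \<le> (\<Sum>t\<leftarrow>xs. \<bar>t\<bar>)" for xs :: "real list"
        proof (induction xs)
          case (Cons x xs)
          then have "0 \<le> 2 * \<bar>x\<bar> * (\<Sum>t\<leftarrow>xs. \<bar>t\<bar>)" by (intro mult_nonneg_nonneg) auto
          moreover have "(\<Sum>t\<leftarrow>x # xs. \<bar>t\<bar>)\<^sup>2 = x\<^sup>2 + (\<Sum>t\<leftarrow>xs. \<bar>t\<bar>)\<^sup>2 + 2 * \<bar>x\<bar> * (\<Sum>t\<leftarrow>xs. \<bar>t\<bar>)"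
            by (simp add: power2_sum)
          moreover have "(\<Sum>t\<leftarrow>x # xs. t\<^sup>2) = x\<^sup>2 + (\<Sum>t\<leftarrow>xs. t\<^sup>2)" "0 \<le> (\<Sum>t\<leftarrow>x # xs. \<bar>t\<bar>)"
            using Cons by auto
          ultimately show ?case using Cons by linarith
        qed simp
        have "list_norm ?x \<le> (\<Sum>t\<leftarrow>?x. \<bar>t\<bar>)"
          unfolding list_norm_def by (rule real_le_lsqrt) (use S[of ?x] in blast)+
        also have "\<dots> = (\<Sum>i\<leftarrow>args. \<bar>z i\<bar>)" by (simp add: comp_def)
        also have "\<dots> \<le> (\<Sum>i\<leftarrow>args. \<Sum>i\<in>I. \<bar>z i\<bar>)"
          using args I by (intro sum_list_mono member_le_sum) auto
        also have "\<dots> = (\<Sum>i\<in>I. ?n * \<bar>z i\<bar>)" by (simp add: sum_list_triv sum_distrib_left)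
        finally show ?thesis .
      qed
      moreover have "0 \<le> list_norm ?x" unfolding list_norm_def by (intro real_sqrt_ge_zero sum_list_nonneg) auto
      \<comment> \<open>The coefficients \<open>?n * sgn (z i)\<close> depend on \<open>z\<close>,
        which is allowed because the constant of \<open>affine_powr_le\<close> is uniform in
        them.\<close>
      moreover have "(\<Sum>i\<in>I. ?n * \<bar>z i\<bar>) = (\<Sum>i\<in>I. (?n * sgn (z i)) * z i)"
        by (intro sum.cong refl) (simp add: abs_sgn mult.commute)
      then have "(\<Sum>i\<in>I. ?n * \<bar>z i\<bar>) \<le> \<bar>0 + (\<Sum>i\<in>I. (?n * sgn (z i)) * z i)\<bar>" by simp
      ultimately have "list_norm ?x powr p \<le> \<bar>0 + (\<Sum>i\<in>I. (?n * sgn (z i)) * z i)\<bar> powr p"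
        using p by (intro powr_mono2) auto
      also have "\<dots> \<le> D * ?g"
        by (rule D) (auto simp: abs_mult abs_sgn_eq)
      finally have n: "list_norm ?x powr p \<le> D * ?g" .
      have "list_norm ?x powr (2 - \<epsilon>) \<le> 1 + list_norm ?x powr p"
      proof (cases "list_norm ?x \<le> 1")
        case True
        then have "list_norm ?x powr (2 - \<epsilon>) \<le> 1 powr (2 - \<epsilon>)"
          using C \<open>0 \<le> list_norm ?x\<close> by (intro powr_mono2) auto
        then show ?thesis by (simp add: add_increasing2)
      next
        case False
        then have "list_norm ?x powr (2 - \<epsilon>) \<le> list_norm ?x powr p" using p by (intro powr_mono) auto
        then show ?thesis by simp
      qed
      also have "\<dots> \<le> (1 + D) * ?g" using n growth_ge_1[of p I z] by (simp add: algebra_simps)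
      finally have "C * list_norm ?x powr (2 - \<epsilon>) + c \<le> C * ((1 + D) * ?g) + c * ?g"
        using C growth_ge_1[of p I z] by (intro add_mono mult_left_mono) auto
      then have "exp (C * list_norm ?x powr (2 - \<epsilon>) + c) \<le> exp ((C * (1 + D) + c) * ?g)"
        by (simp add: algebra_simps)
      moreover have "\<bar>f ?x\<bar> \<le> exp (C * list_norm ?x powr (2 - \<epsilon>) + c)" by (rule C(5)) simp
      ultimately show "\<bar>f ?x\<bar> \<le> exp ((C * (1 + D) + c) * ?g)" by (rule order_trans[rotated])
    qed (use C D in simp)
  qed
qed

text \<open>If a G-variable is multiplied, \<open>\<phi> v\<close> is a coordinate projection and
  every exponent from 1 on works; otherwise it is a nonlinearity of the program.\<close>

lemma (in netsor) \<phi>_ctrl_exponent: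
  assumes v: "ismm v"
  shows "\<exists>q<2. \<forall>p. q \<le> p \<longrightarrow> 1 \<le> p \<longrightarrow> p < 2 \<longrightarrow> ctrl p (Gb v) (\<phi> v)"
proof -
  note vD = ismmD[OF v]
  have sub: "Gb (Suc (arg v)) \<subseteq> Gb v" using vD(5) by (intro Gb_mono) simp
  have "arg v < nv" using vD by simp
  then show ?thesis
  proof (cases rule: instr_cases)
    case (3 f args)
    have "\<phi> v = (\<lambda>z. f (map z args))" using hexpr_nonlin[OF 3(1,2)] by (auto simp: \<phi>_def)
    moreover have "set args \<subseteq> Gb v" "controlled (length args) f"
      using wf_nonlin[OF 3(1) \<open>arg v < nv\<close> 3(2)] sub Gb_mono[of "arg v" "Suc (arg v)"] by auto
    ultimately show ?thesis using ctrl_of_controlled[OF _ _ finite_Gb] by simp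
  next
    case 1
    have "\<phi> v = (\<lambda>z. z (arg v))" using hexpr_G 1 by (auto simp: \<phi>_def)
    then show ?thesis using sub 1 by (intro exI[of _ 1]) (auto simp: Gb_Suc intro!: ctrl_coord)
  next
    case 2
    have "\<phi> v = (\<lambda>z. z (arg v))" using hexpr_G 2 by (auto simp: \<phi>_def)
    then show ?thesis using sub 2 by (intro exI[of _ 1]) (auto simp: Gb_Suc intro!: ctrl_coord)
  qed
qed

theorem mainTheorem7:
  fixes M :: "'w measure" and m nA :: nat and ps :: "instr list"
    and mu_in :: "nat \<Rightarrow> real" and S_in :: "nat \<Rightarrow> nat \<Rightarrow> real" and sW2 :: "nat \<Rightarrow> real"
    and W :: "nat \<Rightarrow> nat \<Rightarrow> 'w \<Rightarrow> nat \<Rightarrow> nat \<Rightarrow> real"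
    and X :: "nat \<Rightarrow> 'w \<Rightarrow> nat \<Rightarrow> nat \<Rightarrow> real"
    and \<psi> :: "real list \<Rightarrow> real"
  assumes "prob_space M"
    and "wf_prog m nA ps"
    and "\<forall>a<nA. sW2 a > 0"
    and "cov_matrix {..<m} S_in"
    and "\<forall>n\<ge>1. sampled M n m nA mu_in S_in sW2 (W n) (X n)"
    and "controlled (length (gvars ps m)) \<psi>"
    and "borel_fun (length (gvars ps m)) \<psi>"
  shows "AE \<omega> in M.
     (\<lambda>n. (\<Sum>\<alpha><n. \<psi> (map (\<lambda>g. (prog_vals ps m n (\<lambda>a. W n a \<omega>) (X n \<omega>) ! g) \<alpha>) (gvars ps m))) / real n)
     \<longlonglongrightarrow> (\<integral>z. \<psi> (map z (gvars ps m))
            \<partial>gaussian_vec (set (gvars ps m)) (mu_lim m mu_in) (Sigma_lim ps m mu_in S_in sW2))"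
proof -
  interpret P: netsor M m nA ps mu_in S_in sW2 W X
    using assms by (auto simp: netsor_def netsor_axioms_def)
  let ?gs = "gvars ps m"
  have gs: "set ?gs = P.Gb P.nv" by (auto simp: gvars_def P.Gb_def Gbelow_def P.nv_def)
  obtain q0 where q0: "q0 < 2" "\<And>p. q0 \<le> p \<Longrightarrow> 1 \<le> p \<Longrightarrow> p < 2 \<Longrightarrow> ctrl p (P.Gb P.nv) (\<lambda>z. \<psi> (map z ?gs))"
    using ctrl_of_controlled[OF assms(6), of "P.Gb P.nv"] gs by auto
  obtain q where q: "\<And>v. P.ismm v \<Longrightarrow> q v < 2" "\<And>v p. P.ismm v \<Longrightarrow> q v \<le> p \<Longrightarrow> 1 \<le> p \<Longrightarrow> p < 2 \<Longrightarrow> ctrl p (P.Gb v) (P.\<phi> v)"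
    using P.\<phi>_ctrl_exponent by metis
  have fin: "finite {v. P.ismm v}" by (rule finite_subset[of _ "{..<P.nv}"]) (auto dest: P.ismmD)
  \<comment> \<open>Finitely many thresholds below 2 have a maximum below 2. The element 1 enforces
    the lower bound on the exponent, \<open>q0\<close> belongs to the test function.\<close>
  define F where "F = {1, q0} \<union> q ` {v. P.ismm v}"
  have F: "finite F" "F \<noteq> {}" using fin by (auto simp: F_def)
  define p where "p = Max F"
  have p: "1 \<le> p" "q0 \<le> p" "\<And>v. P.ismm v \<Longrightarrow> q v \<le> p"
    unfolding p_def by (rule Max_ge[OF F(1)]; simp add: F_def)+
  have p2: "p < 2" unfolding p_def Max_less_iff[OF F] using q0 q by (auto simp: F_def)
  interpret P: netsor_ctrl M m nA ps mu_in S_in sW2 W X p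
    by unfold_locales (use p p2 q in auto)
  have "P.lln P.nv" using P.lln_rank_stable[of P.nv] by (simp add: P.nv_def)
  moreover have "ctrl p (P.Gb P.nv) (\<lambda>z. \<psi> (map z ?gs))" using q0 p p2 by simp
  moreover have "(\<lambda>z. \<psi> (map z ?gs)) \<in> borel_measurable (PiM (P.Gb P.nv) (\<lambda>_. borel))"
    using assms(7) gs by (intro borel_fun_map_measurable) auto
  ultimately have "AE \<omega> in M. (\<lambda>n. (\<Sum>\<alpha><n. \<psi> (map (P.st n \<omega> P.nv \<alpha>) ?gs)) / real n) \<longlonglongrightarrow> (\<integral>z. \<psi> (map z ?gs) \<partial>P.\<gamma> P.nv)"
    unfolding P.lln_def by blast
  moreover have "map (P.st n \<omega> P.nv \<alpha>) ?gs = map (\<lambda>g. (prog_vals ps m n (\<lambda>a. W n a \<omega>) (X n \<omega>) ! g) \<alpha>) ?gs" for n \<omega> \<alpha>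
    using gs by (auto simp: P.st_def P.val_def)
  moreover have "P.\<gamma> P.nv = gaussian_vec (set ?gs) (mu_lim m mu_in) (Sigma_lim ps m mu_in S_in sW2)"
    unfolding gs by (simp add: P.\<gamma>_def P.mu_def P.Sg_def Sigma_lim_def P.nv_def)
  ultimately show ?thesis by simp
qed

end
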